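(* Let $X$ be a standard Brownian motion. For $\epsilon>0$ and $t\ge0$ define $$I^{3,1}_\epsilon(t)=\frac1\epsilon\int_0^tX_{(u+\epsilon)\wedge t}^-\mathbf 1_{\{X_u>0\}}du,\qquad I^{3,2}_\epsilon(t)=\frac1\epsilon\int_0^tX_{(u+\epsilon)\wedge t}^+\mathbf 1_{\{X_u<0\}}du,$$ $$I^{4,1}_\epsilon(t)=\frac1\epsilon\int_0^tX_u^-\mathbf 1_{\{X_{(u+\epsilon)\wedge t}>0\}}du,\qquad I^{4,2}_\epsilon(t)=\frac1\epsilon\int_0^tX_u^+\mathbf 1_{\{X_{(u+\epsilon)\wedge t}<0\}}du.$$ Then: 1. $\displaystyle\lim_{\epsilon\to0}\ (ucp)\ I^{3,1}_\epsilon(t)=\lim_{\epsilon\to0}\ (ucp)\ I^{3,2}_\epsilon(t)=\tfrac14L_t^0(X).$ 2. $\displaystyle\lim_{\epsilon\to0}\ (ucp)\ I^{4,1}_\epsilon(t)=\lim_{\epsilon\to0}\ (ucp)\ I^{4,2}_\epsilon(t)=\tfrac14L_t^0(X).$ Moreover, for all $T>0$ and $\delta\in(0,\frac12)$ there exists a constant $C$ such that for all $\epsilon\in(0,1]$, $$\left\|\sup_{t\in[0,T]}\left|I^{4,i}_\epsilon(t)-\tfrac14L_t^0(X)\right|\right\|_{L^2(\Omega)}\le C\,\epsilon^{\delta/2},\qquad i=1\text{ or }2.$$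
   Context: Notation: $y^+=\max(y,0)$, $y^-=\max(-y,0)$, $a\wedge b=\min(a,b)$. Convergence (ucp) means convergence in probability, uniformly in $t$ on compact time intervals. $(L_t^x(X))_{x\in\mathbb{R},t\ge0}$ is the (continuous) local time family of Brownian motion, normalized by $\int_0^t g(X_s)\,ds=\int_{\mathbb{R}}g(x)L_t^x(X)\,dx$ for all non-negative Borel $g$; thus $X_t^+=\int_0^t\mathbf 1_{\{X_s>0\}}dX_s+\frac12L_t^0(X)$. *)

theory Defs
  imports "HOL-Probability.Probability"
begin

text \<open>Processes are functions of type \<open>real \<Rightarrow> 'a \<Rightarrow> real\<close>, of which only the values at times
  \<open>t \<ge> 0\<close> matter. Paths are continuous for every \<open>\<omega>\<close>, so that pathwise suprema over
  \<open>[0,T]\<close> are random variables without completing the probability space.\<close>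

locale standard_brownian_motion = prob_space M
  for M :: "'a measure" and X :: "real \<Rightarrow> 'a \<Rightarrow> real" +
  assumes random_variable_BM: "\<And>t. 0 \<le> t \<Longrightarrow> random_variable borel (X t)"
    and BM_start: "AE \<omega> in M. X 0 \<omega> = 0"
    and BM_indep_increments: "\<And>(\<tau> :: nat \<Rightarrow> real) n. 0 \<le> \<tau> 0 \<Longrightarrow> mono \<tau> \<Longrightarrow>
      indep_vars (\<lambda>_. borel) (\<lambda>i \<omega>. X (\<tau> (Suc i)) \<omega> - X (\<tau> i) \<omega>) {..<n}"
    and BM_increments: "\<And>s t. 0 \<le> s \<Longrightarrow> s < t \<Longrightarrow>
      distributed M lborel (\<lambda>\<omega>. X t \<omega> - X s \<omega>) (normal_density 0 (sqrt (t - s)))"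
    and BM_continuous: "\<And>\<omega>. \<omega> \<in> space M \<Longrightarrow> continuous_on {0..} (\<lambda>t. X t \<omega>)"

text \<open>\<open>L x t\<close> is the local time at level \<open>x\<close> up to time \<open>t\<close>. Continuity and the occupation
  time formula determine the family up to indistinguishability and fix its normalization.\<close>

definition local_time_family ::
    "'a measure \<Rightarrow> (real \<Rightarrow> 'a \<Rightarrow> real) \<Rightarrow> (real \<Rightarrow> real \<Rightarrow> 'a \<Rightarrow> real) \<Rightarrow> bool" where
  "local_time_family M X L \<longleftrightarrow>
     (\<forall>x. \<forall>t\<ge>0. L x t \<in> borel_measurable M) \<and>
     (\<forall>\<omega>\<in>space M. \<forall>x. \<forall>t\<ge>0. 0 \<le> L x t \<omega>) \<and>
     (\<forall>\<omega>\<in>space M. continuous_on (UNIV \<times> {0..}) (\<lambda>(x, t). L x t \<omega>)) \<and>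
     (AE \<omega> in M. \<forall>t\<ge>0. \<forall>g :: real \<Rightarrow> ennreal. g \<in> borel_measurable borel \<longrightarrow>
        (\<integral>\<^sup>+ s\<in>{0..t}. g (X s \<omega>) \<partial>lborel) = (\<integral>\<^sup>+ x. g x * ennreal (L x t \<omega>) \<partial>lborel))"

definition pos_part :: "real \<Rightarrow> real" where "pos_part y = max y 0"

definition neg_part :: "real \<Rightarrow> real" where "neg_part y = max (- y) 0"

definition I31 :: "(real \<Rightarrow> 'a \<Rightarrow> real) \<Rightarrow> real \<Rightarrow> real \<Rightarrow> 'a \<Rightarrow> real" where
  "I31 X \<epsilon> t \<omega> =
     1 / \<epsilon> * (LINT u:{0..t}|lborel. neg_part (X (min (u + \<epsilon>) t) \<omega>) * indicator {0<..} (X u \<omega>))"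

definition I32 :: "(real \<Rightarrow> 'a \<Rightarrow> real) \<Rightarrow> real \<Rightarrow> real \<Rightarrow> 'a \<Rightarrow> real" where
  "I32 X \<epsilon> t \<omega> =
     1 / \<epsilon> * (LINT u:{0..t}|lborel. pos_part (X (min (u + \<epsilon>) t) \<omega>) * indicator {..<0} (X u \<omega>))"

definition I41 :: "(real \<Rightarrow> 'a \<Rightarrow> real) \<Rightarrow> real \<Rightarrow> real \<Rightarrow> 'a \<Rightarrow> real" where
  "I41 X \<epsilon> t \<omega> =
     1 / \<epsilon> * (LINT u:{0..t}|lborel. neg_part (X u \<omega>) * indicator {0<..} (X (min (u + \<epsilon>) t) \<omega>))"

definition I42 :: "(real \<Rightarrow> 'a \<Rightarrow> real) \<Rightarrow> real \<Rightarrow> real \<Rightarrow> 'a \<Rightarrow> real" where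
  "I42 X \<epsilon> t \<omega> =
     1 / \<epsilon> * (LINT u:{0..t}|lborel. pos_part (X u \<omega>) * indicator {..<0} (X (min (u + \<epsilon>) t) \<omega>))"

definition sup_dist :: "real \<Rightarrow> (real \<Rightarrow> 'a \<Rightarrow> real) \<Rightarrow> (real \<Rightarrow> 'a \<Rightarrow> real) \<Rightarrow> 'a \<Rightarrow> ennreal" where
  "sup_dist T Y Z \<omega> = (SUP t\<in>{0..T}. ennreal \<bar>Y t \<omega> - Z t \<omega>\<bar>)"

text \<open>Since \<open>measure\<close> and the integrals give junk values on non-measurable arguments,
  measurability of the suprema is made an explicit part of the two notions below.\<close>

definition ucp_tendsto ::
    "'a measure \<Rightarrow> ('b \<Rightarrow> real \<Rightarrow> 'a \<Rightarrow> real) \<Rightarrow> (real \<Rightarrow> 'a \<Rightarrow> real) \<Rightarrow> 'b filter \<Rightarrow> bool" where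
  "ucp_tendsto M Y Z F \<longleftrightarrow> (\<forall>T>0.
     (\<forall>\<^sub>F e in F. sup_dist T (Y e) Z \<in> borel_measurable M) \<and>
     (\<forall>\<eta>>0. ((\<lambda>e. measure M {\<omega> \<in> space M. ennreal \<eta> < sup_dist T (Y e) Z \<omega>}) \<longlongrightarrow> 0) F))"

definition L2_norm :: "'a measure \<Rightarrow> ('a \<Rightarrow> ennreal) \<Rightarrow> ennreal" where
  "L2_norm M f = (let p = (\<integral>\<^sup>+ \<omega>. (f \<omega>)\<^sup>2 \<partial>M) in if p = \<top> then \<top> else ennreal (sqrt (enn2real p)))"

definition L2_norm_le :: "'a measure \<Rightarrow> ('a \<Rightarrow> ennreal) \<Rightarrow> real \<Rightarrow> bool" where
  "L2_norm_le M f c \<longleftrightarrow> f \<in> borel_measurable M \<and> L2_norm M f \<le> ennreal c"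

end

theory Submission
  imports Defs
begin

text \<open>All four integrands have the form \<open>f (X u) (X (u + \<epsilon>))\<close>, up to stopping at \<open>t\<close>. Here \<open>f x y\<close> is the
  distance of \<open>x\<close> or of \<open>y\<close> from \<open>0\<close> if \<open>x\<close> and \<open>y\<close> lie on prescribed opposite sides of \<open>0\<close>, and
  vanishes otherwise. Consequently \<open>f x y \<le> \<bar>y - x\<bar>\<close>, and \<open>f x y \<noteq> 0\<close> forces
  \<open>\<bar>x\<bar> \<le> \<bar>y - x\<bar>\<close>. The locale \<open>crossing_functional\<close> collects what is needed of \<open>f\<close>, and
  \<open>1/\<epsilon> f (X u) (X (u + \<epsilon>))\<close> is analysed once for all four cases.

  Averaging over the increment of \<open>X\<close> after time \<open>u\<close> replaces the integrand by \<open>k\<^sub>\<epsilon> (X u)\<close>, where the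
  kernel \<open>k\<^sub>\<epsilon> x = E f x (x + \<surd>\<epsilon> N) / \<epsilon>\<close>, for a standard normal variable \<open>N\<close>, lives on the scale
  \<open>\<surd>\<epsilon>\<close> and has total mass \<open>1/4\<close>: for each size \<open>z\<close> of the increment, the integral over \<open>x\<close> is the
  area \<open>z\<^sup>2/2\<close> of a triangle, for one of the two signs of \<open>z\<close>. By the occupation time formula
  \<open>\<integral>\<^sub>0\<^sup>t k\<^sub>\<epsilon> (X u) du\<close> is the integral of \<open>k\<^sub>\<epsilon>\<close> against the local times at time \<open>t\<close>, which explains
  the limit \<open>1/4 L 0 t\<close>. The distance to the limit splits into three parts.

  \<^item> Stopping the increment at \<open>t\<close> changes the integral by at most an increment of \<open>X\<close> over a time
    at most \<open>\<epsilon>\<close>, so the modulus of continuity bounds it (\<open>modulus_of_continuity\<close>).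

  \<^item> The difference between the integrand and \<open>k\<^sub>\<epsilon> (X u)\<close> has conditional mean zero, so its values at
    times more than \<open>\<epsilon>\<close> apart are uncorrelated. Its integral over \<open>[a, b]\<close> therefore has second moment
    \<open>O(\<surd>\<epsilon> (\<surd>b - \<surd>a))\<close> (\<open>deviation_increment\<close>).

  \<^item> The integral of \<open>k\<^sub>\<epsilon> (X u)\<close> is compared with the local time by telescoping along
    \<open>\<epsilon>, \<epsilon>/4, \<epsilon>/16, \<dots>\<close>. The function \<open>h = k\<^sub>\<epsilon> - k\<^bsub>\<epsilon>/4\<^esub>\<close> has integral zero and lives on the scale \<open>\<surd>\<epsilon>\<close>,
    so the heat semigroup makes it small: \<open>E h (X u) h (X v)\<close> decays fast in \<open>v - u\<close>, and for each
    \<open>\<theta> < 1\<close> the integral of \<open>h (X u)\<close> over \<open>[a, b]\<close> has second moment \<open>O(\<epsilon> powr (\<theta>/2) (\<surd>b - \<surd>a))\<close>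
    (\<open>kernel_diff_increment\<close>). These bounds are summable along the geometric sequence of scales.

  The last two bounds are additive in the time interval. Chaining over dyadic times
  (\<open>sup_sq_le_chaining\<close>), as in the theorem of Rademacher and Menshov, turns such bounds into
  mean-square bounds for the supremum over \<open>t\<close> at the cost of a factor \<open>log\<^sup>2 (1/\<epsilon>)\<close>, and the gap
  between \<open>\<delta>\<close> and \<open>1/2\<close> absorbs that factor. Both modes of convergence follow from the resulting
  estimate \<open>E sup\<^sub>t \<bar>\<dots>\<bar>\<^sup>2 \<le> C \<epsilon> powr \<delta>\<close>.

  Measurability of the supremum needs an argument of its own: the approximations of the second
  kind, \<open>I41\<close> and \<open>I42\<close>, can jump in \<open>t\<close> when \<open>X t\<close> leaves \<open>0\<close>. They are, however, increasing limits
  of processes with continuous paths, and for suprema over a compact interval this suffices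
  (\<open>sup_dist_measurable\<close>).\<close>

section \<open>Chaining over dyadic points\<close>

text \<open>A dyadic point of level \<open>m\<close> is reached from the left end by at most one increment of each level
  \<open>j \<le> m\<close>, following its binary expansion.\<close>

lemma dyadic_increment_le:
  fixes y :: "real \<Rightarrow> real" and d :: "nat \<Rightarrow> real"
  assumes d: "\<And>j k. j \<le> m \<Longrightarrow> k < 2 ^ j \<Longrightarrow>
      \<bar>y (a + h * (real (Suc k) / 2 ^ j)) - y (a + h * (real k / 2 ^ j))\<bar> \<le> d j"
    and i: "i \<le> 2 ^ m"
  shows "\<bar>y (a + h * (real i / 2 ^ m)) - y a\<bar> \<le> (\<Sum>j\<le>m. d j)"
  using d i
proof (induction m arbitrary: i)
  case 0
  from 0(1)[of 0 0] have *: "\<bar>y (a + h) - y a\<bar> \<le> d 0" by simp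
  from 0 have "i = 0 \<or> i = 1" by auto
  then show ?case using * by auto
next
  case (Suc m)
  define i' where "i' = i div 2"
  have i': "i' \<le> 2 ^ m" using Suc.prems(2) by (auto simp: i'_def)
  have IH: "\<bar>y (a + h * (real i' / 2 ^ m)) - y a\<bar> \<le> (\<Sum>j\<le>m. d j)"
    by (rule Suc.IH[OF _ i']) (use Suc.prems(1) in auto)
  have eq: "real i' / 2 ^ m = real (2 * i') / 2 ^ Suc m" by simp
  have d0: "0 \<le> d (Suc m)" using Suc.prems(1)[of "Suc m" 0] by simp
  show ?case
  proof (cases "even i")
    case True
    then have "i = 2 * i'" by (simp add: i'_def)
    then show ?thesis using IH d0 unfolding eq by simp
  next
    case False
    then have i: "i = Suc (2 * i')" by (simp add: i'_def)
    have "2 * i' < 2 ^ Suc m" using Suc.prems(2) i by linarith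
    from Suc.prems(1)[OF order_refl this]
    have "\<bar>y (a + h * (real i / 2 ^ Suc m)) - y (a + h * (real i' / 2 ^ m))\<bar> \<le> d (Suc m)"
      unfolding i eq .
    then show ?thesis using IH by simp
  qed
qed

text \<open>The Cauchy-Schwarz inequality with weights \<open>q ^ k\<close>. If the squares decay like \<open>p ^ k\<close> with
  \<open>p < q\<close>, the bound on the right stays summable; below \<open>q = \<surd>p\<close>.\<close>

lemma sum_square_le_geometric:
  fixes a :: "nat \<Rightarrow> real"
  assumes q: "0 < q" "q < 1"
  shows "(\<Sum>k<n. \<bar>a k\<bar>)\<^sup>2 \<le> (\<Sum>k<n. (a k)\<^sup>2 * (1 / ((1 - q) * q ^ k)))"
proof -
  have "(\<Sum>k<n. \<bar>a k\<bar>) = (\<Sum>k<n. sqrt (q ^ k) * (\<bar>a k\<bar> / sqrt (q ^ k)))"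
    using q by (intro sum.cong) auto
  then have "(\<Sum>k<n. \<bar>a k\<bar>)\<^sup>2 \<le> (\<Sum>k<n. (sqrt (q ^ k))\<^sup>2) * (\<Sum>k<n. (\<bar>a k\<bar> / sqrt (q ^ k))\<^sup>2)"
    using Cauchy_Schwarz_ineq_sum[of "\<lambda>k. sqrt (q ^ k)" "\<lambda>k. \<bar>a k\<bar> / sqrt (q ^ k)" "{..<n}"] by simp
  also have "\<dots> = (\<Sum>k<n. q ^ k) * (\<Sum>k<n. (a k)\<^sup>2 / q ^ k)"
    using q by (simp add: power_divide)
  also have "\<dots> \<le> (1 / (1 - q)) * (\<Sum>k<n. (a k)\<^sup>2 / q ^ k)"
  proof (rule mult_right_mono)
    have "(\<Sum>k<n. q ^ k) = (1 - q ^ n) / (1 - q)" using q by (simp add: sum_gp_strict)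
    also have "\<dots> \<le> 1 / (1 - q)" using q by (intro divide_right_mono) auto
    finally show "(\<Sum>k<n. q ^ k) \<le> 1 / (1 - q)" .
  qed (use q in \<open>auto intro!: sum_nonneg\<close>)
  also have "\<dots> = (\<Sum>k<n. (a k)\<^sup>2 * (1 / ((1 - q) * q ^ k)))"
    by (simp add: sum_distrib_left)
  finally show ?thesis .
qed

section \<open>Mean-square bounds for suprema\<close>

text \<open>Read: the expectation of \<open>sup\<^sub>t (Y t)\<^sup>2\<close> is at most \<open>c\<close>. The supremum of an uncountable family
  need not be a random variable, so the bound is put on a measurable majorant instead. The index
  set \<open>S\<close> may consist of times or of pairs of times.\<close>

definition sup_sq_le :: "'a measure \<Rightarrow> 'i set \<Rightarrow> ('i \<Rightarrow> 'a \<Rightarrow> real) \<Rightarrow> real \<Rightarrow> bool" where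
  "sup_sq_le M S Y c \<longleftrightarrow> (\<exists>U\<in>borel_measurable M.
     (AE \<omega> in M. \<forall>t\<in>S. ennreal ((Y t \<omega>)\<^sup>2) \<le> U \<omega>) \<and> (\<integral>\<^sup>+ \<omega>. U \<omega> \<partial>M) \<le> ennreal c)"

lemma sup_sq_leE:
  assumes "sup_sq_le M S Y c"
  obtains U where "U \<in> borel_measurable M" "AE \<omega> in M. \<forall>t\<in>S. ennreal ((Y t \<omega>)\<^sup>2) \<le> U \<omega>"
    "(\<integral>\<^sup>+ \<omega>. U \<omega> \<partial>M) \<le> ennreal c"
  using assms by (auto simp: sup_sq_le_def)

lemma sup_sq_le_mono:
  assumes "sup_sq_le M S Y c" "c \<le> c'"
  shows "sup_sq_le M S Y c'"
  using assms unfolding sup_sq_le_def by (meson ennreal_leI order_trans)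

lemma sup_sq_le_dominated:
  assumes Y: "sup_sq_le M S Y c" and le: "AE \<omega> in M. \<forall>t\<in>S'. \<exists>s\<in>S. \<bar>Z t \<omega>\<bar> \<le> \<bar>Y s \<omega>\<bar>"
  shows "sup_sq_le M S' Z c"
proof -
  from Y obtain U where U: "U \<in> borel_measurable M" "AE \<omega> in M. \<forall>t\<in>S. ennreal ((Y t \<omega>)\<^sup>2) \<le> U \<omega>"
    "(\<integral>\<^sup>+ \<omega>. U \<omega> \<partial>M) \<le> ennreal c" by (rule sup_sq_leE)
  have "AE \<omega> in M. \<forall>t\<in>S'. ennreal ((Z t \<omega>)\<^sup>2) \<le> U \<omega>"
    using U(2) le
  proof eventually_elim
    case (elim \<omega>)
    show ?case
    proof
      fix t assume "t \<in> S'"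
      then obtain s where s: "s \<in> S" "\<bar>Z t \<omega>\<bar> \<le> \<bar>Y s \<omega>\<bar>" using elim by blast
      then have "(Z t \<omega>)\<^sup>2 \<le> (Y s \<omega>)\<^sup>2" by (simp add: abs_le_square_iff)
      then show "ennreal ((Z t \<omega>)\<^sup>2) \<le> U \<omega>" using elim(1) s(1)
        by (meson ennreal_leI order_trans)
    qed
  qed
  with U show ?thesis unfolding sup_sq_le_def by blast
qed

lemma sup_sq_le_subset:
  assumes "sup_sq_le M S Y c" "S' \<subseteq> S"
  shows "sup_sq_le M S' Y c"
proof (rule sup_sq_le_dominated[OF assms(1)], intro AE_I2 ballI)
  fix \<omega> t assume "t \<in> S'"
  then show "\<exists>s\<in>S. \<bar>Y t \<omega>\<bar> \<le> \<bar>Y s \<omega>\<bar>" using assms(2) by (intro bexI[of _ t]) auto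
qed

lemma (in prob_space) sup_sq_le_const: "sup_sq_le M S (\<lambda>_ _. c) (c\<^sup>2)"
  unfolding sup_sq_le_def by (intro bexI[of _ "\<lambda>_. ennreal (c\<^sup>2)"]) (auto simp: emeasure_space_1)

lemma sup_sq_le_add:
  assumes Y: "sup_sq_le M S Y c" and Z: "sup_sq_le M S Z c'" and c: "0 \<le> c" "0 \<le> c'"
    and W: "AE \<omega> in M. \<forall>t\<in>S. \<bar>W t \<omega>\<bar> \<le> \<bar>Y t \<omega>\<bar> + \<bar>Z t \<omega>\<bar>"
  shows "sup_sq_le M S W (2 * c + 2 * c')"
proof -
  from Y obtain U where U[measurable]: "U \<in> borel_measurable M" and U': "AE \<omega> in M. \<forall>t\<in>S. ennreal ((Y t \<omega>)\<^sup>2) \<le> U \<omega>"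
    "(\<integral>\<^sup>+ \<omega>. U \<omega> \<partial>M) \<le> ennreal c" by (rule sup_sq_leE)
  from Z obtain V where V[measurable]: "V \<in> borel_measurable M" and V': "AE \<omega> in M. \<forall>t\<in>S. ennreal ((Z t \<omega>)\<^sup>2) \<le> V \<omega>"
    "(\<integral>\<^sup>+ \<omega>. V \<omega> \<partial>M) \<le> ennreal c'" by (rule sup_sq_leE)
  have "AE \<omega> in M. \<forall>t\<in>S. ennreal ((W t \<omega>)\<^sup>2) \<le> 2 * U \<omega> + 2 * V \<omega>"
    using U'(1) V'(1) W
  proof eventually_elim
    case (elim \<omega>)
    show ?case
    proof
      fix t assume t: "t \<in> S"
      have "(W t \<omega>)\<^sup>2 \<le> (\<bar>Y t \<omega>\<bar> + \<bar>Z t \<omega>\<bar>)\<^sup>2"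
        using elim(3) t by (metis abs_ge_zero power2_abs power_mono)
      also have "\<dots> \<le> 2 * (Y t \<omega>)\<^sup>2 + 2 * (Z t \<omega>)\<^sup>2"
        using sum_squares_bound[of "\<bar>Y t \<omega>\<bar>" "\<bar>Z t \<omega>\<bar>"] by (simp add: power2_sum)
      finally have "ennreal ((W t \<omega>)\<^sup>2) \<le> ennreal (2 * (Y t \<omega>)\<^sup>2 + 2 * (Z t \<omega>)\<^sup>2)"
        by (rule ennreal_leI)
      also have "\<dots> = 2 * ennreal ((Y t \<omega>)\<^sup>2) + 2 * ennreal ((Z t \<omega>)\<^sup>2)"
        by (simp add: ennreal_plus ennreal_mult)
      also have "\<dots> \<le> 2 * U \<omega> + 2 * V \<omega>"
        using elim(1,2) t by (intro add_mono mult_left_mono) auto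
      finally show "ennreal ((W t \<omega>)\<^sup>2) \<le> 2 * U \<omega> + 2 * V \<omega>" .
    qed
  qed
  moreover have "(\<integral>\<^sup>+ \<omega>. 2 * U \<omega> + 2 * V \<omega> \<partial>M) \<le> ennreal (2 * c + 2 * c')"
  proof -
    have "(\<integral>\<^sup>+ \<omega>. 2 * U \<omega> + 2 * V \<omega> \<partial>M) = 2 * (\<integral>\<^sup>+ \<omega>. U \<omega> \<partial>M) + 2 * (\<integral>\<^sup>+ \<omega>. V \<omega> \<partial>M)"
      by (simp add: nn_integral_add nn_integral_cmult)
    also have "\<dots> \<le> 2 * ennreal c + 2 * ennreal c'"
      using U'(2) V'(2) by (intro add_mono mult_left_mono) auto
    also have "\<dots> = ennreal (2 * c + 2 * c')"
      using c by (simp add: ennreal_plus ennreal_mult)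
    finally show ?thesis .
  qed
  ultimately show ?thesis unfolding sup_sq_le_def
    by (intro bexI[of _ "\<lambda>\<omega>. 2 * U \<omega> + 2 * V \<omega>"]) auto
qed

text \<open>Mean-square bounds that decay geometrically can be summed. The limit need not be the sum of the
  series itself: it is enough that it is approached by values \<open>z n\<close> dominated by the partial sums,
  which covers both telescoping sums and chains of dyadic increments.\<close>

lemma sup_sq_le_series:
  assumes Y: "\<And>k::nat. sup_sq_le M S (Y k) (c * p ^ k)" and p: "0 < p" "p < 1" and c: "0 \<le> c"
    and lim: "AE \<omega> in M. \<forall>t\<in>S. \<exists>z. (z \<longlonglongrightarrow> Z t \<omega>) \<and> (\<forall>n. \<bar>z n\<bar> \<le> (\<Sum>k<n. \<bar>Y k t \<omega>\<bar>))"
  shows "sup_sq_le M S Z (c / (1 - sqrt p)\<^sup>2)"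
proof -
  define q where "q = sqrt p"
  have q: "0 < q" "q < 1" and qp: "q * q = p" using p by (auto simp: q_def)
  have "\<forall>k. \<exists>U. U \<in> borel_measurable M \<and> (AE \<omega> in M. \<forall>t\<in>S. ennreal ((Y k t \<omega>)\<^sup>2) \<le> U \<omega>) \<and>
    (\<integral>\<^sup>+ \<omega>. U \<omega> \<partial>M) \<le> ennreal (c * p ^ k)"
    using Y unfolding sup_sq_le_def by blast
  from choice[OF this] obtain U where U: "\<forall>k. U k \<in> borel_measurable M \<and>
    (AE \<omega> in M. \<forall>t\<in>S. ennreal ((Y k t \<omega>)\<^sup>2) \<le> U k \<omega>) \<and> (\<integral>\<^sup>+ \<omega>. U k \<omega> \<partial>M) \<le> ennreal (c * p ^ k)"
    by (rule exE)
  then have U0[measurable]: "U k \<in> borel_measurable M"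
    and U1: "AE \<omega> in M. \<forall>t\<in>S. ennreal ((Y k t \<omega>)\<^sup>2) \<le> U k \<omega>"
    and U2: "(\<integral>\<^sup>+ \<omega>. U k \<omega> \<partial>M) \<le> ennreal (c * p ^ k)" for k by simp_all
  have U1': "AE \<omega> in M. \<forall>k. \<forall>t\<in>S. ennreal ((Y k t \<omega>)\<^sup>2) \<le> U k \<omega>"
    unfolding AE_all_countable using U1 by blast
  define w where "w k = 1 / ((1 - q) * q ^ k)" for k
  have w: "0 \<le> w k" for k using q by (auto simp: w_def)
  define V where "V \<omega> = (\<Sum>k. ennreal (w k) * U k \<omega>)" for \<omega>
  have [measurable]: "V \<in> borel_measurable M" unfolding V_def by measurable
  have "AE \<omega> in M. \<forall>t\<in>S. ennreal ((Z t \<omega>)\<^sup>2) \<le> V \<omega>"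
    using lim U1'
  proof eventually_elim
    case (elim \<omega>)
    show ?case
    proof
      fix t assume t: "t \<in> S"
      then obtain z where z: "z \<longlonglongrightarrow> Z t \<omega>" "\<And>n. \<bar>z n\<bar> \<le> (\<Sum>k<n. \<bar>Y k t \<omega>\<bar>)"
        using elim(1) by blast
      have "ennreal ((z n)\<^sup>2) \<le> V \<omega>" for n
      proof -
        have "(z n)\<^sup>2 \<le> (\<Sum>k<n. \<bar>Y k t \<omega>\<bar>)\<^sup>2"
          using z(2)[of n] by (metis abs_ge_zero power2_abs power_mono)
        also have "\<dots> \<le> (\<Sum>k<n. (Y k t \<omega>)\<^sup>2 * w k)"
          unfolding w_def by (rule sum_square_le_geometric[OF q])
        finally have "ennreal ((z n)\<^sup>2) \<le> ennreal (\<Sum>k<n. (Y k t \<omega>)\<^sup>2 * w k)"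
          by (rule ennreal_leI)
        also have "\<dots> = (\<Sum>k<n. ennreal ((Y k t \<omega>)\<^sup>2 * w k))"
          by (rule sum_ennreal[symmetric]) (use w in auto)
        also have "\<dots> \<le> (\<Sum>k<n. ennreal (w k) * U k \<omega>)"
          using elim(2) t w by (intro sum_mono) (auto simp: ennreal_mult mult.commute intro!: mult_left_mono)
        also have "\<dots> \<le> V \<omega>" unfolding V_def by (rule sum_le_suminf) auto
        finally show ?thesis .
      qed
      moreover have "(\<lambda>n. ennreal ((z n)\<^sup>2)) \<longlonglongrightarrow> ennreal ((Z t \<omega>)\<^sup>2)"
        by (intro tendsto_ennrealI tendsto_power z)
      ultimately show "ennreal ((Z t \<omega>)\<^sup>2) \<le> V \<omega>"
        using LIMSEQ_le_const2 by blast
    qed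
  qed
  moreover have "(\<integral>\<^sup>+ \<omega>. V \<omega> \<partial>M) \<le> ennreal (c / (1 - q)\<^sup>2)"
  proof -
    have "(\<integral>\<^sup>+ \<omega>. V \<omega> \<partial>M) = (\<Sum>k. ennreal (w k) * (\<integral>\<^sup>+ \<omega>. U k \<omega> \<partial>M))"
      unfolding V_def by (subst nn_integral_suminf) (auto simp: nn_integral_cmult)
    also have "\<dots> \<le> (\<Sum>k. ennreal (c / (1 - q) * q ^ k))"
    proof (intro suminf_le summableI)
      fix k
      have "ennreal (w k) * (\<integral>\<^sup>+ \<omega>. U k \<omega> \<partial>M) \<le> ennreal (w k) * ennreal (c * p ^ k)"
        by (intro mult_left_mono U2) auto
      also have "\<dots> = ennreal (w k * (c * p ^ k))" using w c p by (simp add: ennreal_mult)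
      also have "w k * (c * p ^ k) = c / (1 - q) * q ^ k"
        using q unfolding w_def qp[symmetric] by (simp add: power_mult_distrib field_simps)
      finally show "ennreal (w k) * (\<integral>\<^sup>+ \<omega>. U k \<omega> \<partial>M) \<le> ennreal (c / (1 - q) * q ^ k)" .
    qed
    also have "\<dots> = ennreal (\<Sum>k. c / (1 - q) * q ^ k)"
      using q c by (intro suminf_ennreal2 summable_mult summable_geometric) auto
    also have "(\<Sum>k. c / (1 - q) * q ^ k) = c / (1 - q)\<^sup>2"
    proof -
      have "norm q < 1" using q by simp
      then have "(\<Sum>k. c / (1 - q) * q ^ k) = c / (1 - q) * (1 / (1 - q))"
        using suminf_mult[OF summable_geometric, of q "c / (1 - q)"] suminf_geometric[of q] by (simp only:)
      then show ?thesis by (simp add: power2_eq_square)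
    qed
    finally show ?thesis .
  qed
  ultimately show ?thesis unfolding sup_sq_le_def q_def[symmetric]
    by (intro bexI[of _ V] conjI) simp_all
qed

text \<open>The bound on the increments is additive over adjacent intervals, so at every dyadic level the
  expected sum of all squared increments is at most \<open>K * sqrt T\<close>. The path to a point of
  level \<open>m\<close> uses one increment from each of \<open>Suc m\<close> levels, which costs the factor \<open>(Suc m)\<^sup>2\<close>;
  the times between the points of the grid are left to the hypothesis on small gaps.\<close>

lemma sup_sq_le_chaining:
  fixes Y :: "real \<Rightarrow> 'a \<Rightarrow> real"
  assumes T: "0 < T" and K: "0 \<le> K" and \<Gamma>: "0 \<le> \<Gamma>"
    and meas: "\<And>t. 0 \<le> t \<Longrightarrow> t \<le> T \<Longrightarrow> Y t \<in> borel_measurable M"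
    and zero: "\<And>\<omega>. Y 0 \<omega> = 0"
    and incr: "\<And>a b. 0 \<le> a \<Longrightarrow> a \<le> b \<Longrightarrow> b \<le> T \<Longrightarrow>
        (\<integral>\<^sup>+ \<omega>. ennreal ((Y b \<omega> - Y a \<omega>)\<^sup>2) \<partial>M) \<le> ennreal (K * (sqrt b - sqrt a))"
    and gap: "sup_sq_le M {(s, t). 0 \<le> s \<and> s \<le> t \<and> t \<le> T \<and> t - s \<le> T / 2 ^ m} (\<lambda>(s, t) \<omega>. Y t \<omega> - Y s \<omega>) \<Gamma>"
  shows "sup_sq_le M {0..T} Y (2 * (real (Suc m))\<^sup>2 * K * sqrt T + 2 * \<Gamma>)"
proof -
  define g where "g j k = T * (real k / 2 ^ j)" for j k :: nat
  have g: "0 \<le> g j k" "k \<le> 2 ^ j \<Longrightarrow> g j k \<le> T" "g j k \<le> g j (Suc k)" for j k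
  proof -
    show "0 \<le> g j k" "g j k \<le> g j (Suc k)" using T by (auto simp: g_def divide_right_mono)
    assume "k \<le> 2 ^ j"
    then have "real k \<le> 2 ^ j" by (metis of_nat_le_iff of_nat_numeral of_nat_power)
    then have "real k / 2 ^ j \<le> 1" by simp
    then show "g j k \<le> T" unfolding g_def using T mult_left_le[of "real k / 2 ^ j" T] by (simp del: times_divide_eq_right)
  qed
  define Q where "Q j \<omega> = (\<Sum>k<2^j. (Y (g j (Suc k)) \<omega> - Y (g j k) \<omega>)\<^sup>2)" for j \<omega>
  have [measurable]: "Y (g j k) \<in> borel_measurable M" if "k \<le> 2 ^ j" for j k
    using g that by (intro meas) auto
  have Qm[measurable]: "Q j \<in> borel_measurable M" for j
    unfolding Q_def by (intro borel_measurable_sum borel_measurable_power borel_measurable_diff) auto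
  have Q0: "0 \<le> Q j \<omega>" for j \<omega> by (auto simp: Q_def intro!: sum_nonneg)
  have EQ: "(\<integral>\<^sup>+ \<omega>. ennreal (Q j \<omega>) \<partial>M) \<le> ennreal (K * sqrt T)" for j
  proof -
    have "(\<integral>\<^sup>+ \<omega>. ennreal (Q j \<omega>) \<partial>M) = (\<Sum>k<2^j. \<integral>\<^sup>+ \<omega>. ennreal ((Y (g j (Suc k)) \<omega> - Y (g j k) \<omega>)\<^sup>2) \<partial>M)"
      unfolding Q_def
    proof (subst nn_integral_sum[symmetric])
      fix k assume "k \<in> {..<2 ^ j :: nat}"
      then show "(\<lambda>\<omega>. ennreal ((Y (g j (Suc k)) \<omega> - Y (g j k) \<omega>)\<^sup>2)) \<in> borel_measurable M"
        by (intro measurable_compose[OF _ measurable_ennreal] borel_measurable_power borel_measurable_diff) auto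
    qed (simp add: sum_ennreal)
    also have "\<dots> \<le> (\<Sum>k<2^j. ennreal (K * (sqrt (g j (Suc k)) - sqrt (g j k))))"
      by (intro sum_mono incr g) auto
    also have "\<dots> = ennreal (\<Sum>k<2^j. K * (sqrt (g j (Suc k)) - sqrt (g j k)))"
      using K g by (intro sum_ennreal) auto
    also have "(\<Sum>k<2^j. K * (sqrt (g j (Suc k)) - sqrt (g j k))) = K * sqrt T"
      unfolding sum_distrib_left[symmetric] sum_lessThan_telescope[of "\<lambda>k. sqrt (g j k)"]
      by (simp add: g_def)
    finally show ?thesis .
  qed
  have main: "(Y (g m i) \<omega>)\<^sup>2 \<le> real (Suc m) * (\<Sum>j\<le>m. Q j \<omega>)" if i: "i \<le> 2 ^ m" for i \<omega>
  proof -
    have "\<bar>Y (0 + T * (real i / 2 ^ m)) \<omega> - Y 0 \<omega>\<bar> \<le> (\<Sum>j\<le>m. sqrt (Q j \<omega>))"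
    proof (rule dyadic_increment_le[where y = "\<lambda>t. Y t \<omega>", OF _ i])
      fix j k :: nat assume "k < 2 ^ j"
      then have "(Y (g j (Suc k)) \<omega> - Y (g j k) \<omega>)\<^sup>2 \<le> Q j \<omega>"
        unfolding Q_def by (intro member_le_sum[where f = "\<lambda>k. (Y (g j (Suc k)) \<omega> - Y (g j k) \<omega>)\<^sup>2"]) auto
      then show "\<bar>Y (0 + T * (real (Suc k) / 2 ^ j)) \<omega> - Y (0 + T * (real k / 2 ^ j)) \<omega>\<bar> \<le> sqrt (Q j \<omega>)"
        by (intro real_le_rsqrt) (simp add: g_def)
    qed
    then have "\<bar>Y (g m i) \<omega>\<bar> \<le> (\<Sum>j\<le>m. sqrt (Q j \<omega>))" by (simp add: g_def zero)
    then have "(Y (g m i) \<omega>)\<^sup>2 \<le> (\<Sum>j\<le>m. sqrt (Q j \<omega>))\<^sup>2"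
      by (metis abs_ge_zero power2_abs power_mono)
    also have "\<dots> \<le> (\<Sum>j\<le>m. (sqrt (Q j \<omega>))\<^sup>2) * real (card {..m})"
      using sum_squared_le_sum_of_squares[of "\<lambda>j. sqrt (Q j \<omega>)" "{..m}"] by simp
    also have "\<dots> = real (Suc m) * (\<Sum>j\<le>m. Q j \<omega>)" using Q0 by simp
    finally show ?thesis .
  qed
  have grid: "sup_sq_le M {..2 ^ m :: nat} (\<lambda>i. Y (g m i)) ((real (Suc m))\<^sup>2 * K * sqrt T)"
    unfolding sup_sq_le_def
  proof (intro bexI[of _ "\<lambda>\<omega>. ennreal (real (Suc m)) * (\<Sum>j\<le>m. ennreal (Q j \<omega>))"] conjI AE_I2 ballI)
    fix \<omega> i assume "i \<in> {..2 ^ m :: nat}"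
    with main[of i \<omega>] have "ennreal ((Y (g m i) \<omega>)\<^sup>2) \<le> ennreal (real (Suc m) * (\<Sum>j\<le>m. Q j \<omega>))"
      by (intro ennreal_leI) auto
    also have "\<dots> = ennreal (real (Suc m)) * (\<Sum>j\<le>m. ennreal (Q j \<omega>))"
      using Q0 by (subst ennreal_mult) (auto intro!: sum_nonneg simp: sum_ennreal)
    finally show "ennreal ((Y (g m i) \<omega>)\<^sup>2) \<le> ennreal (real (Suc m)) * (\<Sum>j\<le>m. ennreal (Q j \<omega>))" .
  next
    have "(\<integral>\<^sup>+ \<omega>. ennreal (real (Suc m)) * (\<Sum>j\<le>m. ennreal (Q j \<omega>)) \<partial>M) =
        ennreal (real (Suc m)) * (\<Sum>j\<le>m. \<integral>\<^sup>+ \<omega>. ennreal (Q j \<omega>) \<partial>M)"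
      by (simp add: nn_integral_cmult nn_integral_sum)
    also have "\<dots> \<le> ennreal (real (Suc m)) * (\<Sum>j\<le>m. ennreal (K * sqrt T))"
      by (intro mult_left_mono sum_mono EQ) auto
    also have "\<dots> = ennreal ((real (Suc m))\<^sup>2 * K * sqrt T)"
      using K T by (subst sum_ennreal) (auto simp: ennreal_mult[symmetric] power2_eq_square algebra_simps simp del: of_nat_Suc)
    finally show "(\<integral>\<^sup>+ \<omega>. ennreal (real (Suc m)) * (\<Sum>j\<le>m. ennreal (Q j \<omega>)) \<partial>M) \<le> ennreal ((real (Suc m))\<^sup>2 * K * sqrt T)" .
  qed measurable
  define i where "i t = nat \<lfloor>t / T * 2 ^ m\<rfloor>" for t
  have it: "i t \<le> 2 ^ m" "0 \<le> g m (i t)" "g m (i t) \<le> t" "t - g m (i t) \<le> T / 2 ^ m" if t: "t \<in> {0..T}" for t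
  proof -
    have 1: "0 \<le> t / T * 2 ^ m" "t / T * 2 ^ m \<le> 2 ^ m" using t T by (auto simp: field_simps)
    have it: "real (i t) \<le> t / T * 2 ^ m" "t / T * 2 ^ m \<le> real (i t) + 1"
      using 1 unfolding i_def by linarith+
    have "real (i t) \<le> real (2 ^ m)" using order_trans[OF it(1) 1(2)] by simp
    then show "i t \<le> 2 ^ m" by (rule of_nat_le_iff[THEN iffD1])
    show "0 \<le> g m (i t)" by (rule g)
    show "g m (i t) \<le> t" using it T by (simp add: g_def field_simps)
    have "t \<le> T * (real (i t) + 1) / 2 ^ m" using it(2) T by (simp add: field_simps)
    then show "t - g m (i t) \<le> T / 2 ^ m" by (simp add: g_def add_divide_distrib distrib_left)
  qed
  have "sup_sq_le M {0..T} (\<lambda>t. Y (g m (i t))) ((real (Suc m))\<^sup>2 * K * sqrt T)"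
  proof (rule sup_sq_le_dominated[OF grid], intro AE_I2 ballI)
    fix \<omega> t assume "t \<in> {0..T}"
    then show "\<exists>i'\<in>{..2 ^ m}. \<bar>Y (g m (i t)) \<omega>\<bar> \<le> \<bar>Y (g m i') \<omega>\<bar>"
      by (intro bexI[of _ "i t"]) (use it in auto)
  qed
  moreover have "sup_sq_le M {0..T} (\<lambda>t \<omega>. Y t \<omega> - Y (g m (i t)) \<omega>) \<Gamma>"
  proof (rule sup_sq_le_dominated[OF gap], intro AE_I2 ballI)
    fix \<omega> t assume t: "t \<in> {0..T}"
    show "\<exists>s\<in>{(s, t). 0 \<le> s \<and> s \<le> t \<and> t \<le> T \<and> t - s \<le> T / 2 ^ m}.
       \<bar>Y t \<omega> - Y (g m (i t)) \<omega>\<bar> \<le> \<bar>(case s of (s, t) \<Rightarrow> \<lambda>\<omega>. Y t \<omega> - Y s \<omega>) \<omega>\<bar>"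
      by (rule bexI[of _ "(g m (i t), t)"]) (use it[OF t] t in auto)
  qed
  ultimately have "sup_sq_le M {0..T} Y (2 * ((real (Suc m))\<^sup>2 * K * sqrt T) + 2 * \<Gamma>)"
    by (rule sup_sq_le_add) (use K T \<Gamma> in auto)
  then show ?thesis by (simp add: mult.assoc)
qed

section \<open>Second moments of time integrals\<close>

text \<open>By Fubini's theorem the second moment is the double integral of the correlations, and half of it
  comes from pairs \<open>u < v\<close>. With \<open>r u\<close> for the earlier time and \<open>k (v - u)\<close> for the decay of
  the correlation this double integral factorises.\<close>

lemma (in prob_space) second_moment_time_integral:
  fixes Y :: "real \<Rightarrow> 'a \<Rightarrow> real" and r k :: "real \<Rightarrow> ennreal"
  assumes ab: "0 \<le> a" "a \<le> b"
    and Y[measurable]: "(\<lambda>(u, \<omega>). Y u \<omega>) \<in> borel_measurable (borel \<Otimes>\<^sub>M M)"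
    and rk[measurable]: "r \<in> borel_measurable borel" "k \<in> borel_measurable borel"
    and sq: "\<And>u. a \<le> u \<Longrightarrow> u \<le> b \<Longrightarrow> (\<integral>\<^sup>+ \<omega>. ennreal ((Y u \<omega>)\<^sup>2) \<partial>M) \<le> ennreal c"
    and corr: "\<And>u v. 0 < u \<Longrightarrow> a \<le> u \<Longrightarrow> u < v \<Longrightarrow> v \<le> b \<Longrightarrow>
        ennreal \<bar>expectation (\<lambda>\<omega>. Y u \<omega> * Y v \<omega>)\<bar> \<le> r u * k (v - u)"
  shows "(\<integral>\<^sup>+ \<omega>. ennreal ((LINT u:{a..b}|lborel. Y u \<omega>)\<^sup>2) \<partial>M) \<le>
    2 * (\<integral>\<^sup>+ u\<in>{a..b}. r u \<partial>lborel) * (\<integral>\<^sup>+ s\<in>{0..b}. k s \<partial>lborel)"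
proof -
  \<comment> \<open>Cutting off outside \<open>[a, b]\<close> reduces all integrals to the whole line.\<close>
  define Z where "Z u \<omega> = indicator {a..b} u * Y u \<omega>" for u \<omega>
  let ?P = "lborel \<Otimes>\<^sub>M lborel :: (real \<times> real) measure"
  define F where "F = (\<lambda>(p, \<omega>). Z (fst p) \<omega> * Z (snd p) \<omega>)"
  have Ym[measurable]: "(\<lambda>x. Y (f x) (g x)) \<in> borel_measurable N"
    if "f \<in> borel_measurable N" "g \<in> measurable N M" for f g and N :: "'z measure"
    using measurable_compose[OF measurable_Pair[OF that] Y] by simp
  have Zm[measurable]: "(\<lambda>x. Z (f x) (g x)) \<in> borel_measurable N"
    if [measurable]: "f \<in> borel_measurable N" "g \<in> measurable N M" for f g and N :: "'z measure"
    unfolding Z_def by measurable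
  have [measurable]: "F \<in> borel_measurable (?P \<Otimes>\<^sub>M M)" unfolding F_def case_prod_beta by measurable
  have Z2: "(\<integral>\<^sup>+ \<omega>. ennreal ((Z u \<omega>)\<^sup>2) \<partial>M) \<le> ennreal c" for u
    using sq[of u] by (cases "u \<in> {a..b}") (auto simp: Z_def)
  interpret PM: pair_sigma_finite ?P M by unfold_locales
  have ZZ: "(\<integral>\<^sup>+ \<omega>. ennreal (norm (F (p, \<omega>))) \<partial>M) \<le> ennreal c * (indicator {a..b} (fst p) * indicator {a..b} (snd p))" for p
  proof (cases "fst p \<in> {a..b} \<and> snd p \<in> {a..b}")
    case True
    have "(\<integral>\<^sup>+ \<omega>. ennreal (norm (F (p, \<omega>))) \<partial>M) \<le>
        (\<integral>\<^sup>+ \<omega>. ennreal (1/2) * ennreal ((Z (fst p) \<omega>)\<^sup>2) + ennreal (1/2) * ennreal ((Z (snd p) \<omega>)\<^sup>2) \<partial>M)"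
    proof (intro nn_integral_mono)
      fix \<omega>
      have "norm (F (p, \<omega>)) \<le> 1/2 * (Z (fst p) \<omega>)\<^sup>2 + 1/2 * (Z (snd p) \<omega>)\<^sup>2"
        using sum_squares_bound[of "\<bar>Z (fst p) \<omega>\<bar>" "\<bar>Z (snd p) \<omega>\<bar>"] by (simp add: F_def abs_mult)
      then show "ennreal (norm (F (p, \<omega>))) \<le> ennreal (1/2) * ennreal ((Z (fst p) \<omega>)\<^sup>2) + ennreal (1/2) * ennreal ((Z (snd p) \<omega>)\<^sup>2)"
        by (metis ennreal_leI ennreal_mult ennreal_plus half_gt_zero less_eq_real_def mult_nonneg_nonneg zero_le_power2 zero_less_one)
    qed
    also have "\<dots> \<le> ennreal (1/2) * ennreal c + ennreal (1/2) * ennreal c"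
      by (subst nn_integral_add) (auto simp: nn_integral_cmult intro!: add_mono mult_left_mono Z2)
    also have "\<dots> = ennreal c"
    proof (cases "0 \<le> c")
      case True
      then have "ennreal (1/2) * ennreal c = ennreal (c / 2)"
        by (subst ennreal_mult[symmetric]) auto
      moreover have "ennreal (c / 2) + ennreal (c / 2) = ennreal (c / 2 + c / 2)"
        using True by (intro ennreal_plus[symmetric]) auto
      ultimately show ?thesis by simp
    qed (simp add: ennreal_neg)
    finally show ?thesis using True by simp
  qed (auto simp: F_def Z_def)
  have F: "integrable (?P \<Otimes>\<^sub>M M) F"
  proof (rule integrableI_bounded)
    have "(\<integral>\<^sup>+ x. ennreal (norm (F x)) \<partial>(?P \<Otimes>\<^sub>M M)) = (\<integral>\<^sup>+ p. (\<integral>\<^sup>+ \<omega>. ennreal (norm (F (p, \<omega>))) \<partial>M) \<partial>?P)"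
      by (rule nn_integral_fst[symmetric]) measurable
    also have "\<dots> \<le> (\<integral>\<^sup>+ p. ennreal c * (indicator {a..b} (fst p) * indicator {a..b} (snd p)) \<partial>?P)"
      by (intro nn_integral_mono ZZ)
    also have "\<dots> = ennreal c * (\<integral>\<^sup>+ p. indicator ({a..b} \<times> {a..b}) p \<partial>?P)"
      by (subst nn_integral_cmult[symmetric]) (auto intro!: nn_integral_cong simp: indicator_def)
    also have "\<dots> = ennreal c * (ennreal (b - a) * ennreal (b - a))"
      using ab by (subst nn_integral_indicator) (auto simp: lborel.emeasure_pair_measure_Times)
    also have "\<dots> < \<infinity>" by (simp add: ennreal_mult_less_top)
    finally show "(\<integral>\<^sup>+ x. ennreal (norm (F x)) \<partial>(?P \<Otimes>\<^sub>M M)) < \<infinity>" .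
  qed measurable
  have F': "integrable (?P \<Otimes>\<^sub>M M) (case_prod (\<lambda>p \<omega>. F (p, \<omega>)))"
    using F unfolding case_prod_eta .
  have AE1: "AE \<omega> in M. (LINT u:{a..b}|lborel. Y u \<omega>)\<^sup>2 = (\<integral>p. F (p, \<omega>) \<partial>?P)"
    using PM.AE_integrable_snd[OF F']
  proof eventually_elim
    case (elim \<omega>)
    have "(LINT u:{a..b}|lborel. Y u \<omega>) = (\<integral>u. Z u \<omega> \<partial>lborel)"
      by (simp add: set_lebesgue_integral_def Z_def)
    then have "(LINT u:{a..b}|lborel. Y u \<omega>)\<^sup>2 = (\<integral>u. (\<integral>v. Z u \<omega> * Z v \<omega> \<partial>lborel) \<partial>lborel)"
      by (simp add: power2_eq_square)
    also have "\<dots> = (\<integral>p. F (p, \<omega>) \<partial>?P)"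
      using lborel_pair.integral_fst'[OF elim] by (simp add: F_def)
    finally show ?case .
  qed
  have int2: "integrable M (\<lambda>\<omega>. \<integral>p. F (p, \<omega>) \<partial>?P)"
    using PM.integrable_snd[OF F'] by simp
  have "(\<integral>\<^sup>+ \<omega>. ennreal ((LINT u:{a..b}|lborel. Y u \<omega>)\<^sup>2) \<partial>M) = (\<integral>\<^sup>+ \<omega>. ennreal (\<integral>p. F (p, \<omega>) \<partial>?P) \<partial>M)"
    using AE1 by (intro nn_integral_cong_AE) auto
  also have "\<dots> = ennreal (\<integral>\<omega>. (\<integral>p. F (p, \<omega>) \<partial>?P) \<partial>M)"
    by (rule nn_integral_eq_integral[OF int2]) (use AE1 in eventually_elim, metis zero_le_power2)
  also have "(\<integral>\<omega>. (\<integral>p. F (p, \<omega>) \<partial>?P) \<partial>M) = (\<integral>p. (\<integral>\<omega>. F (p, \<omega>) \<partial>M) \<partial>?P)"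
    by (rule PM.Fubini_integral[OF F'])
  also have "ennreal (\<integral>p. (\<integral>\<omega>. F (p, \<omega>) \<partial>M) \<partial>?P) \<le> ennreal (norm (\<integral>p. (\<integral>\<omega>. F (p, \<omega>) \<partial>M) \<partial>?P))"
    by (intro ennreal_leI) simp
  also have "\<dots> \<le> (\<integral>\<^sup>+ p. ennreal (norm (\<integral>\<omega>. F (p, \<omega>) \<partial>M)) \<partial>?P)"
    by (rule integral_norm_bound_ennreal[OF PM.integrable_fst'[OF F]])
  also have "\<dots> = (\<integral>\<^sup>+ u. (\<integral>\<^sup>+ v. ennreal (norm (\<integral>\<omega>. F ((u, v), \<omega>) \<partial>M)) \<partial>lborel) \<partial>lborel)"
    by (rule lborel.nn_integral_fst[symmetric, where f = "\<lambda>p. ennreal (norm (\<integral>\<omega>. F (p, \<omega>) \<partial>M))"]) measurable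
  also have "\<dots> \<le> (\<integral>\<^sup>+ u. (\<integral>\<^sup>+ v. (r u * indicator {a..b} u) * (k (v - u) * indicator {0..b} (v - u)) +
      (r v * indicator {a..b} v) * (k (u - v) * indicator {0..b} (u - v)) \<partial>lborel) \<partial>lborel)" (is "_ \<le> (\<integral>\<^sup>+ u. (\<integral>\<^sup>+ v. ?R u v + ?R v u \<partial>lborel) \<partial>lborel)")
  proof (rule nn_integral_mono_AE, use AE_lborel_singleton[of 0] in eventually_elim)
    case (elim u)
    show ?case
    proof (rule nn_integral_mono_AE, use AE_lborel_singleton[of 0] AE_lborel_singleton[of u] in eventually_elim)
      case (elim v)
      have R: "ennreal (norm (\<integral>\<omega>. Z u \<omega> * Z v \<omega> \<partial>M)) \<le> ?R u v" if "u < v" "u \<noteq> 0" for u v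
      proof (cases "a \<le> u \<and> v \<le> b")
        case True
        then show ?thesis using corr[of u v] that ab by (auto simp: Z_def)
      next
        case False
        then have "(\<lambda>\<omega>. Z u \<omega> * Z v \<omega>) = (\<lambda>_. 0)" using that by (auto simp: Z_def fun_eq_iff)
        then show ?thesis by simp
      qed
      show ?case
      proof (cases "u < v")
        case True
        then show ?thesis using R[of u v] \<open>u \<noteq> 0\<close> by (simp add: F_def add_increasing2)
      next
        case False
        then have "v < u" using elim by simp
        then show ?thesis using R[of v u] elim by (simp add: F_def add_increasing mult.commute)
      qed
    qed
  qed
  also have "\<dots> = (\<integral>\<^sup>+ u. (\<integral>\<^sup>+ v. ?R u v \<partial>lborel) \<partial>lborel) + (\<integral>\<^sup>+ u. (\<integral>\<^sup>+ v. ?R v u \<partial>lborel) \<partial>lborel)"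
    by (simp add: nn_integral_add)
  also have "(\<integral>\<^sup>+ u. (\<integral>\<^sup>+ v. ?R v u \<partial>lborel) \<partial>lborel) = (\<integral>\<^sup>+ u. (\<integral>\<^sup>+ v. ?R u v \<partial>lborel) \<partial>lborel)"
    by (rule lborel_pair.Fubini'[where f = "\<lambda>v u. ?R v u"]) measurable
  also have "(\<integral>\<^sup>+ u. (\<integral>\<^sup>+ v. ?R u v \<partial>lborel) \<partial>lborel) = (\<integral>\<^sup>+ u\<in>{a..b}. r u \<partial>lborel) * (\<integral>\<^sup>+ s\<in>{0..b}. k s \<partial>lborel)"
  proof -
    have "(\<integral>\<^sup>+ v. k (v - u) * indicator {0..b} (v - u) \<partial>lborel) = (\<integral>\<^sup>+ s\<in>{0..b}. k s \<partial>lborel)" for u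
      by (subst nn_integral_real_affine[of _ 1 u]) auto
    then show ?thesis by (simp add: nn_integral_cmult nn_integral_multc)
  qed
  finally show ?thesis by (simp add: mult_2 distrib_right)
qed

lemma nn_integral_inverse_sqrt:
  assumes "0 \<le> a" "a \<le> b"
  shows "(\<integral>\<^sup>+ u\<in>{a..b}. ennreal (1 / sqrt u) \<partial>lborel) = ennreal (2 * (sqrt b - sqrt a))"
proof -
  have "((\<lambda>u. 1 / sqrt u) has_integral (2 * sqrt b - 2 * sqrt a)) {a..b}"
  proof (rule fundamental_theorem_of_calculus_interior)
    fix x assume "x \<in> {a<..<b}"
    then have "0 < x" using assms by auto
    then show "((\<lambda>u. 2 * sqrt u) has_vector_derivative 1 / sqrt x) (at x)"
      unfolding has_real_derivative_iff_has_vector_derivative[symmetric]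
      by (auto intro!: derivative_eq_intros simp: field_simps)
  qed (use assms in \<open>auto intro!: continuous_intros\<close>)
  then have "((\<lambda>u. if 0 \<le> u then 1 / sqrt u else 0) has_integral (2 * sqrt b - 2 * sqrt a)) {a..b}"
    by (rule has_integral_eq[rotated]) (use assms in auto)
  from nn_integral_has_integral_lebesgue[OF _ this]
  have "(\<integral>\<^sup>+ u. ennreal (indicator {a..b} u * (if 0 \<le> u then 1 / sqrt u else 0)) \<partial>lborel) = ennreal (2 * (sqrt b - sqrt a))"
    by (simp add: algebra_simps)
  also have "(\<integral>\<^sup>+ u. ennreal (indicator {a..b} u * (if 0 \<le> u then 1 / sqrt u else 0)) \<partial>lborel) = (\<integral>\<^sup>+ u\<in>{a..b}. ennreal (1 / sqrt u) \<partial>lborel)"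
    using assms by (intro nn_integral_cong) (auto simp: indicator_def)
  finally show ?thesis .
qed

lemma nn_integral_powr_from_0:
  assumes "-1 < \<alpha>" "0 \<le> b"
  shows "(\<integral>\<^sup>+ s\<in>{0..b}. ennreal (s powr \<alpha>) \<partial>lborel) = ennreal (b powr (\<alpha> + 1) / (\<alpha> + 1))"
proof -
  have "((\<lambda>s. s powr \<alpha>) has_integral (b powr (\<alpha> + 1) / (\<alpha> + 1))) {0..b}"
    using assms by (intro has_integral_powr_from_0) auto
  from nn_integral_has_integral_lebesgue[OF _ this]
  have "(\<integral>\<^sup>+ s. ennreal (indicator {0..b} s * s powr \<alpha>) \<partial>lborel) = ennreal (b powr (\<alpha> + 1) / (\<alpha> + 1))"
    by simp
  also have "(\<integral>\<^sup>+ s. ennreal (indicator {0..b} s * s powr \<alpha>) \<partial>lborel) = (\<integral>\<^sup>+ s\<in>{0..b}. ennreal (s powr \<alpha>) \<partial>lborel)"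
    by (intro nn_integral_cong) (auto simp: indicator_def)
  finally show ?thesis .
qed

section \<open>The Gaussian kernel\<close>

abbreviation gauss :: "real \<Rightarrow> real \<Rightarrow> real" where "gauss r \<equiv> normal_density 0 (sqrt r)"

lemma gauss_le:
  assumes "0 < r" shows "gauss r x \<le> 1 / sqrt r"
proof -
  have "gauss r x = 1 / sqrt (2 * pi * r) * exp (- x\<^sup>2 / (2 * r))"
    using assms by (simp add: normal_density_def)
  also have "\<dots> \<le> 1 / sqrt (2 * pi * r) * 1"
    using assms by (intro mult_left_mono) auto
  also have "\<dots> \<le> 1 / sqrt r"
  proof -
    have "1 * r \<le> 2 * pi * r" using assms pi_gt3 by (intro mult_right_mono) auto
    then show ?thesis using assms by (auto intro!: divide_left_mono real_sqrt_le_mono)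
  qed
  finally show ?thesis .
qed

lemma gauss_Lipschitz:
  assumes r: "0 < r" shows "\<bar>gauss r a - gauss r b\<bar> \<le> \<bar>a - b\<bar> / r"
proof -
  have deriv: "(gauss r has_field_derivative (- x / r * gauss r x)) (at x within UNIV)" for x
    unfolding normal_density_def using r
    by (auto intro!: derivative_eq_intros simp: field_simps power2_eq_square)
  have "norm (- x / r * gauss r x) \<le> 1 / r" for x
  proof -
    define y where "y = \<bar>x\<bar> / sqrt r"
    have "2 * y \<le> 1 + y\<^sup>2" using sum_squares_bound[of 1 y] by (simp add: power2_eq_square)
    then have "y \<le> 1 + y\<^sup>2 / 2" by simp
    also have "\<dots> \<le> exp (y\<^sup>2 / 2)" by (rule exp_ge_add_one_self)
    finally have y: "y * exp (- (y\<^sup>2 / 2)) \<le> 1" by (simp add: exp_minus field_simps)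
    have "\<bar>x\<bar> * gauss r x = 1 / sqrt (2 * pi) * (y * exp (- (y\<^sup>2 / 2)))"
      using r by (simp add: y_def normal_density_def real_sqrt_mult power_divide)
    also have "\<dots> \<le> 1 * 1"
    proof (intro mult_mono y)
      have "1 \<le> sqrt (2 * pi)" using pi_gt3 by (simp add: real_le_rsqrt)
      then show "1 / sqrt (2 * pi) \<le> 1" by simp
    qed (auto simp: y_def r less_imp_le)
    finally have "\<bar>x\<bar> * gauss r x / r \<le> 1 / r" using r by (intro divide_right_mono) auto
    then show ?thesis using r by (simp add: abs_mult)
  qed
  from field_differentiable_bound[OF convex_UNIV deriv this, of a b]
  show ?thesis by simp
qed

text \<open>The difference is at most \<open>r powr (- 1 / 2) * min y 1\<close> with \<open>y = \<bar>a - b\<bar> / sqrt r\<close>, the two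
  bounds being those of \<open>gauss_Lipschitz\<close> and \<open>gauss_le\<close>; and \<open>min y 1 \<le> y powr \<theta>\<close>. The
  exponent of \<open>r\<close> is larger than \<open>-1\<close> exactly because \<open>\<theta> < 1\<close>, so the bound is integrable in time.\<close>

lemma gauss_Hoelder:
  assumes r: "0 < r" and \<theta>: "0 < \<theta>" "\<theta> < 1"
  shows "\<bar>gauss r a - gauss r b\<bar> \<le> \<bar>a - b\<bar> powr \<theta> * r powr (- (1 + \<theta>) / 2)"
proof -
  define y where "y = \<bar>a - b\<bar> / sqrt r"
  have y0: "0 \<le> y" using r by (simp add: y_def)
  have 1: "\<bar>gauss r a - gauss r b\<bar> \<le> 1 / sqrt r * y"
    using gauss_Lipschitz[OF r, of a b] r by (simp add: y_def)
  have 2: "\<bar>gauss r a - gauss r b\<bar> \<le> 1 / sqrt r * 1"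
    using gauss_le[OF r, of a] gauss_le[OF r, of b] normal_density_nonneg[of 0 "sqrt r" a] normal_density_nonneg[of 0 "sqrt r" b]
    by linarith
  have "min y 1 \<le> y powr \<theta>"
  proof (cases "y \<le> 1")
    case True
    have "y powr 1 \<le> y powr \<theta>" using True y0 \<theta> by (intro powr_mono') auto
    then show ?thesis using y0 True by simp
  next
    case False
    then have "1 \<le> y powr \<theta>" using \<theta> by (intro ge_one_powr_ge_zero) auto
    then show ?thesis by simp
  qed
  then have "1 / sqrt r * min y 1 \<le> 1 / sqrt r * y powr \<theta>"
    using r by (intro mult_left_mono) auto
  then have "\<bar>gauss r a - gauss r b\<bar> \<le> 1 / sqrt r * y powr \<theta>" using 1 2
    by (cases "y \<le> 1") (auto simp: min_def)
  also have "\<dots> = \<bar>a - b\<bar> powr \<theta> * r powr (- (1 + \<theta>) / 2)"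
  proof -
    have s: "sqrt r = r powr (1/2)" using r by (simp add: powr_half_sqrt)
    have "r powr (- (1 + \<theta>) / 2) = r powr (- (1/2)) * r powr (- (\<theta> / 2))"
      unfolding powr_add[symmetric] by (simp add: field_simps)
    then show ?thesis using r unfolding y_def s
      by (simp add: powr_divide powr_powr powr_minus divide_simps)
  qed
  finally show ?thesis .
qed

lemma gauss_moments:
  assumes r: "0 < r"
  shows "(\<integral>\<^sup>+ z. ennreal (gauss r z) \<partial>lborel) = 1"
    and "(\<integral>\<^sup>+ z. ennreal (\<bar>z\<bar> * gauss r z) \<partial>lborel) \<le> ennreal (sqrt r)"
    and "(\<integral>\<^sup>+ z. ennreal (z\<^sup>2 * gauss r z) \<partial>lborel) = ennreal r"
    and "(\<integral>\<^sup>+ z. ennreal (\<bar>z\<bar> ^ 3 * gauss r z) \<partial>lborel) \<le> ennreal (2 * r * sqrt r)"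
    and "(\<integral>\<^sup>+ z. ennreal (z ^ 4 * gauss r z) \<partial>lborel) = ennreal (3 * r\<^sup>2)"
    and "integrable lborel (\<lambda>z. \<bar>z\<bar> * gauss r z)"
proof -
  have s: "0 < sqrt r" using r by simp
  have pi: "sqrt (2 / pi) \<le> 1" using pi_gt3 by (simp add: real_le_lsqrt)
  have nn: "(\<integral>\<^sup>+ z. ennreal (f z) \<partial>lborel) = ennreal c" if "has_bochner_integral lborel f c" "\<And>z. 0 \<le> f z" for f and c :: real
    using nn_integral_eq_integral[of lborel f] that by (auto simp: has_bochner_integral_iff)
  show "(\<integral>\<^sup>+ z. ennreal (gauss r z) \<partial>lborel) = 1"
    using nn[OF normal_moment_even[OF s, of 0 0]] by simp
  have e1: "has_bochner_integral lborel (\<lambda>z. \<bar>z\<bar> * gauss r z) (sqrt r * sqrt (2 / pi))"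
    using normal_moment_abs_odd[OF s, of 0 0] by (simp add: mult.commute)
  then show "integrable lborel (\<lambda>z. \<bar>z\<bar> * gauss r z)" by (simp add: has_bochner_integral_iff)
  show "(\<integral>\<^sup>+ z. ennreal (\<bar>z\<bar> * gauss r z) \<partial>lborel) \<le> ennreal (sqrt r)"
    unfolding nn[OF e1, simplified] using mult_left_mono[OF pi, of "sqrt r"] r by (intro ennreal_leI) simp
  have "has_bochner_integral lborel (\<lambda>z. z\<^sup>2 * gauss r z) r"
    using normal_moment_even[OF s, of 0 1] r by (simp add: mult.commute)
  from nn[OF this] show "(\<integral>\<^sup>+ z. ennreal (z\<^sup>2 * gauss r z) \<partial>lborel) = ennreal r" by simp
  have "has_bochner_integral lborel (\<lambda>z. \<bar>z\<bar> ^ 3 * gauss r z) (2 * r * sqrt r * sqrt (2 / pi))"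
    using normal_moment_abs_odd[OF s, of 0 1] r by (simp add: mult.commute power3_eq_cube mult.left_commute)
  from nn[OF this] show "(\<integral>\<^sup>+ z. ennreal (\<bar>z\<bar> ^ 3 * gauss r z) \<partial>lborel) \<le> ennreal (2 * r * sqrt r)"
    using mult_left_mono[OF pi, of "2 * r * sqrt r"] r by (simp add: ennreal_leI)
  have "has_bochner_integral lborel (\<lambda>z. z ^ 4 * gauss r z) (3 * r\<^sup>2)"
    using normal_moment_even[OF s, of 0 2] r
    by (simp add: mult.commute power_divide fact_numeral)
  from nn[OF this] show "(\<integral>\<^sup>+ z. ennreal (z ^ 4 * gauss r z) \<partial>lborel) = ennreal (3 * r\<^sup>2)" by simp
qed

section \<open>Crossing functionals and their kernels\<close>

text \<open>The first argument is the position of the path at time \<open>u\<close>, the second one its position at time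
  \<open>u + \<epsilon>\<close>. In \<open>f_mass\<close> the two signs of the increment are added, because a functional may see
  crossings in one direction only. Lower semicontinuity is demanded in the form of an increasing
  approximation by continuous functions, from which the suprema over time inherit measurability.\<close>

locale crossing_functional =
  fixes f :: "real \<Rightarrow> real \<Rightarrow> real"
  assumes f_measurable: "(\<lambda>(x, y). f x y) \<in> borel_measurable (borel \<Otimes>\<^sub>M borel)"
    and f_nonneg: "0 \<le> f x y"
    and f_le: "f x y \<le> \<bar>y - x\<bar>"
    and f_support: "f x y \<noteq> 0 \<Longrightarrow> \<bar>x\<bar> \<le> \<bar>y - x\<bar>"
    and f_mass: "(\<integral>\<^sup>+ x. ennreal (f x (x + z)) \<partial>lborel) + (\<integral>\<^sup>+ x. ennreal (f x (x - z)) \<partial>lborel) = ennreal (z\<^sup>2 / 2)"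
    and f_lsc: "\<exists>g :: nat \<Rightarrow> real \<times> real \<Rightarrow> real. (\<forall>n. continuous_on UNIV (g n)) \<and> (\<forall>n p. 0 \<le> g n p) \<and>
      (\<forall>p. incseq (\<lambda>n. g n p)) \<and> (\<forall>p. (\<lambda>n. g n p) \<longlonglongrightarrow> f (fst p) (snd p))"
begin

lemma f_comp_measurable[measurable]:
  assumes "g \<in> borel_measurable N" "h \<in> borel_measurable N"
  shows "(\<lambda>x. f (g x) (h x)) \<in> borel_measurable N"
  using measurable_compose[OF measurable_Pair[OF assms] f_measurable] by simp

text \<open>The conditional expectation of \<open>f (X u) (X (u + \<epsilon>)) / \<epsilon>\<close> given \<open>X u = x\<close>.\<close>

definition crossing_kernel :: "real \<Rightarrow> real \<Rightarrow> real" where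
  "crossing_kernel \<epsilon> x = 1 / \<epsilon> * (\<integral>z. f x (x + z) * gauss \<epsilon> z \<partial>lborel)"

lemma integrable_f_gauss:
  assumes "0 < \<epsilon>" shows "integrable lborel (\<lambda>z. f x (x + z) * gauss \<epsilon> z)"
proof (rule Bochner_Integration.integrable_bound[OF gauss_moments(6)[OF assms]])
  show "AE z in lborel. norm (f x (x + z) * gauss \<epsilon> z) \<le> norm (\<bar>z\<bar> * gauss \<epsilon> z)"
    using f_le[of x "x + _"] f_nonneg by (auto simp: abs_mult intro!: mult_right_mono)
qed measurable

lemma crossing_kernel_measurable[measurable]: "crossing_kernel \<epsilon> \<in> borel_measurable borel"
  unfolding crossing_kernel_def by measurable

lemma crossing_kernel_nonneg: "0 < \<epsilon> \<Longrightarrow> 0 \<le> crossing_kernel \<epsilon> x"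
  unfolding crossing_kernel_def using f_nonneg by (auto intro!: integral_nonneg)

lemma ennreal_crossing_kernel:
  assumes "0 < \<epsilon>"
  shows "ennreal (crossing_kernel \<epsilon> x) = ennreal (1 / \<epsilon>) * (\<integral>\<^sup>+ z. ennreal (f x (x + z)) * ennreal (gauss \<epsilon> z) \<partial>lborel)"
proof -
  have "(\<integral>\<^sup>+ z. ennreal (f x (x + z)) * ennreal (gauss \<epsilon> z) \<partial>lborel) = (\<integral>\<^sup>+ z. ennreal (f x (x + z) * gauss \<epsilon> z) \<partial>lborel)"
    using f_nonneg by (simp add: ennreal_mult)
  also have "\<dots> = ennreal (\<integral>z. f x (x + z) * gauss \<epsilon> z \<partial>lborel)"
    using f_nonneg by (intro nn_integral_eq_integral integrable_f_gauss[OF assms]) auto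
  finally show ?thesis
    unfolding crossing_kernel_def using assms f_nonneg by (simp only:) (rule ennreal_mult, auto intro!: integral_nonneg)
qed

lemma crossing_kernel_le:
  assumes e: "0 < \<epsilon>" shows "crossing_kernel \<epsilon> x \<le> 1 / sqrt \<epsilon>"
proof -
  have "ennreal (crossing_kernel \<epsilon> x) \<le> ennreal (1 / \<epsilon>) * ennreal (sqrt \<epsilon>)"
    unfolding ennreal_crossing_kernel[OF e]
  proof (intro mult_left_mono)
    have "(\<integral>\<^sup>+ z. ennreal (f x (x + z)) * ennreal (gauss \<epsilon> z) \<partial>lborel) \<le> (\<integral>\<^sup>+ z. ennreal (\<bar>z\<bar> * gauss \<epsilon> z) \<partial>lborel)"
      using f_le[of x "x + _"] by (intro nn_integral_mono) (auto simp: ennreal_mult intro!: mult_right_mono ennreal_leI)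
    also have "\<dots> \<le> ennreal (sqrt \<epsilon>)" by (rule gauss_moments(2)[OF e])
    finally show "(\<integral>\<^sup>+ z. ennreal (f x (x + z)) * ennreal (gauss \<epsilon> z) \<partial>lborel) \<le> ennreal (sqrt \<epsilon>)" .
  qed auto
  also have "\<dots> = ennreal (1 / \<epsilon> * sqrt \<epsilon>)" using e by (intro ennreal_mult[symmetric]) auto
  also have "1 / \<epsilon> * sqrt \<epsilon> = 1 / sqrt \<epsilon>" using e by (simp add: field_simps)
  finally show ?thesis using e by (subst (asm) ennreal_le_iff) auto
qed

text \<open>Exchange the integrals, and replace the integral over \<open>x\<close> by its average over \<open>z\<close> and \<open>- z\<close>,
  since the Gaussian density is even. By \<open>f_mass\<close> this average is \<open>z\<^sup>2 / 4\<close>, whose expectation is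
  \<open>\<epsilon> / 4\<close>.\<close>

lemma crossing_kernel_mass:
  assumes e: "0 < \<epsilon>"
  shows "(\<integral>\<^sup>+ x. ennreal (crossing_kernel \<epsilon> x) \<partial>lborel) = ennreal (1 / 4)"
proof -
  define J where "J z = (\<integral>\<^sup>+ x. ennreal (f x (x + z)) \<partial>lborel)" for z
  have [measurable]: "J \<in> borel_measurable borel" unfolding J_def by measurable
  have refl: "(\<integral>\<^sup>+ z. J (- z) * ennreal (gauss \<epsilon> z) \<partial>lborel) = (\<integral>\<^sup>+ z. J z * ennreal (gauss \<epsilon> z) \<partial>lborel)"
    by (subst nn_integral_real_affine[of _ "-1" 0]) (auto simp: normal_density_def)
  have "2 * (\<integral>\<^sup>+ z. J z * ennreal (gauss \<epsilon> z) \<partial>lborel) = (\<integral>\<^sup>+ z. J z * ennreal (gauss \<epsilon> z) + J (- z) * ennreal (gauss \<epsilon> z) \<partial>lborel)"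
    by (subst nn_integral_add) (auto simp: refl mult_2)
  also have "\<dots> = (\<integral>\<^sup>+ z. ennreal (1 / 2) * ennreal (z\<^sup>2 * gauss \<epsilon> z) \<partial>lborel)"
  proof (intro nn_integral_cong)
    fix z
    have "J z * ennreal (gauss \<epsilon> z) + J (- z) * ennreal (gauss \<epsilon> z) = (J z + J (- z)) * ennreal (gauss \<epsilon> z)"
      by (simp add: distrib_right)
    also have "J z + J (- z) = ennreal (z\<^sup>2 / 2)" using f_mass[of z] by (simp add: J_def)
    also have "ennreal (z\<^sup>2 / 2) * ennreal (gauss \<epsilon> z) = ennreal (1 / 2 * (z\<^sup>2 * gauss \<epsilon> z))"
      by (subst ennreal_mult[symmetric]) auto
    also have "\<dots> = ennreal (1 / 2) * ennreal (z\<^sup>2 * gauss \<epsilon> z)"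
      by (rule ennreal_mult) auto
    finally show "J z * ennreal (gauss \<epsilon> z) + J (- z) * ennreal (gauss \<epsilon> z) = ennreal (1 / 2) * ennreal (z\<^sup>2 * gauss \<epsilon> z)" .
  qed
  also have "\<dots> = ennreal (1 / 2) * ennreal \<epsilon>"
    by (subst nn_integral_cmult) (auto simp: gauss_moments(3)[OF e])
  finally have 2: "2 * (\<integral>\<^sup>+ z. J z * ennreal (gauss \<epsilon> z) \<partial>lborel) = ennreal (1 / 2) * ennreal \<epsilon>" .
  have JJ: "(\<integral>\<^sup>+ z. J z * ennreal (gauss \<epsilon> z) \<partial>lborel) = ennreal (\<epsilon> / 4)"
  proof -
    have "(\<integral>\<^sup>+ z. J z * ennreal (gauss \<epsilon> z) \<partial>lborel) = ennreal (1 / 2) * (2 * (\<integral>\<^sup>+ z. J z * ennreal (gauss \<epsilon> z) \<partial>lborel))"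
    proof -
      have "ennreal (1 / 2) * 2 = ennreal (1 / 2 * 2)" by (subst ennreal_mult) auto
      then show ?thesis by (simp add: mult.assoc[symmetric])
    qed
    also have "\<dots> = ennreal (1 / 2 * (1 / 2 * \<epsilon>))" unfolding 2 using e
      by (simp only: ennreal_mult[symmetric] less_imp_le mult_nonneg_nonneg zero_le_divide_1_iff zero_le_numeral)
    finally show ?thesis by simp
  qed
  have "(\<integral>\<^sup>+ x. ennreal (crossing_kernel \<epsilon> x) \<partial>lborel) =
      ennreal (1 / \<epsilon>) * (\<integral>\<^sup>+ x. (\<integral>\<^sup>+ z. ennreal (f x (x + z)) * ennreal (gauss \<epsilon> z) \<partial>lborel) \<partial>lborel)"
    unfolding ennreal_crossing_kernel[OF e] by (rule nn_integral_cmult) measurable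
  also have "(\<integral>\<^sup>+ x. (\<integral>\<^sup>+ z. ennreal (f x (x + z)) * ennreal (gauss \<epsilon> z) \<partial>lborel) \<partial>lborel) =
      (\<integral>\<^sup>+ z. (\<integral>\<^sup>+ x. ennreal (f x (x + z)) * ennreal (gauss \<epsilon> z) \<partial>lborel) \<partial>lborel)"
    by (rule lborel_pair.Fubini'[where f = "\<lambda>z x. ennreal (f x (x + z)) * ennreal (gauss \<epsilon> z)"]) measurable
  also have "\<dots> = (\<integral>\<^sup>+ z. J z * ennreal (gauss \<epsilon> z) \<partial>lborel)"
    unfolding J_def by (intro nn_integral_cong nn_integral_multc) measurable
  also have "ennreal (1 / \<epsilon>) * \<dots> = ennreal (1 / \<epsilon> * (\<epsilon> / 4))"
    unfolding JJ using e by (intro ennreal_mult[symmetric]) auto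
  finally show ?thesis using e by simp
qed

text \<open>The triangle \<open>\<bar>x\<bar> \<le> \<bar>z\<bar>\<close> contains the support of \<open>f x (x + z)\<close>, and its section at height \<open>z\<close> has
  length \<open>2 * \<bar>z\<bar>\<close>: the integral is twice a third absolute moment. It bounds the first
  moment of the kernel as well as the integral of \<open>f\<^sup>2\<close>.\<close>

lemma nn_integral_gauss_triangle_le:
  assumes e: "0 < \<epsilon>"
  shows "(\<integral>\<^sup>+ x. (\<integral>\<^sup>+ z. ennreal (z\<^sup>2) * indicator {- \<bar>z\<bar>..\<bar>z\<bar>} x * ennreal (gauss \<epsilon> z) \<partial>lborel) \<partial>lborel)
    \<le> ennreal (4 * \<epsilon> * sqrt \<epsilon>)"
proof -
  have [measurable]: "Measurable.pred (lborel \<Otimes>\<^sub>M lborel) (\<lambda>p :: real \<times> real. fst p \<in> {- \<bar>snd p\<bar>..\<bar>snd p\<bar>})"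
    "Measurable.pred (lborel \<Otimes>\<^sub>M lborel) (\<lambda>p :: real \<times> real. snd p \<in> {- \<bar>fst p\<bar>..\<bar>fst p\<bar>})"
    unfolding atLeastAtMost_iff by measurable
  have "(\<integral>\<^sup>+ x. (\<integral>\<^sup>+ z. ennreal (z\<^sup>2) * indicator {- \<bar>z\<bar>..\<bar>z\<bar>} x * ennreal (gauss \<epsilon> z) \<partial>lborel) \<partial>lborel) =
    (\<integral>\<^sup>+ z. (\<integral>\<^sup>+ x. ennreal (z\<^sup>2) * indicator {- \<bar>z\<bar>..\<bar>z\<bar>} x * ennreal (gauss \<epsilon> z) \<partial>lborel) \<partial>lborel)"
    by (rule lborel_pair.Fubini'[where f = "\<lambda>z x. ennreal (z\<^sup>2) * indicator {- \<bar>z\<bar>..\<bar>z\<bar>} x * ennreal (gauss \<epsilon> z)"]) measurable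
  also have "\<dots> = (\<integral>\<^sup>+ z. ennreal 2 * ennreal (\<bar>z\<bar> ^ 3 * gauss \<epsilon> z) \<partial>lborel)"
  proof (intro nn_integral_cong)
    fix z :: real
    have "(\<integral>\<^sup>+ x. ennreal (z\<^sup>2) * indicator {- \<bar>z\<bar>..\<bar>z\<bar>} x * ennreal (gauss \<epsilon> z) \<partial>lborel) = ennreal (z\<^sup>2) * ennreal (2 * \<bar>z\<bar>) * ennreal (gauss \<epsilon> z)"
      by (simp add: nn_integral_multc nn_integral_cmult)
    also have "\<dots> = ennreal (z\<^sup>2 * (2 * \<bar>z\<bar>) * gauss \<epsilon> z)"
      by (subst ennreal_mult, simp, simp, subst ennreal_mult) auto
    also have "z\<^sup>2 * (2 * \<bar>z\<bar>) * gauss \<epsilon> z = 2 * (\<bar>z\<bar> ^ 3 * gauss \<epsilon> z)"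
      by (simp add: power3_eq_cube power2_eq_square)
    also have "ennreal \<dots> = ennreal 2 * ennreal (\<bar>z\<bar> ^ 3 * gauss \<epsilon> z)" by (rule ennreal_mult) auto
    finally show "(\<integral>\<^sup>+ x. ennreal (z\<^sup>2) * indicator {- \<bar>z\<bar>..\<bar>z\<bar>} x * ennreal (gauss \<epsilon> z) \<partial>lborel) = ennreal 2 * ennreal (\<bar>z\<bar> ^ 3 * gauss \<epsilon> z)" .
  qed
  also have "\<dots> \<le> ennreal 2 * ennreal (2 * \<epsilon> * sqrt \<epsilon>)"
    by (subst nn_integral_cmult) (auto intro!: mult_left_mono gauss_moments(4)[OF e])
  also have "\<dots> = ennreal (2 * (2 * \<epsilon> * sqrt \<epsilon>))" using e by (intro ennreal_mult[symmetric]) auto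
  also have "2 * (2 * \<epsilon> * sqrt \<epsilon>) = 4 * \<epsilon> * sqrt \<epsilon>" by simp
  finally show ?thesis .
qed

lemma nn_integral_f_square_le:
  assumes e: "0 < \<epsilon>"
  shows "(\<integral>\<^sup>+ x. (\<integral>\<^sup>+ z. ennreal ((f x (x + z))\<^sup>2) * ennreal (gauss \<epsilon> z) \<partial>lborel) \<partial>lborel) \<le> ennreal (4 * \<epsilon> * sqrt \<epsilon>)"
proof (rule order_trans[OF _ nn_integral_gauss_triangle_le[OF e]], intro nn_integral_mono mult_right_mono)
  fix x z
  have "(f x (x + z))\<^sup>2 \<le> z\<^sup>2" using f_le[of x "x + z"] f_nonneg[of x "x + z"]
    by (intro abs_le_square_iff[THEN iffD1]) auto
  then show "ennreal ((f x (x + z))\<^sup>2) \<le> ennreal (z\<^sup>2) * indicator {- \<bar>z\<bar>..\<bar>z\<bar>} x"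
    using f_support[of x "x + z"] by (cases "f x (x + z) = 0") (auto simp: indicator_def ennreal_leI)
qed auto

lemma crossing_kernel_moment:
  assumes e: "0 < \<epsilon>"
  shows "(\<integral>\<^sup>+ x. ennreal (\<bar>x\<bar> * crossing_kernel \<epsilon> x) \<partial>lborel) \<le> ennreal (4 * sqrt \<epsilon>)"
proof -
  have "(\<integral>\<^sup>+ x. ennreal (\<bar>x\<bar> * crossing_kernel \<epsilon> x) \<partial>lborel) =
    (\<integral>\<^sup>+ x. ennreal (1 / \<epsilon>) * (\<integral>\<^sup>+ z. ennreal \<bar>x\<bar> * (ennreal (f x (x + z)) * ennreal (gauss \<epsilon> z)) \<partial>lborel) \<partial>lborel)"
    using crossing_kernel_nonneg[OF e]
    by (intro nn_integral_cong) (simp add: ennreal_mult ennreal_crossing_kernel[OF e] nn_integral_cmult ac_simps)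
  also have "\<dots> = ennreal (1 / \<epsilon>) * (\<integral>\<^sup>+ x. (\<integral>\<^sup>+ z. ennreal \<bar>x\<bar> * (ennreal (f x (x + z)) * ennreal (gauss \<epsilon> z)) \<partial>lborel) \<partial>lborel)"
    by (rule nn_integral_cmult) measurable
  also have "\<dots> \<le> ennreal (1 / \<epsilon>) * (\<integral>\<^sup>+ x. (\<integral>\<^sup>+ z. ennreal (z\<^sup>2) * indicator {- \<bar>z\<bar>..\<bar>z\<bar>} x * ennreal (gauss \<epsilon> z) \<partial>lborel) \<partial>lborel)"
  proof (intro mult_left_mono nn_integral_mono)
    fix x z
    have "ennreal \<bar>x\<bar> * ennreal (f x (x + z)) \<le> ennreal (z\<^sup>2) * indicator {- \<bar>z\<bar>..\<bar>z\<bar>} x"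
    proof (cases "f x (x + z) = 0")
      case False
      then have x: "\<bar>x\<bar> \<le> \<bar>z\<bar>" using f_support[of x "x + z"] by simp
      have "\<bar>x\<bar> * f x (x + z) \<le> \<bar>z\<bar> * \<bar>z\<bar>"
        using x f_le[of x "x + z"] f_nonneg[of x "x + z"] by (intro mult_mono) auto
      then have "\<bar>x\<bar> * f x (x + z) \<le> z\<^sup>2" by (simp add: power2_eq_square)
      then show ?thesis using x f_nonneg[of x "x + z"]
        by (subst ennreal_mult[symmetric]) (auto simp: indicator_def ennreal_leI)
    qed simp
    then have "ennreal \<bar>x\<bar> * ennreal (f x (x + z)) * ennreal (gauss \<epsilon> z) \<le> ennreal (z\<^sup>2) * indicator {- \<bar>z\<bar>..\<bar>z\<bar>} x * ennreal (gauss \<epsilon> z)"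
      by (rule mult_right_mono) simp
    then show "ennreal \<bar>x\<bar> * (ennreal (f x (x + z)) * ennreal (gauss \<epsilon> z)) \<le> ennreal (z\<^sup>2) * indicator {- \<bar>z\<bar>..\<bar>z\<bar>} x * ennreal (gauss \<epsilon> z)"
      by (simp add: mult.assoc)
  qed auto
  also have "\<dots> \<le> ennreal (1 / \<epsilon>) * ennreal (4 * \<epsilon> * sqrt \<epsilon>)"
    by (intro mult_left_mono nn_integral_gauss_triangle_le[OF e]) auto
  also have "\<dots> = ennreal (1 / \<epsilon> * (4 * \<epsilon> * sqrt \<epsilon>))" using e by (intro ennreal_mult[symmetric]) auto
  finally show ?thesis using e by simp
qed

text \<open>The kernels for \<open>\<epsilon>\<close> and \<open>\<epsilon> / 4\<close> have the same mass, so their difference has integral zero. This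
  cancellation makes the comparison of successive scales small.\<close>

definition kernel_diff :: "real \<Rightarrow> real \<Rightarrow> real" where
  "kernel_diff \<epsilon> x = crossing_kernel \<epsilon> x - crossing_kernel (\<epsilon> / 4) x"

lemma kernel_diff_measurable[measurable]: "kernel_diff \<epsilon> \<in> borel_measurable borel"
  unfolding kernel_diff_def by measurable

lemma integrable_crossing_kernel: "0 < \<epsilon> \<Longrightarrow> integrable lborel (crossing_kernel \<epsilon>)"
  using crossing_kernel_mass[of \<epsilon>] crossing_kernel_nonneg[of \<epsilon>]
  by (intro integrableI_bounded) auto

lemma integral_crossing_kernel: "0 < \<epsilon> \<Longrightarrow> (\<integral>x. crossing_kernel \<epsilon> x \<partial>lborel) = 1 / 4"
  using crossing_kernel_mass[of \<epsilon>] crossing_kernel_nonneg[of \<epsilon>]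
  by (subst integral_eq_nn_integral) auto

lemma abs_kernel_diff_le:
  assumes "0 < \<epsilon>" shows "\<bar>kernel_diff \<epsilon> x\<bar> \<le> 2 / sqrt \<epsilon>"
proof -
  have "crossing_kernel (\<epsilon> / 4) x \<le> 2 / sqrt \<epsilon>" "crossing_kernel \<epsilon> x \<le> 1 / sqrt \<epsilon>"
    using crossing_kernel_le[of "\<epsilon> / 4" x] crossing_kernel_le[of \<epsilon> x] assms by (auto simp: real_sqrt_divide)
  moreover have "1 / sqrt \<epsilon> \<le> 2 / sqrt \<epsilon>" using assms by (intro divide_right_mono) auto
  moreover have "0 \<le> crossing_kernel \<epsilon> x" "0 \<le> crossing_kernel (\<epsilon> / 4) x"
    using assms by (auto intro!: crossing_kernel_nonneg)
  ultimately show ?thesis unfolding kernel_diff_def by linarith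
qed

lemma nn_integral_abs_kernel_diff:
  assumes "0 < \<epsilon>" shows "(\<integral>\<^sup>+ x. ennreal \<bar>kernel_diff \<epsilon> x\<bar> \<partial>lborel) \<le> ennreal (1 / 2)"
proof -
  have "(\<integral>\<^sup>+ x. ennreal \<bar>kernel_diff \<epsilon> x\<bar> \<partial>lborel) \<le> (\<integral>\<^sup>+ x. ennreal (crossing_kernel \<epsilon> x) + ennreal (crossing_kernel (\<epsilon> / 4) x) \<partial>lborel)"
    using crossing_kernel_nonneg[of \<epsilon>] crossing_kernel_nonneg[of "\<epsilon> / 4"] assms
    by (intro nn_integral_mono) (auto simp: kernel_diff_def ennreal_plus[symmetric] abs_if simp del: ennreal_plus intro!: ennreal_leI)
  also have "\<dots> = ennreal (1 / 4) + ennreal (1 / 4)"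
    using assms by (subst nn_integral_add) (auto simp: crossing_kernel_mass)
  also have "\<dots> = ennreal (1 / 4 + 1 / 4)" by (rule ennreal_plus[symmetric]) auto
  finally show ?thesis by simp
qed

lemma nn_integral_powr_kernel_diff:
  assumes e: "0 < \<epsilon>" and \<theta>: "0 < \<theta>" "\<theta> < 1"
  shows "(\<integral>\<^sup>+ x. ennreal (\<bar>x\<bar> powr \<theta> * \<bar>kernel_diff \<epsilon> x\<bar>) \<partial>lborel) \<le> ennreal (7 * \<epsilon> powr (\<theta> / 2))"
proof -
  define c where "c = \<epsilon> powr (\<theta> / 2)"
  have c: "0 \<le> c" by (simp add: c_def)
  have pw: "\<bar>x\<bar> powr \<theta> \<le> c * (1 + \<bar>x\<bar> / sqrt \<epsilon>)" for x
  proof -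
    define s where "s = \<bar>x\<bar> / sqrt \<epsilon>"
    have s0: "0 \<le> s" using e by (simp add: s_def)
    have "\<bar>x\<bar> = sqrt \<epsilon> * s" using e by (simp add: s_def)
    then have "\<bar>x\<bar> powr \<theta> = c * s powr \<theta>"
      using e s0 by (simp add: powr_mult c_def powr_half_sqrt[symmetric] powr_powr)
    also have "s powr \<theta> \<le> 1 + s"
    proof (cases "s \<le> 1")
      case True then have "s powr \<theta> \<le> 1" using s0 \<theta> by (simp add: powr_le1)
      then show ?thesis using s0 by simp
    next
      case False
      then have "s powr \<theta> \<le> s powr 1" using \<theta> by (intro powr_mono) auto
      then show ?thesis using False by simp
    qed
    finally show ?thesis using c by (simp add: s_def mult_left_mono)
  qed
  let ?k = "crossing_kernel"
  have k0: "0 \<le> ?k \<epsilon> x" "0 \<le> ?k (\<epsilon> / 4) x" for x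
    using crossing_kernel_nonneg[of \<epsilon>] crossing_kernel_nonneg[of "\<epsilon> / 4"] e by auto
  have "(\<integral>\<^sup>+ x. ennreal (\<bar>x\<bar> powr \<theta> * \<bar>kernel_diff \<epsilon> x\<bar>) \<partial>lborel) \<le>
      (\<integral>\<^sup>+ x. ennreal c * ennreal \<bar>kernel_diff \<epsilon> x\<bar> +
        ennreal (c / sqrt \<epsilon>) * (ennreal (\<bar>x\<bar> * ?k \<epsilon> x) + ennreal (\<bar>x\<bar> * ?k (\<epsilon> / 4) x)) \<partial>lborel)"
  proof (intro nn_integral_mono)
    fix x
    have d: "\<bar>kernel_diff \<epsilon> x\<bar> \<le> ?k \<epsilon> x + ?k (\<epsilon> / 4) x" using k0[of x] by (auto simp: kernel_diff_def)
    have "\<bar>x\<bar> powr \<theta> * \<bar>kernel_diff \<epsilon> x\<bar> \<le> c * (1 + \<bar>x\<bar> / sqrt \<epsilon>) * \<bar>kernel_diff \<epsilon> x\<bar>"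
      by (intro mult_right_mono pw) auto
    also have "\<dots> = c * \<bar>kernel_diff \<epsilon> x\<bar> + c / sqrt \<epsilon> * (\<bar>x\<bar> * \<bar>kernel_diff \<epsilon> x\<bar>)"
      by (simp add: algebra_simps)
    also have "\<dots> \<le> c * \<bar>kernel_diff \<epsilon> x\<bar> + c / sqrt \<epsilon> * (\<bar>x\<bar> * ?k \<epsilon> x + \<bar>x\<bar> * ?k (\<epsilon> / 4) x)"
      using mult_left_mono[OF d, of "\<bar>x\<bar>"] c e by (intro add_left_mono mult_left_mono) (auto simp: distrib_left)
    finally have "ennreal (\<bar>x\<bar> powr \<theta> * \<bar>kernel_diff \<epsilon> x\<bar>) \<le>
        ennreal (c * \<bar>kernel_diff \<epsilon> x\<bar> + c / sqrt \<epsilon> * (\<bar>x\<bar> * ?k \<epsilon> x + \<bar>x\<bar> * ?k (\<epsilon> / 4) x))"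
      by (rule ennreal_leI)
    also have "\<dots> = ennreal c * ennreal \<bar>kernel_diff \<epsilon> x\<bar> +
        ennreal (c / sqrt \<epsilon>) * (ennreal (\<bar>x\<bar> * ?k \<epsilon> x) + ennreal (\<bar>x\<bar> * ?k (\<epsilon> / 4) x))"
      using c e k0[of x] by (simp add: ennreal_mult[symmetric] ennreal_plus[symmetric] del: ennreal_plus)
    finally show "ennreal (\<bar>x\<bar> powr \<theta> * \<bar>kernel_diff \<epsilon> x\<bar>) \<le> ennreal c * ennreal \<bar>kernel_diff \<epsilon> x\<bar> +
        ennreal (c / sqrt \<epsilon>) * (ennreal (\<bar>x\<bar> * ?k \<epsilon> x) + ennreal (\<bar>x\<bar> * ?k (\<epsilon> / 4) x))" .
  qed
  also have "\<dots> = ennreal c * (\<integral>\<^sup>+ x. ennreal \<bar>kernel_diff \<epsilon> x\<bar> \<partial>lborel) + ennreal (c / sqrt \<epsilon>) *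
      ((\<integral>\<^sup>+ x. ennreal (\<bar>x\<bar> * ?k \<epsilon> x) \<partial>lborel) + (\<integral>\<^sup>+ x. ennreal (\<bar>x\<bar> * ?k (\<epsilon> / 4) x) \<partial>lborel))"
    by (simp add: nn_integral_add nn_integral_cmult)
  also have "\<dots> \<le> ennreal c * ennreal (1 / 2) + ennreal (c / sqrt \<epsilon>) * (ennreal (4 * sqrt \<epsilon>) + ennreal (4 * sqrt (\<epsilon> / 4)))"
    using e by (intro add_mono mult_left_mono nn_integral_abs_kernel_diff crossing_kernel_moment) auto
  also have "\<dots> = ennreal (c * (1 / 2) + c / sqrt \<epsilon> * (4 * sqrt \<epsilon> + 4 * sqrt (\<epsilon> / 4)))"
  proof -
    have "ennreal (4 * sqrt \<epsilon>) + ennreal (4 * sqrt (\<epsilon> / 4)) = ennreal (4 * sqrt \<epsilon> + 4 * sqrt (\<epsilon> / 4))"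
      using e by (intro ennreal_plus[symmetric]) auto
    moreover have "ennreal (c / sqrt \<epsilon>) * ennreal (4 * sqrt \<epsilon> + 4 * sqrt (\<epsilon> / 4)) = ennreal (c / sqrt \<epsilon> * (4 * sqrt \<epsilon> + 4 * sqrt (\<epsilon> / 4)))"
      using e c by (intro ennreal_mult[symmetric]) auto
    moreover have "ennreal c * ennreal (1 / 2) = ennreal (c * (1 / 2))" using c by (intro ennreal_mult[symmetric]) auto
    moreover have "ennreal (c * (1 / 2)) + ennreal (c / sqrt \<epsilon> * (4 * sqrt \<epsilon> + 4 * sqrt (\<epsilon> / 4))) = 
       ennreal (c * (1 / 2) + c / sqrt \<epsilon> * (4 * sqrt \<epsilon> + 4 * sqrt (\<epsilon> / 4)))"
      using e c by (intro ennreal_plus[symmetric]) auto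
    ultimately show ?thesis by simp
  qed
  also have "\<dots> \<le> ennreal (7 * c)"
    using e c by (intro ennreal_leI) (simp add: real_sqrt_divide field_simps)
  finally show ?thesis by (simp add: c_def)
qed

text \<open>Because \<open>kernel_diff \<epsilon>\<close> has integral zero, the Gaussian density at \<open>y - x\<close> may be replaced by its
  difference to the density at \<open>- x\<close>. By \<open>gauss_Hoelder\<close> that difference is
  \<open>O(\<bar>y\<bar> powr \<theta>)\<close>, and \<open>y\<close> is of order \<open>sqrt \<epsilon>\<close> on the bulk of the kernel.\<close>

lemma abs_heat_kernel_diff_le:
  assumes e: "0 < \<epsilon>" and r: "0 < r" and \<theta>: "0 < \<theta>" "\<theta> < 1"
  shows "\<bar>\<integral>z. kernel_diff \<epsilon> (x + z) * gauss r z \<partial>lborel\<bar> \<le> 7 * \<epsilon> powr (\<theta> / 2) * r powr (- (1 + \<theta>) / 2)"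
proof -
  let ?h = "kernel_diff \<epsilon>"
  have h: "integrable lborel ?h" "(\<integral>y. ?h y \<partial>lborel) = 0"
    unfolding kernel_diff_def using e by (auto simp: integral_crossing_kernel integrable_crossing_kernel)
  have hg: "integrable lborel (\<lambda>y. ?h y * gauss r (y - x))"
  proof (rule Bochner_Integration.integrable_bound[OF integrable_mult_left[OF h(1), of "1 / sqrt r"]])
    show "AE y in lborel. norm (?h y * gauss r (y - x)) \<le> norm (?h y * (1 / sqrt r))"
      using gauss_le[OF r] r by (auto simp: abs_mult simp del: times_divide_eq_right intro!: mult_left_mono)
  qed measurable
  have "(\<integral>z. ?h (x + z) * gauss r z \<partial>lborel) = (\<integral>y. ?h y * gauss r (y - x) \<partial>lborel)"
    by (subst lborel_integral_real_affine[of 1 "\<lambda>y. ?h y * gauss r (y - x)" x]) auto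
  also have "\<dots> = (\<integral>y. ?h y * gauss r (y - x) \<partial>lborel) - (\<integral>y. ?h y * gauss r (0 - x) \<partial>lborel)"
    by (simp add: h)
  also have "\<dots> = (\<integral>y. ?h y * (gauss r (y - x) - gauss r (0 - x)) \<partial>lborel)"
    using h hg by (subst Bochner_Integration.integral_diff[symmetric]) (auto simp: right_diff_distrib)
  finally have eq: "(\<integral>z. ?h (x + z) * gauss r z \<partial>lborel) = (\<integral>y. ?h y * (gauss r (y - x) - gauss r (0 - x)) \<partial>lborel)" .
  have int: "integrable lborel (\<lambda>y. ?h y * (gauss r (y - x) - gauss r (0 - x)))"
    unfolding right_diff_distrib using h hg by (intro Bochner_Integration.integrable_diff) auto
  have "ennreal \<bar>\<integral>y. ?h y * (gauss r (y - x) - gauss r (0 - x)) \<partial>lborel\<bar> \<le>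
      (\<integral>\<^sup>+ y. ennreal (norm (?h y * (gauss r (y - x) - gauss r (0 - x)))) \<partial>lborel)"
    using integral_norm_bound_ennreal[OF int] by simp
  also have "\<dots> \<le> (\<integral>\<^sup>+ y. ennreal (r powr (- (1 + \<theta>) / 2)) * ennreal (\<bar>y\<bar> powr \<theta> * \<bar>?h y\<bar>) \<partial>lborel)"
  proof (intro nn_integral_mono)
    fix y
    have "norm (?h y * (gauss r (y - x) - gauss r (0 - x))) \<le> \<bar>?h y\<bar> * (\<bar>y\<bar> powr \<theta> * r powr (- (1 + \<theta>) / 2))"
      using gauss_Hoelder[OF r \<theta>, of "y - x" "0 - x"] by (auto simp: abs_mult intro!: mult_left_mono)
    then have "ennreal (norm (?h y * (gauss r (y - x) - gauss r (0 - x)))) \<le> ennreal (r powr (- (1 + \<theta>) / 2) * (\<bar>y\<bar> powr \<theta> * \<bar>?h y\<bar>))"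
      by (intro ennreal_leI) (simp add: ac_simps)
    also have "\<dots> = ennreal (r powr (- (1 + \<theta>) / 2)) * ennreal (\<bar>y\<bar> powr \<theta> * \<bar>?h y\<bar>)" by (rule ennreal_mult) auto
    finally show "ennreal (norm (?h y * (gauss r (y - x) - gauss r (0 - x)))) \<le> ennreal (r powr (- (1 + \<theta>) / 2)) * ennreal (\<bar>y\<bar> powr \<theta> * \<bar>?h y\<bar>)" .
  qed
  also have "\<dots> \<le> ennreal (r powr (- (1 + \<theta>) / 2)) * ennreal (7 * \<epsilon> powr (\<theta> / 2))"
    by (subst nn_integral_cmult) (auto intro!: mult_left_mono nn_integral_powr_kernel_diff[OF e \<theta>])
  also have "\<dots> = ennreal (r powr (- (1 + \<theta>) / 2) * (7 * \<epsilon> powr (\<theta> / 2)))" by (rule ennreal_mult[symmetric]) auto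
  finally show ?thesis unfolding eq by (subst (asm) ennreal_le_iff) (auto simp: ac_simps)
qed

end

section \<open>Brownian paths\<close>

context standard_brownian_motion
begin

text \<open>Extending the paths by \<open>X 0\<close> to negative times makes them continuous on the whole line, which
  avoids guards on the time parameter.\<close>

definition path :: "real \<Rightarrow> 'a \<Rightarrow> real" where "path u \<omega> = X (max 0 u) \<omega>"

lemma path_eq: "0 \<le> u \<Longrightarrow> path u \<omega> = X u \<omega>"
  by (simp add: path_def)

lemma path_continuous:
  assumes "\<omega> \<in> space M" shows "continuous_on UNIV (\<lambda>u. path u \<omega>)"
  unfolding path_def by (rule continuous_on_compose2[OF BM_continuous[OF assms]]) (auto intro!: continuous_intros)

lemma path_continuous_on [continuous_intros]:
  assumes "\<omega> \<in> space M" "continuous_on S g" shows "continuous_on S (\<lambda>x. path (g x) \<omega>)"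
  by (rule continuous_on_compose2[OF path_continuous[OF assms(1)] assms(2)]) simp

lemma path_random_variable: "path u \<in> borel_measurable M"
  using random_variable_BM[of "max 0 u"] by (simp add: path_def[abs_def])

text \<open>Continuous paths are limits of step functions in time.\<close>

lemma path_jointly_measurable: "(\<lambda>(u, \<omega>). path u \<omega>) \<in> borel_measurable (borel \<Otimes>\<^sub>M M)"
proof (rule borel_measurable_LIMSEQ_real)
  define g where "g n u = \<lfloor>real (Suc n) * u\<rfloor>" for n and u :: real
  fix n
  show "(\<lambda>(u, \<omega>). path (real_of_int (g n u) / real (Suc n)) \<omega>) \<in> borel_measurable (borel \<Otimes>\<^sub>M M)"
    unfolding case_prod_beta g_def
  proof (rule measurable_compose_countable[where f = "\<lambda>i x. path (real_of_int i / real (Suc n)) (snd x)"])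
    show "(\<lambda>x. path (real_of_int i / real (Suc n)) (snd x)) \<in> borel_measurable (borel \<Otimes>\<^sub>M M)" for i
      by (rule measurable_compose[OF measurable_snd path_random_variable])
  qed measurable
next
  fix x :: "real \<times> 'a" assume "x \<in> space (borel \<Otimes>\<^sub>M M)"
  then obtain u \<omega> where x: "x = (u, \<omega>)" "\<omega> \<in> space M" by (auto simp: space_pair_measure)
  have "(\<lambda>n. real_of_int \<lfloor>real (Suc n) * u\<rfloor> / real (Suc n)) \<longlonglongrightarrow> u"
  proof (rule tendsto_sandwich[of "\<lambda>n. u - 1 / real (Suc n)" _ _ "\<lambda>n. u"])
    show "\<forall>\<^sub>F n in sequentially. u - 1 / real (Suc n) \<le> real_of_int \<lfloor>real (Suc n) * u\<rfloor> / real (Suc n)"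
    proof (intro always_eventually allI)
      fix n
      have "real (Suc n) * u - 1 \<le> real_of_int \<lfloor>real (Suc n) * u\<rfloor>" by linarith
      then have "(real (Suc n) * u - 1) / real (Suc n) \<le> real_of_int \<lfloor>real (Suc n) * u\<rfloor> / real (Suc n)"
        by (rule divide_right_mono) simp
      then show "u - 1 / real (Suc n) \<le> real_of_int \<lfloor>real (Suc n) * u\<rfloor> / real (Suc n)"
        by (simp add: diff_divide_distrib del: of_nat_Suc)
    qed
    show "\<forall>\<^sub>F n in sequentially. real_of_int \<lfloor>real (Suc n) * u\<rfloor> / real (Suc n) \<le> u"
    proof (intro always_eventually allI)
      fix n
      have "real_of_int \<lfloor>real (Suc n) * u\<rfloor> \<le> real (Suc n) * u" by linarith
      then have "real_of_int \<lfloor>real (Suc n) * u\<rfloor> / real (Suc n) \<le> (real (Suc n) * u) / real (Suc n)"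
        by (rule divide_right_mono) simp
      then show "real_of_int \<lfloor>real (Suc n) * u\<rfloor> / real (Suc n) \<le> u" by (simp del: of_nat_Suc)
    qed
    show "(\<lambda>n. u - 1 / real (Suc n)) \<longlonglongrightarrow> u"
      using tendsto_diff[OF tendsto_const[of u] LIMSEQ_inverse_real_of_nat] by (simp add: inverse_eq_divide)
  qed simp
  from continuous_on_tendsto_compose[OF path_continuous[OF x(2)] this]
  show "(\<lambda>n. case x of (u, \<omega>) \<Rightarrow> path (real_of_int \<lfloor>real (Suc n) * u\<rfloor> / real (Suc n)) \<omega>) \<longlonglongrightarrow> (case x of (u, \<omega>) \<Rightarrow> path u \<omega>)"
    by (simp add: x(1))
qed

lemma path_measurable[measurable]:
  assumes "g \<in> borel_measurable N" "h \<in> measurable N M"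
  shows "(\<lambda>x. path (g x) (h x)) \<in> borel_measurable N"
  using measurable_compose[OF measurable_Pair[OF assms] path_jointly_measurable] by simp

text \<open>The increments are independent along the times \<open>0, u, u', v, w\<close>; the positions at \<open>u\<close>, \<open>u'\<close> and
  \<open>v\<close> are sums of increments because almost surely \<open>X 0 = 0\<close>. Three earlier times
  are what two values of the integrand at disjoint time intervals require.\<close>

lemma law_increment_after:
  assumes t: "0 \<le> u" "u \<le> u'" "u' \<le> v" "v < w"
  shows "distr M ((borel \<Otimes>\<^sub>M borel \<Otimes>\<^sub>M borel) \<Otimes>\<^sub>M borel) (\<lambda>\<omega>. ((path u \<omega>, path u' \<omega>, path v \<omega>), path w \<omega> - path v \<omega>)) =
    distr M (borel \<Otimes>\<^sub>M borel \<Otimes>\<^sub>M borel) (\<lambda>\<omega>. (path u \<omega>, path u' \<omega>, path v \<omega>)) \<Otimes>\<^sub>M density lborel (gauss (w - v))"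
proof -
  \<comment> \<open>The sequence of times stays at \<open>w\<close> from index \<open>4\<close> on, since independence is assumed for infinite sequences.\<close>
  define \<tau> :: "nat \<Rightarrow> real" where "\<tau> i = (if i = 0 then 0 else if i = 1 then u else if i = 2 then u' else if i = 3 then v else w)" for i
  have "mono \<tau>" unfolding mono_def \<tau>_def using t by auto
  from BM_indep_increments[OF _ this, of 4]
  have ind: "indep_vars (\<lambda>_. borel) (\<lambda>i \<omega>. X (\<tau> (Suc i)) \<omega> - X (\<tau> i) \<omega>) {..<4}"
    by (simp add: \<tau>_def)
  have ind2: "indep_var (PiM {0, 1, 2} (\<lambda>_. borel)) (\<lambda>\<omega>. restrict (\<lambda>i. X (\<tau> (Suc i)) \<omega> - X (\<tau> i) \<omega>) {0, 1, 2})
     (PiM {3} (\<lambda>_. borel)) (\<lambda>\<omega>. restrict (\<lambda>i. X (\<tau> (Suc i)) \<omega> - X (\<tau> i) \<omega>) {3 :: nat})"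
    by (rule indep_var_restrict[OF ind]) auto
  let ?B3 = "borel \<Otimes>\<^sub>M borel \<Otimes>\<^sub>M borel :: (real \<times> real \<times> real) measure"
  let ?W = "\<lambda>\<omega>. (path u \<omega>, path u' \<omega>, path v \<omega>)"
  let ?Winc = "\<lambda>\<omega>. (path u \<omega> - path 0 \<omega>, path u' \<omega> - path 0 \<omega>, path v \<omega> - path 0 \<omega>)"
  let ?D = "\<lambda>\<omega>. path w \<omega> - path v \<omega>"
  let ?RA = "\<lambda>\<omega>. restrict (\<lambda>i. X (\<tau> (Suc i)) \<omega> - X (\<tau> i) \<omega>) {0, 1, 2 :: nat}"
  let ?RB = "\<lambda>\<omega>. restrict (\<lambda>i. X (\<tau> (Suc i)) \<omega> - X (\<tau> i) \<omega>) {3 :: nat}"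
  let ?PA = "PiM {0, 1, 2 :: nat} (\<lambda>_. borel :: real measure)"
  let ?PB = "PiM {3 :: nat} (\<lambda>_. borel :: real measure)"
  let ?YA = "\<lambda>g :: nat \<Rightarrow> real. (g 0, g 0 + g 1, g 0 + g 1 + g 2)"
  let ?YB = "\<lambda>g :: nat \<Rightarrow> real. g 3"
  have RA[measurable]: "?RA \<in> measurable M ?PA" and RB[measurable]: "?RB \<in> measurable M ?PB"
    and eqR: "distr M ?PA ?RA \<Otimes>\<^sub>M distr M ?PB ?RB = distr M (?PA \<Otimes>\<^sub>M ?PB) (\<lambda>\<omega>. (?RA \<omega>, ?RB \<omega>))"
    using ind2 unfolding indep_var_distribution_eq by auto
  have YA[measurable]: "?YA \<in> measurable ?PA ?B3" by measurable
  have YB[measurable]: "?YB \<in> measurable ?PB borel" by measurable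
  have W0: "?YA (?RA \<omega>) = ?Winc \<omega>" and D: "?YB (?RB \<omega>) = ?D \<omega>" for \<omega>
    using t by (auto simp: \<tau>_def path_eq)
  interpret PD: prob_space "distr M borel ?D" by (rule prob_space_distr) measurable
  have dD: "distr M borel ?D = distr (distr M ?PB ?RB) borel ?YB"
    by (subst distr_distr[OF YB RB]) (simp only: comp_def D)
  have dW: "distr M ?B3 ?Winc = distr (distr M ?PA ?RA) ?B3 ?YA"
    by (subst distr_distr[OF YA RA]) (simp only: comp_def W0)
  have "distr M ?B3 ?Winc \<Otimes>\<^sub>M distr M borel ?D =
      distr (distr M ?PA ?RA \<Otimes>\<^sub>M distr M ?PB ?RB) (?B3 \<Otimes>\<^sub>M borel) (\<lambda>(x, y). (?YA x, ?YB y))"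
    unfolding dW dD
  proof (rule pair_measure_distr)
    show "sigma_finite_measure (distr (distr M ?PB ?RB) borel ?YB)"
      unfolding dD[symmetric] by (rule PD.sigma_finite_measure_axioms)
  qed simp_all
  also have "\<dots> = distr M (?B3 \<Otimes>\<^sub>M borel) ((\<lambda>(x, y). (?YA x, ?YB y)) \<circ> (\<lambda>\<omega>. (?RA \<omega>, ?RB \<omega>)))"
    unfolding eqR by (rule distr_distr) measurable
  also have "((\<lambda>(x, y). (?YA x, ?YB y)) \<circ> (\<lambda>\<omega>. (?RA \<omega>, ?RB \<omega>))) = (\<lambda>\<omega>. (?Winc \<omega>, ?D \<omega>))"
    unfolding comp_def prod.case W0 D ..
  finally have eq: "distr M ?B3 ?Winc \<Otimes>\<^sub>M distr M borel ?D = distr M (?B3 \<Otimes>\<^sub>M borel) (\<lambda>\<omega>. (?Winc \<omega>, ?D \<omega>))" .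
  have AE0: "AE \<omega> in M. path 0 \<omega> = 0" using BM_start by (simp add: path_def)
  have 1: "distr M ?B3 ?Winc = distr M ?B3 ?W"
    by (rule distr_cong_AE) (use AE0 in \<open>auto elim: eventually_mono\<close>)
  have 2: "distr M (?B3 \<Otimes>\<^sub>M borel) (\<lambda>\<omega>. (?Winc \<omega>, ?D \<omega>)) = distr M (?B3 \<Otimes>\<^sub>M borel) (\<lambda>\<omega>. (?W \<omega>, ?D \<omega>))"
    by (rule distr_cong_AE) (use AE0 in \<open>auto elim: eventually_mono\<close>)
  have "distributed M lborel ?D (gauss (w - v))"
    using BM_increments[of v w] t by (simp add: path_eq)
  then have "distr M lborel ?D = density lborel (gauss (w - v))"
    by (rule distributed_distr_eq_density)
  moreover have "distr M borel ?D = distr M lborel ?D" by (rule distr_cong) auto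
  ultimately have 3: "distr M borel ?D = density lborel (gauss (w - v))" by (rule trans[rotated])
  have A: "distr M ?B3 ?W \<Otimes>\<^sub>M density lborel (gauss (w - v)) = distr M ?B3 ?Winc \<Otimes>\<^sub>M distr M borel ?D"
    by (rule arg_cong2[where f = pair_measure, OF 1[symmetric] 3[symmetric]])
  show ?thesis by (rule sym, rule trans[OF trans[OF A eq] 2])
qed

lemma nn_integral_path_increment:
  assumes t: "0 \<le> s" "s < t" and g[measurable]: "g \<in> borel_measurable borel"
  shows "(\<integral>\<^sup>+ \<omega>. g (path t \<omega> - path s \<omega>) \<partial>M) = (\<integral>\<^sup>+ z. g z * ennreal (gauss (t - s) z) \<partial>lborel)"
proof -
  have "distributed M lborel (\<lambda>\<omega>. path t \<omega> - path s \<omega>) (gauss (t - s))"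
    using BM_increments[of s t] t by (simp add: path_eq)
  from distributed_nn_integral[OF this, of g] show ?thesis by (simp add: mult.commute)
qed

lemma nn_integral_path_le:
  assumes u: "0 < u" and g[measurable]: "g \<in> borel_measurable borel"
  shows "(\<integral>\<^sup>+ \<omega>. g (path u \<omega>) \<partial>M) \<le> ennreal (1 / sqrt u) * (\<integral>\<^sup>+ x. g x \<partial>lborel)"
proof -
  have "AE \<omega> in M. path 0 \<omega> = 0" using BM_start by (simp add: path_def)
  then have "(\<integral>\<^sup>+ \<omega>. g (path u \<omega>) \<partial>M) = (\<integral>\<^sup>+ \<omega>. g (path u \<omega> - path 0 \<omega>) \<partial>M)"
    by (intro nn_integral_cong_AE) (auto elim: eventually_mono)
  also have "\<dots> = (\<integral>\<^sup>+ z. g z * ennreal (gauss (u - 0) z) \<partial>lborel)"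
    by (rule nn_integral_path_increment) (use u in auto)
  also have "\<dots> \<le> (\<integral>\<^sup>+ z. ennreal (1 / sqrt u) * g z \<partial>lborel)"
    using gauss_le[OF u] by (intro nn_integral_mono) (auto simp: mult.commute intro!: mult_left_mono ennreal_leI)
  also have "\<dots> = ennreal (1 / sqrt u) * (\<integral>\<^sup>+ x. g x \<partial>lborel)"
    by (rule nn_integral_cmult) measurable
  finally show ?thesis .
qed

lemma nn_integral_path_pair_le:
  assumes u: "0 < u" "u < w" and g[measurable]: "case_prod g \<in> borel_measurable (borel \<Otimes>\<^sub>M borel)"
  shows "(\<integral>\<^sup>+ \<omega>. g (path u \<omega>) (path w \<omega>) \<partial>M) \<le>
    ennreal (1 / sqrt u) * (\<integral>\<^sup>+ x. (\<integral>\<^sup>+ z. g x (x + z) * ennreal (gauss (w - u) z) \<partial>lborel) \<partial>lborel)"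
proof -
  have gm[measurable]: "(\<lambda>x. g (a x) (b x)) \<in> borel_measurable N" if "a \<in> borel_measurable N" "b \<in> borel_measurable N" for a b and N :: "'z measure"
    using measurable_compose[OF measurable_Pair[OF that] g] by simp
  let ?B3 = "borel \<Otimes>\<^sub>M borel \<Otimes>\<^sub>M borel :: (real \<times> real \<times> real) measure"
  let ?W = "\<lambda>\<omega>. (path u \<omega>, path u \<omega>, path u \<omega>)"
  let ?N = "density lborel (gauss (w - u))"
  have "0 < sqrt (w - u)" using u by simp
  then interpret N: prob_space ?N by (rule prob_space_normal_density)
  have "(\<integral>\<^sup>+ \<omega>. g (path u \<omega>) (path w \<omega>) \<partial>M) =
      (\<integral>\<^sup>+ p. g (fst (fst p)) (fst (fst p) + snd p) \<partial>distr M (?B3 \<Otimes>\<^sub>M borel) (\<lambda>\<omega>. (?W \<omega>, path w \<omega> - path u \<omega>)))"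
    by (subst nn_integral_distr) auto
  also have "\<dots> = (\<integral>\<^sup>+ p. g (fst (fst p)) (fst (fst p) + snd p) \<partial>(distr M ?B3 ?W \<Otimes>\<^sub>M ?N))"
    by (subst law_increment_after) (use u in auto)
  also have "\<dots> = (\<integral>\<^sup>+ q. (\<integral>\<^sup>+ z. g (fst q) (fst q + z) \<partial>?N) \<partial>distr M ?B3 ?W)"
    by (subst N.nn_integral_fst[symmetric]) (auto cong: measurable_cong_sets)
  also have "\<dots> = (\<integral>\<^sup>+ \<omega>. (\<integral>\<^sup>+ z. g (path u \<omega>) (path u \<omega> + z) \<partial>?N) \<partial>M)"
    by (subst nn_integral_distr) auto
  also have "\<dots> = (\<integral>\<^sup>+ \<omega>. (\<integral>\<^sup>+ z. g (path u \<omega>) (path u \<omega> + z) * ennreal (gauss (w - u) z) \<partial>lborel) \<partial>M)"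
    by (intro nn_integral_cong) (subst nn_integral_density, auto simp: mult.commute)
  also have "\<dots> \<le> ennreal (1 / sqrt u) * (\<integral>\<^sup>+ x. (\<integral>\<^sup>+ z. g x (x + z) * ennreal (gauss (w - u) z) \<partial>lborel) \<partial>lborel)"
    by (rule nn_integral_path_le[OF u(1)]) measurable
  finally show ?thesis .
qed

text \<open>The Markov property in the form in which it is used: the increment after \<open>v\<close> is
  integrated out first. For \<open>\<kappa> = 0\<close> the product is centred.\<close>

lemma abs_expectation_product_le:
  fixes \<phi> \<psi> :: "real \<Rightarrow> real \<Rightarrow> real"
  assumes t: "0 \<le> u" "u \<le> u'" "u' \<le> v" "v < w"
    and [measurable]: "case_prod \<phi> \<in> borel_measurable (borel \<Otimes>\<^sub>M borel)" "case_prod \<psi> \<in> borel_measurable (borel \<Otimes>\<^sub>M borel)"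
    and sq: "(\<integral>\<^sup>+ \<omega>. ennreal ((\<phi> (path u \<omega>) (path u' \<omega>))\<^sup>2) \<partial>M) < \<infinity>" "(\<integral>\<^sup>+ \<omega>. ennreal ((\<psi> (path v \<omega>) (path w \<omega>))\<^sup>2) \<partial>M) < \<infinity>"
    and \<kappa>: "\<And>x. \<bar>\<integral>z. \<psi> x (x + z) * gauss (w - v) z \<partial>lborel\<bar> \<le> \<kappa>"
  shows "ennreal \<bar>expectation (\<lambda>\<omega>. \<phi> (path u \<omega>) (path u' \<omega>) * \<psi> (path v \<omega>) (path w \<omega>))\<bar> \<le>
    ennreal \<kappa> * (\<integral>\<^sup>+ \<omega>. ennreal \<bar>\<phi> (path u \<omega>) (path u' \<omega>)\<bar> \<partial>M)"
proof -
  have \<phi>m[measurable]: "(\<lambda>x. \<phi> (a x) (b x)) \<in> borel_measurable N" if "a \<in> borel_measurable N" "b \<in> borel_measurable N" for a b and N :: "'z measure"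
    using measurable_compose[OF measurable_Pair[OF that] assms(5)] by simp
  have \<psi>m[measurable]: "(\<lambda>x. \<psi> (a x) (b x)) \<in> borel_measurable N" if "a \<in> borel_measurable N" "b \<in> borel_measurable N" for a b and N :: "'z measure"
    using measurable_compose[OF measurable_Pair[OF that] assms(6)] by simp
  let ?B3 = "borel \<Otimes>\<^sub>M borel \<Otimes>\<^sub>M borel :: (real \<times> real \<times> real) measure"
  let ?W = "\<lambda>\<omega>. (path u \<omega>, path u' \<omega>, path v \<omega>)"
  let ?N = "density lborel (gauss (w - v))"
  let ?P = "distr M ?B3 ?W"
  define F where "F = (\<lambda>p :: (real \<times> real \<times> real) \<times> real. \<phi> (fst (fst p)) (fst (snd (fst p))) * \<psi> (snd (snd (fst p))) (snd (snd (fst p)) + snd p))"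
  have Fm[measurable]: "F \<in> borel_measurable (?B3 \<Otimes>\<^sub>M borel)" unfolding F_def by measurable
  have "0 < sqrt (w - v)" using t by simp
  then interpret N: prob_space ?N by (rule prob_space_normal_density)
  interpret P: prob_space ?P by (rule prob_space_distr) measurable
  interpret PN: pair_sigma_finite ?P ?N by unfold_locales
  have key: "distr M (?B3 \<Otimes>\<^sub>M borel) (\<lambda>\<omega>. (?W \<omega>, path w \<omega> - path v \<omega>)) = ?P \<Otimes>\<^sub>M ?N"
    by (rule law_increment_after[OF t])
  have sets: "sets (?P \<Otimes>\<^sub>M ?N) = sets (?B3 \<Otimes>\<^sub>M borel)"
    by (intro sets_pair_measure_cong) auto
  have FE: "F (?W \<omega>, path w \<omega> - path v \<omega>) = \<phi> (path u \<omega>) (path u' \<omega>) * \<psi> (path v \<omega>) (path w \<omega>)" for \<omega>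
    by (simp add: F_def)
  have int: "integrable M (\<lambda>\<omega>. \<phi> (path u \<omega>) (path u' \<omega>) * \<psi> (path v \<omega>) (path w \<omega>))"
  proof (rule Bochner_Integration.integrable_bound)
    show "integrable M (\<lambda>\<omega>. (\<phi> (path u \<omega>) (path u' \<omega>))\<^sup>2 + (\<psi> (path v \<omega>) (path w \<omega>))\<^sup>2)"
      using sq by (intro Bochner_Integration.integrable_add integrableI_bounded) auto
    show "AE \<omega> in M. norm (\<phi> (path u \<omega>) (path u' \<omega>) * \<psi> (path v \<omega>) (path w \<omega>)) \<le> norm ((\<phi> (path u \<omega>) (path u' \<omega>))\<^sup>2 + (\<psi> (path v \<omega>) (path w \<omega>))\<^sup>2)"
    proof (intro AE_I2)
      fix \<omega>
      let ?a = "\<bar>\<phi> (path u \<omega>) (path u' \<omega>)\<bar>" and ?b = "\<bar>\<psi> (path v \<omega>) (path w \<omega>)\<bar>"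
      have "2 * ?a * ?b \<le> ?a\<^sup>2 + ?b\<^sup>2" by (rule sum_squares_bound)
      moreover have "0 \<le> ?a * ?b" by simp
      ultimately have "?a * ?b \<le> ?a\<^sup>2 + ?b\<^sup>2" by linarith
      then show "norm (\<phi> (path u \<omega>) (path u' \<omega>) * \<psi> (path v \<omega>) (path w \<omega>)) \<le> norm ((\<phi> (path u \<omega>) (path u' \<omega>))\<^sup>2 + (\<psi> (path v \<omega>) (path w \<omega>))\<^sup>2)"
        by (simp add: abs_mult)
    qed
  qed measurable
  have Fint: "integrable (?P \<Otimes>\<^sub>M ?N) F"
    unfolding key[symmetric] by (subst integrable_distr_eq) (auto simp: FE int)
  have "expectation (\<lambda>\<omega>. \<phi> (path u \<omega>) (path u' \<omega>) * \<psi> (path v \<omega>) (path w \<omega>)) = integral\<^sup>L (?P \<Otimes>\<^sub>M ?N) F"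
    unfolding key[symmetric] by (subst integral_distr) (auto simp: FE)
  also have "\<dots> = (\<integral>q. (\<integral>z. F (q, z) \<partial>?N) \<partial>?P)"
    by (rule PN.integral_fst'[OF Fint, symmetric])
  finally have "ennreal \<bar>expectation (\<lambda>\<omega>. \<phi> (path u \<omega>) (path u' \<omega>) * \<psi> (path v \<omega>) (path w \<omega>))\<bar> \<le> (\<integral>\<^sup>+ q. ennreal (norm (\<integral>z. F (q, z) \<partial>?N)) \<partial>?P)"
    using integral_norm_bound_ennreal[OF PN.integrable_fst'[OF Fint]] by simp
  also have "\<dots> \<le> (\<integral>\<^sup>+ q. ennreal \<kappa> * ennreal \<bar>\<phi> (fst q) (fst (snd q))\<bar> \<partial>?P)"
  proof (intro nn_integral_mono)
    fix q
    have k0: "0 \<le> \<kappa>" using order_trans[OF abs_ge_zero \<kappa>] .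
    have "(\<integral>z. F (q, z) \<partial>?N) = (\<integral>z. gauss (w - v) z *\<^sub>R F (q, z) \<partial>lborel)"
      by (rule integral_density) (auto simp: F_def)
    also have "\<dots> = \<phi> (fst q) (fst (snd q)) * (\<integral>z. \<psi> (snd (snd q)) (snd (snd q) + z) * gauss (w - v) z \<partial>lborel)"
      by (subst integral_mult_right_zero[symmetric]) (auto simp: F_def ac_simps intro!: Bochner_Integration.integral_cong)
    finally have "norm (\<integral>z. F (q, z) \<partial>?N) \<le> \<kappa> * \<bar>\<phi> (fst q) (fst (snd q))\<bar>"
      using mult_left_mono[OF \<kappa>[of "snd (snd q)"], of "\<bar>\<phi> (fst q) (fst (snd q))\<bar>"] by (simp add: abs_mult mult.commute)
    then show "ennreal (norm (\<integral>z. F (q, z) \<partial>?N)) \<le> ennreal \<kappa> * ennreal \<bar>\<phi> (fst q) (fst (snd q))\<bar>"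
      using k0 by (simp add: ennreal_mult[symmetric] ennreal_leI)
  qed
  also have "\<dots> = (\<integral>\<^sup>+ \<omega>. ennreal \<kappa> * ennreal \<bar>\<phi> (path u \<omega>) (path u' \<omega>)\<bar> \<partial>M)"
    by (subst nn_integral_distr) auto
  also have "\<dots> = ennreal \<kappa> * (\<integral>\<^sup>+ \<omega>. ennreal \<bar>\<phi> (path u \<omega>) (path u' \<omega>)\<bar> \<partial>M)"
    by (rule nn_integral_cmult) measurable
  finally show ?thesis .
qed

lemma path_increment_moments:
  assumes "0 \<le> s" "s \<le> t"
  shows "(\<integral>\<^sup>+ \<omega>. ennreal ((path t \<omega> - path s \<omega>)\<^sup>2) \<partial>M) = ennreal (t - s)"
    and "(\<integral>\<^sup>+ \<omega>. ennreal ((path t \<omega> - path s \<omega>) ^ 4) \<partial>M) = ennreal (3 * (t - s)\<^sup>2)"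
proof -
  show "(\<integral>\<^sup>+ \<omega>. ennreal ((path t \<omega> - path s \<omega>)\<^sup>2) \<partial>M) = ennreal (t - s)"
  proof (cases "s = t")
    case False
    then show ?thesis using assms gauss_moments(3)[of "t - s"]
      by (subst nn_integral_path_increment) (auto simp: ennreal_mult)
  qed simp
  show "(\<integral>\<^sup>+ \<omega>. ennreal ((path t \<omega> - path s \<omega>) ^ 4) \<partial>M) = ennreal (3 * (t - s)\<^sup>2)"
  proof (cases "s = t")
    case False
    then show ?thesis using assms gauss_moments(5)[of "t - s"]
      by (subst nn_integral_path_increment) (auto simp: ennreal_mult)
  qed simp
qed

section \<open>Modulus of continuity\<close>

text \<open>Fourth moments of the increments of one dyadic level add up to \<open>O(2 ^ -j)\<close>, so the largest
  increment of level \<open>j\<close> has second moment \<open>O(2 powr (- j / 2))\<close>. Two times at distance at most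
  \<open>\<epsilon>\<close> lie in the same or in adjacent blocks of a level \<open>n\<close> with \<open>2 ^ -n\<close> of order \<open>\<epsilon>\<close>, and
  the chains that lead to them use only levels \<open>j \<ge> n\<close>.\<close>

lemma modulus_of_continuity:
  assumes H: "1 \<le> H" and e: "0 < \<epsilon>" "\<epsilon> \<le> 1"
  shows "sup_sq_le M {(s, t). 0 \<le> s \<and> s \<le> t \<and> t \<le> H \<and> t - s \<le> \<epsilon>} (\<lambda>(s, t) \<omega>. path t \<omega> - path s \<omega>)
    (36 * sqrt (2 * H) / (1 - sqrt (1 / sqrt 2))\<^sup>2 * sqrt \<epsilon>)"
proof -
  define n where "n = nat \<lfloor>log 2 (H / \<epsilon>)\<rfloor>"
  have He: "1 \<le> H / \<epsilon>" using H e by (simp add: field_simps)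
  then have "0 \<le> log 2 (H / \<epsilon>)" by simp
  then have nl: "real n \<le> log 2 (H / \<epsilon>)" "log 2 (H / \<epsilon>) < real n + 1" unfolding n_def by linarith+
  have n1: "2 ^ n \<le> H / \<epsilon>"
  proof -
    have "2 powr real n \<le> 2 powr log 2 (H / \<epsilon>)" using nl by (intro powr_mono) auto
    then show ?thesis using He by (simp add: powr_realpow)
  qed
  have n2: "H / \<epsilon> \<le> 2 * 2 ^ n"
  proof -
    have "2 powr log 2 (H / \<epsilon>) \<le> 2 powr (real n + 1)" using nl by (intro powr_mono) auto
    then show ?thesis using He by (simp add: powr_add powr_realpow)
  qed
  define g where "g j k = H * (real k / 2 ^ j)" for j k :: nat
  have g0: "0 \<le> g j k" "g j k \<le> g j (Suc k)" and gd: "g j (Suc k) - g j k = H / 2 ^ j" for j k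
    using H by (auto simp: g_def divide_right_mono field_simps)
  \<comment> \<open>The grid extends to \<open>2 * H\<close>, so that the block starting at the right end \<open>H\<close> needs no special treatment.\<close>
  define Q where "Q j \<omega> = (\<Sum>k<2 * 2 ^ j. (path (g j (Suc k)) \<omega> - path (g j k) \<omega>) ^ 4)" for j :: nat and \<omega>
  have Q0: "0 \<le> Q j \<omega>" for j \<omega> by (auto simp: Q_def intro!: sum_nonneg)
  have [measurable]: "Q j \<in> borel_measurable M" for j unfolding Q_def by measurable
  have EQ: "(\<integral>\<^sup>+ \<omega>. ennreal (Q j \<omega>) \<partial>M) = ennreal (6 * H\<^sup>2 / 2 ^ j)" for j
  proof -
    have "(\<integral>\<^sup>+ \<omega>. ennreal (Q j \<omega>) \<partial>M) = (\<Sum>k<2 * 2 ^ j. \<integral>\<^sup>+ \<omega>. ennreal ((path (g j (Suc k)) \<omega> - path (g j k) \<omega>) ^ 4) \<partial>M)"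
      unfolding Q_def by (subst nn_integral_sum[symmetric]) (auto simp: sum_ennreal)
    also have "\<dots> = (\<Sum>k<2 * 2 ^ j :: nat. ennreal (3 * (H / 2 ^ j)\<^sup>2))"
      by (intro sum.cong refl) (simp add: path_increment_moments(2)[OF g0] gd)
    also have "\<dots> = ennreal (\<Sum>k<2 * 2 ^ j :: nat. 3 * (H / 2 ^ j)\<^sup>2)"
      by (rule sum_ennreal) simp
    also have "(\<Sum>k<2 * 2 ^ j :: nat. 3 * (H / 2 ^ j)\<^sup>2) = 6 * H\<^sup>2 / 2 ^ j"
      by (simp add: power2_eq_square field_simps)
    finally show ?thesis .
  qed
  define d where "d j \<omega> = sqrt (sqrt (Q j \<omega>))" for j \<omega>
  have d0: "0 \<le> d j \<omega>" for j \<omega> by (simp add: d_def Q0)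
  have [measurable]: "d j \<in> borel_measurable M" for j unfolding d_def by measurable
  have Ed: "(\<integral>\<^sup>+ \<omega>. ennreal ((d j \<omega>)\<^sup>2) \<partial>M) \<le> ennreal (4 * H * (1 / sqrt 2) ^ j)" for j
  proof -
    \<comment> \<open>The weight that balances the two terms of \<open>2 * sqrt Q \<le> \<alpha> * Q + 1 / \<alpha>\<close>, given the size of the expectation of \<open>Q\<close>.\<close>
    define \<alpha> where "\<alpha> = sqrt 2 ^ j / H"
    have \<alpha>: "0 < \<alpha>" using H by (simp add: \<alpha>_def)
    have s2: "sqrt 2 ^ j * sqrt 2 ^ j = (2 :: real) ^ j" by (simp add: power_mult_distrib[symmetric])
    have "(\<integral>\<^sup>+ \<omega>. ennreal ((d j \<omega>)\<^sup>2) \<partial>M) \<le> (\<integral>\<^sup>+ \<omega>. ennreal (\<alpha> / 2) * ennreal (Q j \<omega>) + ennreal (1 / (2 * \<alpha>)) \<partial>M)"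
    proof (intro nn_integral_mono)
      fix \<omega>
      have "2 * (sqrt (Q j \<omega>) * sqrt \<alpha>) * (1 / sqrt \<alpha>) \<le> (sqrt (Q j \<omega>) * sqrt \<alpha>)\<^sup>2 + (1 / sqrt \<alpha>)\<^sup>2"
        by (rule sum_squares_bound)
      then have "2 * sqrt (Q j \<omega>) \<le> Q j \<omega> * \<alpha> + 1 / \<alpha>"
        using \<alpha> Q0[of j \<omega>] by (simp add: power_mult_distrib power_divide)
      then have "(d j \<omega>)\<^sup>2 \<le> \<alpha> / 2 * Q j \<omega> + 1 / (2 * \<alpha>)" using Q0[of j \<omega>] by (simp add: d_def field_simps)
      then have "ennreal ((d j \<omega>)\<^sup>2) \<le> ennreal (\<alpha> / 2 * Q j \<omega> + 1 / (2 * \<alpha>))" by (rule ennreal_leI)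
      also have "\<dots> = ennreal (\<alpha> / 2 * Q j \<omega>) + ennreal (1 / (2 * \<alpha>))"
        using \<alpha> Q0[of j \<omega>] by (intro ennreal_plus) auto
      also have "ennreal (\<alpha> / 2 * Q j \<omega>) = ennreal (\<alpha> / 2) * ennreal (Q j \<omega>)"
        using \<alpha> Q0[of j \<omega>] by (intro ennreal_mult) auto
      finally show "ennreal ((d j \<omega>)\<^sup>2) \<le> ennreal (\<alpha> / 2) * ennreal (Q j \<omega>) + ennreal (1 / (2 * \<alpha>))" .
    qed
    also have "\<dots> = ennreal (\<alpha> / 2) * ennreal (6 * H\<^sup>2 / 2 ^ j) + ennreal (1 / (2 * \<alpha>))"
      by (simp add: nn_integral_add nn_integral_cmult EQ emeasure_space_1)
    also have "\<dots> = ennreal (\<alpha> / 2 * (6 * H\<^sup>2 / 2 ^ j) + 1 / (2 * \<alpha>))"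
    proof -
      have "ennreal (\<alpha> / 2) * ennreal (6 * H\<^sup>2 / 2 ^ j) = ennreal (\<alpha> / 2 * (6 * H\<^sup>2 / 2 ^ j))"
        using \<alpha> by (intro ennreal_mult[symmetric]) auto
      moreover have "ennreal (\<alpha> / 2 * (6 * H\<^sup>2 / 2 ^ j)) + ennreal (1 / (2 * \<alpha>)) = ennreal (\<alpha> / 2 * (6 * H\<^sup>2 / 2 ^ j) + 1 / (2 * \<alpha>))"
        using \<alpha> by (intro ennreal_plus[symmetric]) auto
      ultimately show ?thesis by (simp only:)
    qed
    also have "\<dots> \<le> ennreal (4 * H * (1 / sqrt 2) ^ j)"
    proof (rule ennreal_leI)
      have "\<alpha> / 2 * (6 * H\<^sup>2 / 2 ^ j) = 3 * H * (1 / sqrt 2) ^ j"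
        unfolding s2[symmetric] using H by (simp add: \<alpha>_def power2_eq_square power_divide field_simps)
      moreover have "1 / (2 * \<alpha>) = 1 / 2 * H * (1 / sqrt 2) ^ j"
        using H by (simp add: \<alpha>_def power_divide)
      moreover have "0 \<le> H * (1 / sqrt 2) ^ j" using H by simp
      ultimately show "\<alpha> / 2 * (6 * H\<^sup>2 / 2 ^ j) + 1 / (2 * \<alpha>) \<le> 4 * H * (1 / sqrt 2) ^ j" by linarith
    qed
    finally show ?thesis .
  qed
  have incr: "\<bar>path (g j (Suc k)) \<omega> - path (g j k) \<omega>\<bar> \<le> d j \<omega>" if "k < 2 * 2 ^ j" for j k \<omega>
  proof -
    let ?x = "path (g j (Suc k)) \<omega> - path (g j k) \<omega>"
    have "?x ^ 4 \<le> Q j \<omega>" unfolding Q_def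
      using that by (intro member_le_sum[where f = "\<lambda>k. (path (g j (Suc k)) \<omega> - path (g j k) \<omega>) ^ 4"]) auto
    then have "(?x\<^sup>2)\<^sup>2 \<le> Q j \<omega>" by simp
    then have "?x\<^sup>2 \<le> sqrt (Q j \<omega>)" by (rule real_le_rsqrt)
    then have "\<bar>?x\<bar>\<^sup>2 \<le> sqrt (Q j \<omega>)" by simp
    then show ?thesis unfolding d_def by (rule real_le_rsqrt)
  qed
  let ?S = "{(s, t). 0 \<le> s \<and> s \<le> t \<and> t \<le> H \<and> t - s \<le> \<epsilon>}"
  have "sup_sq_le M ?S (\<lambda>(s, t) \<omega>. path t \<omega> - path s \<omega>) (36 * H * (1 / sqrt 2) ^ n / (1 - sqrt (1 / sqrt 2))\<^sup>2)"
  proof (rule sup_sq_le_series[where Y = "\<lambda>j p \<omega>. 3 * d (n + j) \<omega>"])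
    fix j
    show "sup_sq_le M ?S (\<lambda>p \<omega>. 3 * d (n + j) \<omega>) (36 * H * (1 / sqrt 2) ^ n * (1 / sqrt 2) ^ j)"
      unfolding sup_sq_le_def
    proof (intro bexI[of _ "\<lambda>\<omega>. ennreal ((3 * d (n + j) \<omega>)\<^sup>2)"] conjI AE_I2 ballI order_refl)
      have "(\<integral>\<^sup>+ \<omega>. ennreal ((3 * d (n + j) \<omega>)\<^sup>2) \<partial>M) = (\<integral>\<^sup>+ \<omega>. ennreal 9 * ennreal ((d (n + j) \<omega>)\<^sup>2) \<partial>M)"
      proof (intro nn_integral_cong)
        fix \<omega>
        have "(3 * d (n + j) \<omega>)\<^sup>2 = 9 * (d (n + j) \<omega>)\<^sup>2" by (simp add: power_mult_distrib)
        then show "ennreal ((3 * d (n + j) \<omega>)\<^sup>2) = ennreal 9 * ennreal ((d (n + j) \<omega>)\<^sup>2)"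
          by (simp only:) (rule ennreal_mult, auto)
      qed
      also have "\<dots> \<le> ennreal 9 * ennreal (4 * H * (1 / sqrt 2) ^ (n + j))"
        by (subst nn_integral_cmult) (auto intro!: mult_left_mono Ed)
      also have "\<dots> = ennreal (9 * (4 * H * (1 / sqrt 2) ^ (n + j)))"
        using H by (intro ennreal_mult[symmetric]) auto
      also have "9 * (4 * H * (1 / sqrt 2) ^ (n + j)) = 36 * H * (1 / sqrt 2) ^ n * (1 / sqrt 2) ^ j"
        by (simp add: power_add)
      finally show "(\<integral>\<^sup>+ \<omega>. ennreal ((3 * d (n + j) \<omega>)\<^sup>2) \<partial>M) \<le> ennreal (36 * H * (1 / sqrt 2) ^ n * (1 / sqrt 2) ^ j)" .
    qed measurable
  next
    show "0 < 1 / sqrt (2::real)" "1 / sqrt (2::real) < 1" by simp_all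
    show "0 \<le> 36 * H * (1 / sqrt 2) ^ n" using H by simp
    show "AE \<omega> in M. \<forall>p\<in>?S. \<exists>z. (z \<longlonglongrightarrow> (case p of (s, t) \<Rightarrow> \<lambda>\<omega>. path t \<omega> - path s \<omega>) \<omega>) \<and>
        (\<forall>m. \<bar>z m\<bar> \<le> (\<Sum>k<m. \<bar>3 * d (n + k) \<omega>\<bar>))"
    proof (intro AE_I2 ballI)
      fix \<omega> p assume \<omega>: "\<omega> \<in> space M" and "p \<in> ?S"
      then obtain s t where p: "p = (s, t)" "0 \<le> s" "s \<le> t" "t \<le> H" "t - s \<le> \<epsilon>" by auto
      define i where "i j r = nat \<lfloor>r * 2 ^ j / H\<rfloor>" for j and r :: real
      have ir: "real (i j r) \<le> r * 2 ^ j / H" "r * 2 ^ j / H < real (i j r) + 1" if "0 \<le> r" for j r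
      proof -
        have "0 \<le> r * 2 ^ j / H" using that H by simp
        then show "real (i j r) \<le> r * 2 ^ j / H" "r * 2 ^ j / H < real (i j r) + 1" unfolding i_def by linarith+
      qed
      have div: "i (n + m) r div 2 ^ m = i n r" if "0 \<le> r" for r m
      proof -
        have eq: "r * 2 ^ (n + m) / H / real_of_int (2 ^ m) = r * 2 ^ n / H"
          by (simp add: power_add)
        have "\<lfloor>r * 2 ^ n / H\<rfloor> = \<lfloor>r * 2 ^ (n + m) / H\<rfloor> div 2 ^ m"
          unfolding eq[symmetric] by (rule floor_divide_real_eq_div) simp
        then show ?thesis unfolding i_def by (simp add: nat_div_distrib' nat_power_eq zdiv_int[symmetric])
      qed
      have block: "\<bar>path (g (n + m) (i (n + m) r)) \<omega> - path (g n (i n r)) \<omega>\<bar> \<le> (\<Sum>j\<le>m. d (n + j) \<omega>)"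
        if r: "0 \<le> r" "r \<le> H" for r m
      proof -
        define K where "K = i n r"
        define k where "k = i (n + m) r mod 2 ^ m"
        have ik: "i (n + m) r = K * 2 ^ m + k"
          unfolding K_def k_def div[OF r(1), of m, symmetric] by (rule div_mult_mod_eq[symmetric])
        have k: "k \<le> 2 ^ m" unfolding k_def by (simp add: less_imp_le)
        have "r * 2 ^ n / H \<le> 2 ^ n" using r H by (simp add: pos_divide_le_eq mult.commute)
        then have "real K \<le> 2 ^ n" using ir(1)[OF r(1), of n] unfolding K_def by linarith
        then have "real K \<le> real (2 ^ n)" by simp
        then have K: "K \<le> 2 ^ n" by (rule of_nat_le_iff[THEN iffD1])
        have pt: "H * real K / 2 ^ n + H / 2 ^ n * (real l / 2 ^ j) = g (n + j) (K * 2 ^ j + l)" for j l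
          by (simp add: g_def power_add field_simps)
        have "\<bar>path (H * real K / 2 ^ n + H / 2 ^ n * (real k / 2 ^ m)) \<omega> - path (H * real K / 2 ^ n) \<omega>\<bar> \<le> (\<Sum>j\<le>m. d (n + j) \<omega>)"
        proof (rule dyadic_increment_le[where y = "\<lambda>t. path t \<omega>", OF _ k])
          fix j l :: nat assume "l < 2 ^ j"
          moreover have "K * 2 ^ j \<le> 2 ^ n * 2 ^ j" using K by (rule mult_right_mono) simp
          moreover have "(2 :: nat) ^ j \<le> 2 ^ (n + j)" by (rule power_increasing) auto
          ultimately have "K * 2 ^ j + l < 2 * 2 ^ (n + j)" unfolding power_add by linarith
          from incr[OF this, of \<omega>]
          show "\<bar>path (H * real K / 2 ^ n + H / 2 ^ n * (real (Suc l) / 2 ^ j)) \<omega> - path (H * real K / 2 ^ n + H / 2 ^ n * (real l / 2 ^ j)) \<omega>\<bar> \<le> d (n + j) \<omega>"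
            unfolding pt by simp
        qed
        then show ?thesis unfolding pt[of k m] ik[symmetric] by (simp add: g_def K_def)
      qed
      have adj: "\<bar>path (g n (i n t)) \<omega> - path (g n (i n s)) \<omega>\<bar> \<le> d n \<omega>"
      proof -
        have "(t - s) * 2 ^ n / H \<le> 1"
        proof -
          have "(t - s) * 2 ^ n \<le> \<epsilon> * (H / \<epsilon>)" using p n1 e by (intro mult_mono) auto
          then show ?thesis using e H by simp
        qed
        then have "t * 2 ^ n / H \<le> s * 2 ^ n / H + 1" by (simp add: left_diff_distrib diff_divide_distrib)
        then have "i n t \<le> i n s + 1" unfolding i_def by linarith
        moreover have "s * 2 ^ n / H \<le> t * 2 ^ n / H" using p H by (intro divide_right_mono mult_right_mono) auto
        then have "i n s \<le> i n t" unfolding i_def by linarith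
        ultimately consider "i n t = i n s" | "i n t = Suc (i n s)" by linarith
        then show ?thesis
        proof cases
          case 1 then show ?thesis by (simp add: d0)
        next
          case 2
          have "s * 2 ^ n / H \<le> 2 ^ n" using p H by (simp add: pos_divide_le_eq mult.commute)
          then have "real (i n s) \<le> 2 ^ n" using ir(1)[OF p(2), of n] by linarith
          then have "real (i n s) \<le> real (2 ^ n)" by simp
          then have "i n s \<le> 2 ^ n" by (rule of_nat_le_iff[THEN iffD1])
          then have "i n s < 2 * 2 ^ n" by (rule le_less_trans) simp
          then show ?thesis using incr[of "i n s" n \<omega>] 2 by simp
        qed
      qed
      \<comment> \<open>Shifted by one: the approximation at level \<open>n + m\<close> uses the \<open>Suc m\<close> levels from \<open>n\<close> to \<open>n + m\<close>.\<close>
      define z where "z m = (case m of 0 \<Rightarrow> 0 | Suc m \<Rightarrow> path (g (n + m) (i (n + m) t)) \<omega> - path (g (n + m) (i (n + m) s)) \<omega>)" for m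
      have lim: "(\<lambda>m. path (g (n + m) (i (n + m) r)) \<omega>) \<longlonglongrightarrow> path r \<omega>" if r: "0 \<le> r" for r
      proof (rule continuous_on_tendsto_compose[OF path_continuous[OF \<omega>]])
        show "(\<lambda>m. g (n + m) (i (n + m) r)) \<longlonglongrightarrow> r"
        proof (rule tendsto_sandwich[of "\<lambda>m. r - H * (1 / 2) ^ m" _ _ "\<lambda>m. r"])
          have *: "H * (real (i j r) / 2 ^ j) \<le> r \<and> r - H * (1 / 2) ^ m \<le> H * (real (i j r) / 2 ^ j)" if "m \<le> j" for j m
          proof
            show "H * (real (i j r) / 2 ^ j) \<le> r" using ir(1)[OF r, of j] H by (simp add: field_simps)
            have "r * 2 ^ j \<le> H * (real (i j r) + 1)" using ir(2)[OF r, of j] H by (simp add: field_simps)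
            then have "r \<le> H * (real (i j r) + 1) / 2 ^ j" by (simp add: field_simps)
            also have "\<dots> = H * (real (i j r) / 2 ^ j) + H * (1 / 2) ^ j" by (simp add: field_simps)
            also have "H * (1 / 2) ^ j \<le> H * (1 / 2) ^ m" using that H by (intro mult_left_mono power_decreasing) auto
            finally show "r - H * (1 / 2) ^ m \<le> H * (real (i j r) / 2 ^ j)" by simp
          qed
          show "\<forall>\<^sub>F m in sequentially. r - H * (1 / 2) ^ m \<le> g (n + m) (i (n + m) r)"
            "\<forall>\<^sub>F m in sequentially. g (n + m) (i (n + m) r) \<le> r"
            unfolding g_def by (intro always_eventually allI conjunct2[OF *] conjunct1[OF *[OF order_refl]]; simp)+
          have "(\<lambda>m. r - H * (1 / 2) ^ m) \<longlonglongrightarrow> r - H * 0" by (intro tendsto_intros LIMSEQ_power_zero) simp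
          then show "(\<lambda>m. r - H * (1 / 2) ^ m) \<longlonglongrightarrow> r" by simp
        qed simp
      qed auto
      have "(\<lambda>m. z (Suc m)) \<longlonglongrightarrow> path t \<omega> - path s \<omega>"
        unfolding z_def using p by (auto intro!: tendsto_diff lim)
      then have "z \<longlonglongrightarrow> path t \<omega> - path s \<omega>" by (rule LIMSEQ_imp_Suc)
      moreover have "\<bar>z m\<bar> \<le> (\<Sum>k<m. \<bar>3 * d (n + k) \<omega>\<bar>)" for m
      proof (cases m)
        case (Suc m')
        have "d (n + 0) \<omega> \<le> (\<Sum>j\<le>m'. d (n + j) \<omega>)"
          by (rule member_le_sum[where f = "\<lambda>j. d (n + j) \<omega>"]) (auto simp: d0)
        then have "\<bar>z m\<bar> \<le> 3 * (\<Sum>j\<le>m'. d (n + j) \<omega>)"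
          using block[of t m'] block[of s m'] adj p by (simp add: z_def Suc)
        also have "\<dots> = (\<Sum>k<m. \<bar>3 * d (n + k) \<omega>\<bar>)"
          by (simp add: Suc lessThan_Suc_atMost sum_distrib_left d0)
        finally show ?thesis .
      qed (simp add: z_def)
      ultimately show "\<exists>z. (z \<longlonglongrightarrow> (case p of (s, t) \<Rightarrow> \<lambda>\<omega>. path t \<omega> - path s \<omega>) \<omega>) \<and>
        (\<forall>m. \<bar>z m\<bar> \<le> (\<Sum>k<m. \<bar>3 * d (n + k) \<omega>\<bar>))"
        unfolding p(1) by (intro exI[of _ z]) auto
    qed
  qed
  then show ?thesis
  proof (rule sup_sq_le_mono)
    have "H / sqrt 2 ^ n \<le> sqrt (2 * H) * sqrt \<epsilon>"
    proof (rule power2_le_imp_le)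
      have "H * H \<le> 2 * H * \<epsilon> * 2 ^ n"
        using mult_left_mono[OF n2, of "H * \<epsilon>"] H e by (simp add: field_simps)
      moreover have "(sqrt 2 ^ n)\<^sup>2 = (2 :: real) ^ n" by (simp add: power2_eq_square power_mult_distrib[symmetric])
      ultimately show "(H / sqrt 2 ^ n)\<^sup>2 \<le> (sqrt (2 * H) * sqrt \<epsilon>)\<^sup>2"
        using H e by (simp add: power_divide power_mult_distrib power2_eq_square[of H] field_simps)
    qed (use H e in auto)
    then have "36 * (H / sqrt 2 ^ n) / (1 - sqrt (1 / sqrt 2))\<^sup>2 \<le> 36 * (sqrt (2 * H) * sqrt \<epsilon>) / (1 - sqrt (1 / sqrt 2))\<^sup>2"
      by (intro divide_right_mono mult_left_mono) auto
    then show "36 * H * (1 / sqrt 2) ^ n / (1 - sqrt (1 / sqrt 2))\<^sup>2 \<le> 36 * sqrt (2 * H) / (1 - sqrt (1 / sqrt 2))\<^sup>2 * sqrt \<epsilon>"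
      by (simp add: power_divide)
  qed
qed

end

section \<open>Chaining at scale \<open>\<epsilon>\<close>\<close>

text \<open>The number of levels down to scale \<open>\<epsilon>\<close> is logarithmic in \<open>1 / \<epsilon>\<close>, hence smaller than any negative
  power of \<open>\<epsilon>\<close>.\<close>

lemma dyadic_scale_exists:
  assumes T: "0 < T" and \<kappa>: "0 < \<kappa>"
  shows "\<exists>C\<ge>0. \<forall>\<epsilon>\<in>{0<..1}. \<exists>m. T / 2 ^ m \<le> \<epsilon> \<and> (real (Suc m))\<^sup>2 \<le> C * \<epsilon> powr (- \<kappa>)"
proof -
  define D where "D = 2 + \<bar>log 2 T\<bar> + 2 / (\<kappa> * ln 2)"
  have D0: "0 \<le> D" using \<kappa> by (simp add: D_def)
  have "\<exists>m. T / 2 ^ m \<le> \<epsilon> \<and> (real (Suc m))\<^sup>2 \<le> D\<^sup>2 * \<epsilon> powr (- \<kappa>)" if e: "0 < \<epsilon>" "\<epsilon> \<le> 1" for \<epsilon>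
  proof -
    define m where "m = nat \<lceil>log 2 (T / \<epsilon>)\<rceil>"
    have m1: "log 2 (T / \<epsilon>) \<le> real m" and m2: "real m \<le> max 0 (log 2 (T / \<epsilon>) + 1)" unfolding m_def by linarith+
    have "2 powr log 2 (T / \<epsilon>) \<le> 2 powr real m" using m1 by (intro powr_mono) auto
    then have "T / \<epsilon> \<le> 2 ^ m" using T e by (simp add: powr_realpow)
    then have 1: "T / 2 ^ m \<le> \<epsilon>" using e by (simp add: field_simps)
    have ep: "1 \<le> \<epsilon> powr (- \<kappa> / 2)" using e \<kappa> powr_mono'[of "- \<kappa> / 2" 0 \<epsilon>] by simp
    have "ln (1 / \<epsilon>) \<le> (1 / \<epsilon>) powr (\<kappa> / 2) / (\<kappa> / 2)" using e \<kappa> by (intro ln_powr_bound) auto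
    also have "(1 / \<epsilon>) powr (\<kappa> / 2) = \<epsilon> powr (- \<kappa> / 2)" using e by (simp add: powr_divide powr_minus_divide)
    finally have "ln (1 / \<epsilon>) / ln 2 \<le> \<epsilon> powr (- \<kappa> / 2) / (\<kappa> / 2) / ln 2" by (intro divide_right_mono) auto
    then have l: "log 2 (1 / \<epsilon>) \<le> 2 / (\<kappa> * ln 2) * \<epsilon> powr (- \<kappa> / 2)"
      by (simp add: log_def field_simps)
    have l0: "0 \<le> log 2 (1 / \<epsilon>)" using e by simp
    have "log 2 (T / \<epsilon>) = log 2 T + log 2 (1 / \<epsilon>)" using T e by (simp add: log_divide)
    then have "real (Suc m) \<le> (2 + \<bar>log 2 T\<bar>) * 1 + log 2 (1 / \<epsilon>)" using m2 l0 unfolding of_nat_Suc by (simp add: max_def abs_if split: if_splits)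
    also have "\<dots> \<le> (2 + \<bar>log 2 T\<bar>) * \<epsilon> powr (- \<kappa> / 2) + 2 / (\<kappa> * ln 2) * \<epsilon> powr (- \<kappa> / 2)"
      using ep l by (intro add_mono mult_left_mono) auto
    also have "\<dots> = D * \<epsilon> powr (- \<kappa> / 2)" by (simp add: D_def distrib_right)
    finally have "(real (Suc m))\<^sup>2 \<le> (D * \<epsilon> powr (- \<kappa> / 2))\<^sup>2" by (rule power_mono) simp
    also have "\<dots> = D\<^sup>2 * \<epsilon> powr (- \<kappa>)"
      using e by (simp add: power_mult_distrib power2_eq_square[of "\<epsilon> powr _"] powr_add[symmetric])
    finally show ?thesis using 1 by blast
  qed
  then show ?thesis by (intro exI[of _ "D\<^sup>2"]) auto
qed

text \<open>Chaining down to scale \<open>\<epsilon>\<close>; the logarithmic loss is paid for by lowering the exponent from \<open>\<eta>\<close> to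
  \<open>\<delta>\<close>.\<close>

lemma sup_sq_le_chaining_rate:
  fixes Y :: "real \<Rightarrow> real \<Rightarrow> 'a \<Rightarrow> real"
  assumes T: "0 < T" and K: "0 \<le> K" and G: "0 \<le> G" and \<eta>: "\<delta> < \<eta>"
    and meas: "\<And>\<epsilon> t. 0 < \<epsilon> \<Longrightarrow> \<epsilon> \<le> 1 \<Longrightarrow> 0 \<le> t \<Longrightarrow> t \<le> T \<Longrightarrow> Y \<epsilon> t \<in> borel_measurable M"
    and zero: "\<And>\<epsilon> \<omega>. Y \<epsilon> 0 \<omega> = 0"
    and incr: "\<And>\<epsilon> a b. 0 < \<epsilon> \<Longrightarrow> \<epsilon> \<le> 1 \<Longrightarrow> 0 \<le> a \<Longrightarrow> a \<le> b \<Longrightarrow> b \<le> T \<Longrightarrow>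
        (\<integral>\<^sup>+ \<omega>. ennreal ((Y \<epsilon> b \<omega> - Y \<epsilon> a \<omega>)\<^sup>2) \<partial>M) \<le> ennreal (K * \<epsilon> powr \<eta> * (sqrt b - sqrt a))"
    and gap: "\<And>\<epsilon>. 0 < \<epsilon> \<Longrightarrow> \<epsilon> \<le> 1 \<Longrightarrow> sup_sq_le M {(s, t). 0 \<le> s \<and> s \<le> t \<and> t \<le> T \<and> t - s \<le> \<epsilon>}
        (\<lambda>(s, t) \<omega>. Y \<epsilon> t \<omega> - Y \<epsilon> s \<omega>) (G * \<epsilon> powr \<delta>)"
  shows "\<exists>C\<ge>0. \<forall>\<epsilon>\<in>{0<..1}. sup_sq_le M {0..T} (Y \<epsilon>) (C * \<epsilon> powr \<delta>)"
proof -
  from dyadic_scale_exists[OF T, of "\<eta> - \<delta>"] \<eta> obtain C where C: "0 \<le> C"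
    and scale: "\<And>\<epsilon>. \<epsilon> \<in> {0<..1} \<Longrightarrow> \<exists>m. T / 2 ^ m \<le> \<epsilon> \<and> (real (Suc m))\<^sup>2 \<le> C * \<epsilon> powr (- (\<eta> - \<delta>))" by auto
  have "sup_sq_le M {0..T} (Y \<epsilon>) ((2 * C * K * sqrt T + 2 * G) * \<epsilon> powr \<delta>)" if "\<epsilon> \<in> {0<..1}" for \<epsilon>
  proof -
    from that have e: "0 < \<epsilon>" "\<epsilon> \<le> 1" by auto
    from scale[OF that] obtain m where m: "T / 2 ^ m \<le> \<epsilon>" "(real (Suc m))\<^sup>2 \<le> C * \<epsilon> powr (- (\<eta> - \<delta>))" by blast
    have "sup_sq_le M {(s, t). 0 \<le> s \<and> s \<le> t \<and> t \<le> T \<and> t - s \<le> T / 2 ^ m} (\<lambda>(s, t) \<omega>. Y \<epsilon> t \<omega> - Y \<epsilon> s \<omega>) (G * \<epsilon> powr \<delta>)"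
      by (rule sup_sq_le_subset[OF gap[OF e]]) (use m(1) in auto)
    from sup_sq_le_chaining[OF T _ _ meas[OF e] zero incr[OF e] this]
    have "sup_sq_le M {0..T} (Y \<epsilon>) (2 * (real (Suc m))\<^sup>2 * (K * \<epsilon> powr \<eta>) * sqrt T + 2 * (G * \<epsilon> powr \<delta>))"
      using K G by simp
    then show ?thesis
    proof (rule sup_sq_le_mono)
      have "(real (Suc m))\<^sup>2 * \<epsilon> powr \<eta> \<le> C * \<epsilon> powr (- (\<eta> - \<delta>)) * \<epsilon> powr \<eta>"
        by (intro mult_right_mono m) auto
      also have "\<dots> = C * \<epsilon> powr \<delta>" using e by (simp add: mult.assoc powr_add[symmetric])
      finally have "(2 * K * sqrt T) * ((real (Suc m))\<^sup>2 * \<epsilon> powr \<eta>) \<le> (2 * K * sqrt T) * (C * \<epsilon> powr \<delta>)"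
        using K T by (intro mult_left_mono) auto
      then show "2 * (real (Suc m))\<^sup>2 * (K * \<epsilon> powr \<eta>) * sqrt T + 2 * (G * \<epsilon> powr \<delta>) \<le> (2 * C * K * sqrt T + 2 * G) * \<epsilon> powr \<delta>"
        by (simp add: algebra_simps)
    qed
  qed
  then show ?thesis using C K G T by (intro exI[of _ "2 * C * K * sqrt T + 2 * G"]) auto
qed

section \<open>Integrals over adjacent intervals\<close>

lemma set_integral_diff_Icc:
  fixes g :: "real \<Rightarrow> real"
  assumes "set_integrable lborel {0..b} g" "0 \<le> a" "a \<le> b"
  shows "(LINT u:{0..b}|lborel. g u) - (LINT u:{0..a}|lborel. g u) = (LINT u:{a..b}|lborel. g u)"
proof -
  have i: "set_integrable lborel {0..a} g" "set_integrable lborel {a..b} g"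
    by (rule set_integrable_subset[OF assms(1)]; use assms in auto)+
  have "(LINT u:{0..b}|lborel. g u) = (\<integral>u. indicator {0..a} u *\<^sub>R g u + indicator {a..b} u *\<^sub>R g u \<partial>lborel)"
    unfolding set_lebesgue_integral_def
  proof (rule integral_cong_AE)
    show "AE u in lborel. indicator {0..b} u *\<^sub>R g u = indicator {0..a} u *\<^sub>R g u + indicator {a..b} u *\<^sub>R g u"
      using AE_lborel_singleton[of a] by eventually_elim (use assms in \<open>auto simp: indicator_def\<close>)
  qed (use assms i in \<open>auto simp: set_integrable_def intro!: borel_measurable_add\<close>)
  also have "\<dots> = (LINT u:{0..a}|lborel. g u) + (LINT u:{a..b}|lborel. g u)"
    using i unfolding set_lebesgue_integral_def set_integrable_def by (rule Bochner_Integration.integral_add)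
  finally show ?thesis by simp
qed

lemma set_integral_singleton_0: "(LINT u:{0..0}|lborel. g u) = (0 :: real)" for g :: "real \<Rightarrow> real"
  unfolding set_lebesgue_integral_def
proof (rule integral_eq_zero_AE)
  show "AE u in lborel. indicator {0..0} u *\<^sub>R g u = 0"
    using AE_lborel_singleton[of 0] by eventually_elim auto
qed

lemma abs_set_integral_le:
  fixes g :: "real \<Rightarrow> real"
  assumes "a \<le> b" "\<And>u. a \<le> u \<Longrightarrow> u \<le> b \<Longrightarrow> \<bar>g u\<bar> \<le> c"
  shows "\<bar>LINT u:{a..b}|lborel. g u\<bar> \<le> (b - a) * c"
proof -
  have c: "0 \<le> c" using assms(2)[of a] assms(1) by linarith
  have "norm (\<integral>u. indicator {a..b} u *\<^sub>R g u \<partial>lborel) \<le> (\<integral>u. indicator {a..b} u * c \<partial>lborel)"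
  proof (cases "integrable lborel (\<lambda>u. indicator {a..b} u *\<^sub>R g u)")
    case True
    show ?thesis
    proof (rule Bochner_Integration.integral_norm_bound_integral[OF True])
      show "integrable lborel (\<lambda>u. indicator {a..b} u * c)"
        by (intro integrable_mult_left integrable_real_indicator) (auto simp: assms(1))
      show "norm (indicator {a..b} u *\<^sub>R g u) \<le> indicator {a..b} u * c" for u
        using assms(2) c by (auto simp: indicator_def)
    qed
  next
    case False
    then show ?thesis using c by (simp add: not_integrable_integral_eq)
  qed
  then show ?thesis using assms by (simp add: set_lebesgue_integral_def)
qed

section \<open>Second moments of the two error terms\<close>

locale brownian_crossing = standard_brownian_motion M X + crossing_functional f
  for M :: "'a measure" and X :: "real \<Rightarrow> 'a \<Rightarrow> real" and f :: "real \<Rightarrow> real \<Rightarrow> real"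
begin

text \<open>The integrand minus its conditional expectation given the path up to time \<open>u\<close>.\<close>

definition deviation :: "real \<Rightarrow> real \<Rightarrow> 'a \<Rightarrow> real" where
  "deviation \<epsilon> u \<omega> = f (path u \<omega>) (path (u + \<epsilon>) \<omega>) / \<epsilon> - crossing_kernel \<epsilon> (path u \<omega>)"

lemma deviation_measurable[measurable]:
  assumes [measurable]: "g \<in> borel_measurable N" "h \<in> measurable N M"
  shows "(\<lambda>x. deviation \<epsilon> (g x) (h x)) \<in> borel_measurable N"
  unfolding deviation_def by measurable

text \<open>The first bound, uniform in \<open>u\<close>, provides integrability. The second one uses that the deviation
  is small unless \<open>X u\<close> is within distance of order \<open>sqrt \<epsilon>\<close> of \<open>0\<close>, an event of probability
  \<open>O(sqrt \<epsilon> / sqrt u)\<close>.\<close>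

lemma deviation_second_moment:
  assumes e: "0 < \<epsilon>"
  shows "0 \<le> u \<Longrightarrow> (\<integral>\<^sup>+ \<omega>. ennreal ((deviation \<epsilon> u \<omega>)\<^sup>2) \<partial>M) \<le> ennreal (4 / \<epsilon>)"
    and "0 < u \<Longrightarrow> (\<integral>\<^sup>+ \<omega>. ennreal ((deviation \<epsilon> u \<omega>)\<^sup>2) \<partial>M) \<le> ennreal (9 / sqrt \<epsilon> * (1 / sqrt u))"
proof -
  have "(\<integral>\<^sup>+ \<omega>. ennreal ((deviation \<epsilon> u \<omega>)\<^sup>2) \<partial>M) \<le>
      (\<integral>\<^sup>+ \<omega>. ennreal (2 / \<epsilon>\<^sup>2) * ennreal ((f (path u \<omega>) (path (u + \<epsilon>) \<omega>))\<^sup>2) + 2 * ennreal ((crossing_kernel \<epsilon> (path u \<omega>))\<^sup>2) \<partial>M)"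
  proof (intro nn_integral_mono)
    fix \<omega>
    let ?x = "f (path u \<omega>) (path (u + \<epsilon>) \<omega>)" and ?k = "crossing_kernel \<epsilon> (path u \<omega>)"
    have "(deviation \<epsilon> u \<omega>)\<^sup>2 \<le> 2 * (?x / \<epsilon>)\<^sup>2 + 2 * ?k\<^sup>2"
      using zero_le_power2[of "?x / \<epsilon> + ?k"] unfolding deviation_def
      by (simp only: power2_sum power2_diff)
    also have "2 * (?x / \<epsilon>)\<^sup>2 + 2 * ?k\<^sup>2 = 2 / \<epsilon>\<^sup>2 * ?x\<^sup>2 + 2 * ?k\<^sup>2" by (simp add: power_divide)
    finally have "ennreal ((deviation \<epsilon> u \<omega>)\<^sup>2) \<le> ennreal (2 / \<epsilon>\<^sup>2 * ?x\<^sup>2 + 2 * ?k\<^sup>2)" by (rule ennreal_leI)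
    also have "\<dots> = ennreal (2 / \<epsilon>\<^sup>2 * ?x\<^sup>2) + ennreal (2 * ?k\<^sup>2)" by (rule ennreal_plus) auto
    also have "ennreal (2 / \<epsilon>\<^sup>2 * ?x\<^sup>2) = ennreal (2 / \<epsilon>\<^sup>2) * ennreal (?x\<^sup>2)" by (rule ennreal_mult) auto
    also have "ennreal (2 * ?k\<^sup>2) = 2 * ennreal (?k\<^sup>2)" by (simp add: ennreal_mult)
    finally show "ennreal ((deviation \<epsilon> u \<omega>)\<^sup>2) \<le> ennreal (2 / \<epsilon>\<^sup>2) * ennreal (?x\<^sup>2) + 2 * ennreal (?k\<^sup>2)" .
  qed
  also have "\<dots> = ennreal (2 / \<epsilon>\<^sup>2) * (\<integral>\<^sup>+ \<omega>. ennreal ((f (path u \<omega>) (path (u + \<epsilon>) \<omega>))\<^sup>2) \<partial>M)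
      + 2 * (\<integral>\<^sup>+ \<omega>. ennreal ((crossing_kernel \<epsilon> (path u \<omega>))\<^sup>2) \<partial>M)"
    by (simp add: nn_integral_add nn_integral_cmult)
  finally have split: "(\<integral>\<^sup>+ \<omega>. ennreal ((deviation \<epsilon> u \<omega>)\<^sup>2) \<partial>M) \<le>
      ennreal (2 / \<epsilon>\<^sup>2) * (\<integral>\<^sup>+ \<omega>. ennreal ((f (path u \<omega>) (path (u + \<epsilon>) \<omega>))\<^sup>2) \<partial>M)
      + 2 * (\<integral>\<^sup>+ \<omega>. ennreal ((crossing_kernel \<epsilon> (path u \<omega>))\<^sup>2) \<partial>M)" .
  have comb: "ennreal (2 / \<epsilon>\<^sup>2) * ennreal a + 2 * ennreal b = ennreal (2 / \<epsilon>\<^sup>2 * a + 2 * b)" if "0 \<le> a" "0 \<le> b" for a b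
  proof -
    have "ennreal (2 / \<epsilon>\<^sup>2 * a + 2 * b) = ennreal (2 / \<epsilon>\<^sup>2 * a) + ennreal (2 * b)" using that by (intro ennreal_plus) auto
    also have "ennreal (2 / \<epsilon>\<^sup>2 * a) = ennreal (2 / \<epsilon>\<^sup>2) * ennreal a" using that by (intro ennreal_mult) auto
    also have "ennreal (2 * b) = 2 * ennreal b" using that by (simp add: ennreal_mult)
    finally show ?thesis by simp
  qed
  have ksq: "(crossing_kernel \<epsilon> x)\<^sup>2 \<le> 1 / sqrt \<epsilon> * crossing_kernel \<epsilon> x" "(crossing_kernel \<epsilon> x)\<^sup>2 \<le> 1 / \<epsilon>" for x
  proof -
    show "(crossing_kernel \<epsilon> x)\<^sup>2 \<le> 1 / sqrt \<epsilon> * crossing_kernel \<epsilon> x"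
      unfolding power2_eq_square by (intro mult_right_mono crossing_kernel_le crossing_kernel_nonneg e)
    have "(crossing_kernel \<epsilon> x)\<^sup>2 \<le> (1 / sqrt \<epsilon>)\<^sup>2"
      by (intro power_mono crossing_kernel_le crossing_kernel_nonneg e)
    then show "(crossing_kernel \<epsilon> x)\<^sup>2 \<le> 1 / \<epsilon>" using e by (simp add: power_divide)
  qed
  show "(\<integral>\<^sup>+ \<omega>. ennreal ((deviation \<epsilon> u \<omega>)\<^sup>2) \<partial>M) \<le> ennreal (4 / \<epsilon>)" if u: "0 \<le> u"
  proof -
    have "(\<integral>\<^sup>+ \<omega>. ennreal ((f (path u \<omega>) (path (u + \<epsilon>) \<omega>))\<^sup>2) \<partial>M) \<le> (\<integral>\<^sup>+ \<omega>. ennreal ((path (u + \<epsilon>) \<omega> - path u \<omega>)\<^sup>2) \<partial>M)"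
      using f_le f_nonneg by (intro nn_integral_mono ennreal_leI abs_le_square_iff[THEN iffD1]) simp
    also have "\<dots> = ennreal \<epsilon>" using path_increment_moments(1)[of u "u + \<epsilon>"] u e by simp
    finally have 1: "(\<integral>\<^sup>+ \<omega>. ennreal ((f (path u \<omega>) (path (u + \<epsilon>) \<omega>))\<^sup>2) \<partial>M) \<le> ennreal \<epsilon>" .
    have "(\<integral>\<^sup>+ \<omega>. ennreal ((crossing_kernel \<epsilon> (path u \<omega>))\<^sup>2) \<partial>M) \<le> (\<integral>\<^sup>+ \<omega>. ennreal (1 / \<epsilon>) \<partial>M)"
      by (intro nn_integral_mono ennreal_leI ksq)
    then have 2: "(\<integral>\<^sup>+ \<omega>. ennreal ((crossing_kernel \<epsilon> (path u \<omega>))\<^sup>2) \<partial>M) \<le> ennreal (1 / \<epsilon>)"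
      by (simp add: emeasure_space_1)
    have "(\<integral>\<^sup>+ \<omega>. ennreal ((deviation \<epsilon> u \<omega>)\<^sup>2) \<partial>M) \<le> ennreal (2 / \<epsilon>\<^sup>2) * ennreal \<epsilon> + 2 * ennreal (1 / \<epsilon>)"
      by (rule order_trans[OF split]) (intro add_mono mult_left_mono 1 2; simp)
    also have "\<dots> = ennreal (2 / \<epsilon>\<^sup>2 * \<epsilon> + 2 * (1 / \<epsilon>))" using e by (intro comb) auto
    also have "2 / \<epsilon>\<^sup>2 * \<epsilon> + 2 * (1 / \<epsilon>) = 4 / \<epsilon>" using e by (simp add: power2_eq_square field_simps)
    finally show ?thesis .
  qed
  show "(\<integral>\<^sup>+ \<omega>. ennreal ((deviation \<epsilon> u \<omega>)\<^sup>2) \<partial>M) \<le> ennreal (9 / sqrt \<epsilon> * (1 / sqrt u))" if u: "0 < u"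
  proof -
    have "(\<integral>\<^sup>+ \<omega>. ennreal ((f (path u \<omega>) (path (u + \<epsilon>) \<omega>))\<^sup>2) \<partial>M) \<le>
        ennreal (1 / sqrt u) * (\<integral>\<^sup>+ x. (\<integral>\<^sup>+ z. ennreal ((f x (x + z))\<^sup>2) * ennreal (gauss (u + \<epsilon> - u) z) \<partial>lborel) \<partial>lborel)"
      by (rule nn_integral_path_pair_le[where g = "\<lambda>x y. ennreal ((f x y)\<^sup>2)"]) (use u e in auto)
    also have "\<dots> \<le> ennreal (1 / sqrt u) * ennreal (4 * \<epsilon> * sqrt \<epsilon>)"
      using nn_integral_f_square_le[OF e] by (intro mult_left_mono) auto
    also have "\<dots> = ennreal (1 / sqrt u * (4 * \<epsilon> * sqrt \<epsilon>))" using u e by (intro ennreal_mult[symmetric]) auto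
    finally have 1: "(\<integral>\<^sup>+ \<omega>. ennreal ((f (path u \<omega>) (path (u + \<epsilon>) \<omega>))\<^sup>2) \<partial>M) \<le> ennreal (1 / sqrt u * (4 * \<epsilon> * sqrt \<epsilon>))" .
    have "(\<integral>\<^sup>+ \<omega>. ennreal ((crossing_kernel \<epsilon> (path u \<omega>))\<^sup>2) \<partial>M) \<le> ennreal (1 / sqrt u) * (\<integral>\<^sup>+ x. ennreal ((crossing_kernel \<epsilon> x)\<^sup>2) \<partial>lborel)"
      by (rule nn_integral_path_le[OF u]) measurable
    also have "\<dots> \<le> ennreal (1 / sqrt u) * (\<integral>\<^sup>+ x. ennreal (1 / sqrt \<epsilon>) * ennreal (crossing_kernel \<epsilon> x) \<partial>lborel)"
    proof (intro mult_left_mono nn_integral_mono)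
      fix x
      have "ennreal ((crossing_kernel \<epsilon> x)\<^sup>2) \<le> ennreal (1 / sqrt \<epsilon> * crossing_kernel \<epsilon> x)" by (intro ennreal_leI ksq)
      also have "\<dots> = ennreal (1 / sqrt \<epsilon>) * ennreal (crossing_kernel \<epsilon> x)"
        using e by (intro ennreal_mult crossing_kernel_nonneg) auto
      finally show "ennreal ((crossing_kernel \<epsilon> x)\<^sup>2) \<le> ennreal (1 / sqrt \<epsilon>) * ennreal (crossing_kernel \<epsilon> x)" .
    qed auto
    also have "\<dots> = ennreal (1 / sqrt u) * (ennreal (1 / sqrt \<epsilon>) * ennreal (1 / 4))"
      unfolding crossing_kernel_mass[OF e, symmetric] by (subst nn_integral_cmult) auto
    also have "\<dots> = ennreal (1 / sqrt u * (1 / sqrt \<epsilon> * (1 / 4)))"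
    proof -
      have "ennreal (1 / sqrt \<epsilon>) * ennreal (1 / 4) = ennreal (1 / sqrt \<epsilon> * (1 / 4))"
        using e by (intro ennreal_mult[symmetric]) auto
      then show ?thesis using u e by (simp only:) (intro ennreal_mult[symmetric], auto)
    qed
    finally have 2: "(\<integral>\<^sup>+ \<omega>. ennreal ((crossing_kernel \<epsilon> (path u \<omega>))\<^sup>2) \<partial>M) \<le> ennreal (1 / sqrt u * (1 / sqrt \<epsilon> * (1 / 4)))" .
    have "(\<integral>\<^sup>+ \<omega>. ennreal ((deviation \<epsilon> u \<omega>)\<^sup>2) \<partial>M) \<le> ennreal (2 / \<epsilon>\<^sup>2) * ennreal (1 / sqrt u * (4 * \<epsilon> * sqrt \<epsilon>)) + 2 * ennreal (1 / sqrt u * (1 / sqrt \<epsilon> * (1 / 4)))"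
      by (rule order_trans[OF split]) (intro add_mono mult_left_mono 1 2; simp)
    also have "\<dots> = ennreal (2 / \<epsilon>\<^sup>2 * (1 / sqrt u * (4 * \<epsilon> * sqrt \<epsilon>)) + 2 * (1 / sqrt u * (1 / sqrt \<epsilon> * (1 / 4))))"
      using e u by (intro comb) auto
    also have "2 / \<epsilon>\<^sup>2 * (1 / sqrt u * (4 * \<epsilon> * sqrt \<epsilon>)) + 2 * (1 / sqrt u * (1 / sqrt \<epsilon> * (1 / 4))) = 17 / 2 / sqrt \<epsilon> * (1 / sqrt u)"
    proof -
      have "2 / \<epsilon>\<^sup>2 * (4 * \<epsilon> * sqrt \<epsilon>) = 8 / sqrt \<epsilon>" using e by (simp add: power2_eq_square field_simps)
      then have "2 / \<epsilon>\<^sup>2 * (1 / sqrt u * (4 * \<epsilon> * sqrt \<epsilon>)) = 8 / sqrt \<epsilon> * (1 / sqrt u)" by (simp add: field_simps)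
      then show ?thesis by (simp add: field_simps)
    qed
    also have "ennreal (17 / 2 / sqrt \<epsilon> * (1 / sqrt u)) \<le> ennreal (9 / sqrt \<epsilon> * (1 / sqrt u))"
      using e u by (intro ennreal_leI mult_right_mono divide_right_mono) auto
    finally show ?thesis .
  qed
qed

lemma deviation_conditional_mean_zero:
  assumes e: "0 < \<epsilon>"
  shows "(\<integral>z. (f x (x + z) / \<epsilon> - crossing_kernel \<epsilon> x) * gauss \<epsilon> z \<partial>lborel) = 0"
proof -
  have s: "0 < sqrt \<epsilon>" using e by simp
  have "(\<integral>z. (f x (x + z) / \<epsilon> - crossing_kernel \<epsilon> x) * gauss \<epsilon> z \<partial>lborel) =
      (\<integral>z. 1 / \<epsilon> * (f x (x + z) * gauss \<epsilon> z) - crossing_kernel \<epsilon> x * gauss \<epsilon> z \<partial>lborel)"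
    by (simp add: left_diff_distrib)
  also have "\<dots> = 1 / \<epsilon> * (\<integral>z. f x (x + z) * gauss \<epsilon> z \<partial>lborel) - crossing_kernel \<epsilon> x * (\<integral>z. gauss \<epsilon> z \<partial>lborel)"
    by (subst Bochner_Integration.integral_diff)
      (use integrable_f_gauss[OF e, of x] integrable_normal_density[OF s] in auto)
  also have "\<dots> = 0" using integral_normal_density[OF s] by (simp add: crossing_kernel_def)
  finally show ?thesis .
qed

text \<open>For \<open>v - u > \<epsilon>\<close> the deviation at \<open>u\<close> depends only on the path before \<open>v\<close>, so the two are
  uncorrelated. For close times the mean of the two second moments is enough, and the bound is
  larger at the earlier time.\<close>

lemma deviation_correlation:
  assumes e: "0 < \<epsilon>" and u: "0 < u" "u < v"
  shows "ennreal \<bar>expectation (\<lambda>\<omega>. deviation \<epsilon> u \<omega> * deviation \<epsilon> v \<omega>)\<bar> \<le>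
    ennreal (1 / sqrt u) * (ennreal (9 / sqrt \<epsilon>) * indicator {0..\<epsilon>} (v - u))"
proof (cases "v - u \<le> \<epsilon>")
  case False
  define \<psi> where "\<psi> x y = f x y / \<epsilon> - crossing_kernel \<epsilon> x" for x y
  have dev: "deviation \<epsilon> u \<omega> = \<psi> (path u \<omega>) (path (u + \<epsilon>) \<omega>)" for u \<omega>
    by (simp add: deviation_def \<psi>_def)
  have "ennreal \<bar>expectation (\<lambda>\<omega>. \<psi> (path u \<omega>) (path (u + \<epsilon>) \<omega>) * \<psi> (path v \<omega>) (path (v + \<epsilon>) \<omega>))\<bar> \<le>
      ennreal 0 * (\<integral>\<^sup>+ \<omega>. ennreal \<bar>\<psi> (path u \<omega>) (path (u + \<epsilon>) \<omega>)\<bar> \<partial>M)"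
  proof (rule abs_expectation_product_le)
    show "case_prod \<psi> \<in> borel_measurable (borel \<Otimes>\<^sub>M borel)" "case_prod \<psi> \<in> borel_measurable (borel \<Otimes>\<^sub>M borel)"
      unfolding \<psi>_def by measurable
    have fin: "(\<integral>\<^sup>+ \<omega>. ennreal ((\<psi> (path u \<omega>) (path (u + \<epsilon>) \<omega>))\<^sup>2) \<partial>M) < \<infinity>" if "0 \<le> u" for u
      using deviation_second_moment(1)[OF e that] unfolding dev[symmetric]
      by (rule le_less_trans) simp
    show "(\<integral>\<^sup>+ \<omega>. ennreal ((\<psi> (path u \<omega>) (path (u + \<epsilon>) \<omega>))\<^sup>2) \<partial>M) < \<infinity>"
      "(\<integral>\<^sup>+ \<omega>. ennreal ((\<psi> (path v \<omega>) (path (v + \<epsilon>) \<omega>))\<^sup>2) \<partial>M) < \<infinity>" by (rule fin, use u in simp)+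
    show "\<bar>\<integral>z. \<psi> x (x + z) * gauss (v + \<epsilon> - v) z \<partial>lborel\<bar> \<le> 0" for x
      using deviation_conditional_mean_zero[OF e, of x] by (simp add: \<psi>_def)
  qed (use u e False in auto)
  then show ?thesis by (simp add: dev)
next
  case True
  have int: "integrable M (\<lambda>\<omega>. (deviation \<epsilon> w \<omega>)\<^sup>2)" if "0 \<le> w" for w
    using deviation_second_moment(1)[OF e that] by (intro integrableI_bounded) (auto intro: le_less_trans)
  have le: "expectation (\<lambda>\<omega>. (deviation \<epsilon> w \<omega>)\<^sup>2) \<le> 9 / sqrt \<epsilon> * (1 / sqrt u)" if "u \<le> w" for w
  proof -
    have "ennreal (expectation (\<lambda>\<omega>. (deviation \<epsilon> w \<omega>)\<^sup>2)) = (\<integral>\<^sup>+ \<omega>. ennreal ((deviation \<epsilon> w \<omega>)\<^sup>2) \<partial>M)"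
      using that u by (intro nn_integral_eq_integral[symmetric] int) auto
    also have "\<dots> \<le> ennreal (9 / sqrt \<epsilon> * (1 / sqrt w))"
      using that u by (intro deviation_second_moment(2)[OF e]) auto
    also have "\<dots> \<le> ennreal (9 / sqrt \<epsilon> * (1 / sqrt u))"
      using that u e by (intro ennreal_leI mult_left_mono divide_left_mono) auto
    finally show ?thesis using u e by (subst (asm) ennreal_le_iff) auto
  qed
  have "\<bar>expectation (\<lambda>\<omega>. deviation \<epsilon> u \<omega> * deviation \<epsilon> v \<omega>)\<bar> \<le> expectation (\<lambda>\<omega>. 1 / 2 * (deviation \<epsilon> u \<omega>)\<^sup>2 + 1 / 2 * (deviation \<epsilon> v \<omega>)\<^sup>2)"
  proof (rule order_trans[OF integral_abs_bound], rule Bochner_Integration.integral_mono')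
    show "integrable M (\<lambda>\<omega>. 1 / 2 * (deviation \<epsilon> u \<omega>)\<^sup>2 + 1 / 2 * (deviation \<epsilon> v \<omega>)\<^sup>2)"
      using u by (intro Bochner_Integration.integrable_add integrable_mult_right int) auto
    show "\<bar>deviation \<epsilon> u \<omega> * deviation \<epsilon> v \<omega>\<bar> \<le> 1 / 2 * (deviation \<epsilon> u \<omega>)\<^sup>2 + 1 / 2 * (deviation \<epsilon> v \<omega>)\<^sup>2" for \<omega>
      using sum_squares_bound[of "\<bar>deviation \<epsilon> u \<omega>\<bar>" "\<bar>deviation \<epsilon> v \<omega>\<bar>"] by (simp add: abs_mult)
  qed auto
  also have "\<dots> = 1 / 2 * expectation (\<lambda>\<omega>. (deviation \<epsilon> u \<omega>)\<^sup>2) + 1 / 2 * expectation (\<lambda>\<omega>. (deviation \<epsilon> v \<omega>)\<^sup>2)"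
    using int[of u] int[of v] u by simp
  also have "\<dots> \<le> 9 / sqrt \<epsilon> * (1 / sqrt u)" using le[of u] le[of v] u by linarith
  finally have "ennreal \<bar>expectation (\<lambda>\<omega>. deviation \<epsilon> u \<omega> * deviation \<epsilon> v \<omega>)\<bar> \<le> ennreal (1 / sqrt u * (9 / sqrt \<epsilon>))"
    by (intro ennreal_leI) (simp add: mult.commute)
  also have "\<dots> = ennreal (1 / sqrt u) * ennreal (9 / sqrt \<epsilon>)" using u e by (intro ennreal_mult) auto
  finally show ?thesis using True u by simp
qed

text \<open>The strip \<open>v - u \<le> \<epsilon>\<close> has width \<open>\<epsilon>\<close> and the correlations in it are \<open>O(1 / sqrt \<epsilon>)\<close>, which leaves a
  factor \<open>sqrt \<epsilon>\<close>.\<close>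

lemma deviation_increment:
  assumes e: "0 < \<epsilon>" and ab: "0 \<le> a" "a \<le> b"
  shows "(\<integral>\<^sup>+ \<omega>. ennreal ((LINT u:{a..b}|lborel. deviation \<epsilon> u \<omega>)\<^sup>2) \<partial>M) \<le> ennreal (36 * sqrt \<epsilon> * (sqrt b - sqrt a))"
proof -
  have "(\<integral>\<^sup>+ \<omega>. ennreal ((LINT u:{a..b}|lborel. deviation \<epsilon> u \<omega>)\<^sup>2) \<partial>M) \<le>
      2 * (\<integral>\<^sup>+ u\<in>{a..b}. ennreal (1 / sqrt u) \<partial>lborel) * (\<integral>\<^sup>+ s\<in>{0..b}. (ennreal (9 / sqrt \<epsilon>) * indicator {0..\<epsilon>} s) \<partial>lborel)"
  proof (rule second_moment_time_integral[OF ab])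
    show "(\<integral>\<^sup>+ \<omega>. ennreal ((deviation \<epsilon> u \<omega>)\<^sup>2) \<partial>M) \<le> ennreal (4 / \<epsilon>)" if "a \<le> u" for u
      using ab that by (intro deviation_second_moment(1)[OF e]) auto
    show "ennreal \<bar>expectation (\<lambda>\<omega>. deviation \<epsilon> u \<omega> * deviation \<epsilon> v \<omega>)\<bar> \<le>
        ennreal (1 / sqrt u) * (ennreal (9 / sqrt \<epsilon>) * indicator {0..\<epsilon>} (v - u))" if "0 < u" "u < v" for u v
      using that by (rule deviation_correlation[OF e])
  qed measurable
  also have "\<dots> \<le> 2 * ennreal (2 * (sqrt b - sqrt a)) * ennreal (9 * sqrt \<epsilon>)"
    unfolding nn_integral_inverse_sqrt[OF ab]
  proof (intro mult_left_mono)
    have "(\<integral>\<^sup>+ s\<in>{0..b}. (ennreal (9 / sqrt \<epsilon>) * indicator {0..\<epsilon>} s) \<partial>lborel) \<le> (\<integral>\<^sup>+ s. ennreal (9 / sqrt \<epsilon>) * indicator {0..\<epsilon>} s \<partial>lborel)"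
      by (intro nn_integral_mono) (auto simp: indicator_def)
    also have "\<dots> = ennreal (9 / sqrt \<epsilon>) * ennreal \<epsilon>" using e by (subst nn_integral_cmult) auto
    also have "\<dots> = ennreal (9 / sqrt \<epsilon> * \<epsilon>)" using e by (intro ennreal_mult[symmetric]) auto
    also have "9 / sqrt \<epsilon> * \<epsilon> = 9 * sqrt \<epsilon>" using e by (simp add: field_simps)
    finally show "(\<integral>\<^sup>+ s\<in>{0..b}. (ennreal (9 / sqrt \<epsilon>) * indicator {0..\<epsilon>} s) \<partial>lborel) \<le> ennreal (9 * sqrt \<epsilon>)" .
  qed auto
  also have "\<dots> = ennreal (36 * sqrt \<epsilon> * (sqrt b - sqrt a))"
  proof -
    have "2 * ennreal (2 * (sqrt b - sqrt a)) = ennreal (2 * (2 * (sqrt b - sqrt a)))"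
      using ab by (subst ennreal_mult) auto
    then have "2 * ennreal (2 * (sqrt b - sqrt a)) * ennreal (9 * sqrt \<epsilon>) = ennreal (2 * (2 * (sqrt b - sqrt a)) * (9 * sqrt \<epsilon>))"
      using ab e by (simp only:) (intro ennreal_mult[symmetric], auto)
    also have "2 * (2 * (sqrt b - sqrt a)) * (9 * sqrt \<epsilon>) = 36 * sqrt \<epsilon> * (sqrt b - sqrt a)" by simp
    finally show ?thesis .
  qed
  finally show ?thesis .
qed

text \<open>Given the path up to \<open>u\<close>, the conditional mean of the later value is bounded by
  \<open>abs_heat_kernel_diff_le\<close> with \<open>r = v - u\<close>. This is integrable in \<open>v\<close> and carries the
  small factor \<open>\<epsilon> powr (\<theta> / 2)\<close>.\<close>

lemma kernel_diff_increment:
  assumes e: "0 < \<epsilon>" and ab: "0 \<le> a" "a \<le> b" and \<theta>: "0 < \<theta>" "\<theta> < 1"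
  shows "(\<integral>\<^sup>+ \<omega>. ennreal ((LINT u:{a..b}|lborel. kernel_diff \<epsilon> (path u \<omega>))\<^sup>2) \<partial>M) \<le>
    ennreal (28 * b powr ((1 - \<theta>) / 2) / (1 - \<theta>) * \<epsilon> powr (\<theta> / 2) * (sqrt b - sqrt a))"
proof -
  define c where "c = 7 / 2 * \<epsilon> powr (\<theta> / 2)"
  have c: "0 \<le> c" by (simp add: c_def)
  have sq: "(\<integral>\<^sup>+ \<omega>. ennreal ((kernel_diff \<epsilon> (path u \<omega>))\<^sup>2) \<partial>M) \<le> ennreal ((2 / sqrt \<epsilon>)\<^sup>2)" for u
  proof -
    have "(\<integral>\<^sup>+ \<omega>. ennreal ((kernel_diff \<epsilon> (path u \<omega>))\<^sup>2) \<partial>M) \<le> (\<integral>\<^sup>+ \<omega>. ennreal ((2 / sqrt \<epsilon>)\<^sup>2) \<partial>M)"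
      using abs_kernel_diff_le[OF e] e by (intro nn_integral_mono ennreal_leI abs_le_square_iff[THEN iffD1]) auto
    then show ?thesis by (simp add: emeasure_space_1)
  qed
  have "(\<integral>\<^sup>+ \<omega>. ennreal ((LINT u:{a..b}|lborel. kernel_diff \<epsilon> (path u \<omega>))\<^sup>2) \<partial>M) \<le>
      2 * (\<integral>\<^sup>+ u\<in>{a..b}. ennreal (1 / sqrt u) \<partial>lborel) * (\<integral>\<^sup>+ s\<in>{0..b}. (ennreal c * ennreal (s powr (- (1 + \<theta>) / 2))) \<partial>lborel)"
  proof (rule second_moment_time_integral[OF ab _ _ _ sq])
    fix u v :: real assume u: "0 < u" "u < v"
    have "ennreal \<bar>expectation (\<lambda>\<omega>. kernel_diff \<epsilon> (path u \<omega>) * kernel_diff \<epsilon> (path v \<omega>))\<bar> \<le>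
       ennreal (7 * \<epsilon> powr (\<theta> / 2) * (v - u) powr (- (1 + \<theta>) / 2)) * (\<integral>\<^sup>+ \<omega>. ennreal \<bar>kernel_diff \<epsilon> (path u \<omega>)\<bar> \<partial>M)"
    proof (rule abs_expectation_product_le[where \<phi> = "\<lambda>x _. kernel_diff \<epsilon> x" and \<psi> = "\<lambda>_ y. kernel_diff \<epsilon> y" and u = u and u' = u and v = u])
      show "\<bar>\<integral>z. kernel_diff \<epsilon> (x + z) * gauss (v - u) z \<partial>lborel\<bar> \<le> 7 * \<epsilon> powr (\<theta> / 2) * (v - u) powr (- (1 + \<theta>) / 2)" for x
        using u by (intro abs_heat_kernel_diff_le e \<theta>) auto
      show "(\<integral>\<^sup>+ \<omega>. ennreal ((kernel_diff \<epsilon> (path u \<omega>))\<^sup>2) \<partial>M) < \<infinity>" "(\<integral>\<^sup>+ \<omega>. ennreal ((kernel_diff \<epsilon> (path v \<omega>))\<^sup>2) \<partial>M) < \<infinity>"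
        by (rule le_less_trans[OF sq], simp)+
    qed (use u in auto)
    also have "\<dots> \<le> ennreal (7 * \<epsilon> powr (\<theta> / 2) * (v - u) powr (- (1 + \<theta>) / 2)) * (ennreal (1 / sqrt u) * ennreal (1 / 2))"
    proof (intro mult_left_mono)
      have "(\<integral>\<^sup>+ \<omega>. ennreal \<bar>kernel_diff \<epsilon> (path u \<omega>)\<bar> \<partial>M) \<le> ennreal (1 / sqrt u) * (\<integral>\<^sup>+ x. ennreal \<bar>kernel_diff \<epsilon> x\<bar> \<partial>lborel)"
        by (rule nn_integral_path_le[OF u(1)]) measurable
      also have "\<dots> \<le> ennreal (1 / sqrt u) * ennreal (1 / 2)"
        by (intro mult_left_mono nn_integral_abs_kernel_diff e) auto
      finally show "(\<integral>\<^sup>+ \<omega>. ennreal \<bar>kernel_diff \<epsilon> (path u \<omega>)\<bar> \<partial>M) \<le> ennreal (1 / sqrt u) * ennreal (1 / 2)" .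
    qed auto
    also have "\<dots> = ennreal (1 / sqrt u) * (ennreal c * ennreal ((v - u) powr (- (1 + \<theta>) / 2)))"
    proof -
      let ?p = "(v - u) powr (- (1 + \<theta>) / 2)"
      have "ennreal (7 * \<epsilon> powr (\<theta> / 2) * ?p) * ennreal (1 / 2) = ennreal (7 * \<epsilon> powr (\<theta> / 2) * ?p * (1 / 2))"
        by (intro ennreal_mult[symmetric]) auto
      also have "7 * \<epsilon> powr (\<theta> / 2) * ?p * (1 / 2) = c * ?p" by (simp add: c_def)
      also have "ennreal (c * ?p) = ennreal c * ennreal ?p" using c by (intro ennreal_mult) auto
      finally show ?thesis by (metis (no_types, lifting) mult.left_commute)
    qed
    finally show "ennreal \<bar>expectation (\<lambda>\<omega>. kernel_diff \<epsilon> (path u \<omega>) * kernel_diff \<epsilon> (path v \<omega>))\<bar> \<le>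
        ennreal (1 / sqrt u) * (ennreal c * ennreal ((v - u) powr (- (1 + \<theta>) / 2)))" .
  qed measurable
  also have "(\<integral>\<^sup>+ s\<in>{0..b}. (ennreal c * ennreal (s powr (- (1 + \<theta>) / 2))) \<partial>lborel) = ennreal (c * (b powr ((1 - \<theta>) / 2) / ((1 - \<theta>) / 2)))"
  proof -
    have "(\<integral>\<^sup>+ s\<in>{0..b}. (ennreal c * ennreal (s powr (- (1 + \<theta>) / 2))) \<partial>lborel) = ennreal c * (\<integral>\<^sup>+ s\<in>{0..b}. ennreal (s powr (- (1 + \<theta>) / 2)) \<partial>lborel)"
      by (subst nn_integral_cmult[symmetric]) (auto simp: mult.assoc)
    also have "(\<integral>\<^sup>+ s\<in>{0..b}. ennreal (s powr (- (1 + \<theta>) / 2)) \<partial>lborel) = ennreal (b powr (- (1 + \<theta>) / 2 + 1) / (- (1 + \<theta>) / 2 + 1))"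
      using ab \<theta> by (intro nn_integral_powr_from_0) auto
    also have "- (1 + \<theta>) / 2 + 1 = (1 - \<theta>) / 2" by (simp add: field_simps)
    finally show ?thesis using c \<theta> by (simp only:) (intro ennreal_mult[symmetric], auto)
  qed
  also have "2 * (\<integral>\<^sup>+ u\<in>{a..b}. ennreal (1 / sqrt u) \<partial>lborel) * ennreal (c * (b powr ((1 - \<theta>) / 2) / ((1 - \<theta>) / 2))) =
     ennreal (28 * b powr ((1 - \<theta>) / 2) / (1 - \<theta>) * \<epsilon> powr (\<theta> / 2) * (sqrt b - sqrt a))"
  proof -
    have "2 * ennreal (2 * (sqrt b - sqrt a)) = ennreal (2 * (2 * (sqrt b - sqrt a)))"
      using ab by (subst ennreal_mult) auto
    then have "2 * ennreal (2 * (sqrt b - sqrt a)) * ennreal (c * (b powr ((1 - \<theta>) / 2) / ((1 - \<theta>) / 2))) =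
       ennreal (2 * (2 * (sqrt b - sqrt a)) * (c * (b powr ((1 - \<theta>) / 2) / ((1 - \<theta>) / 2))))"
      using ab c \<theta> by (simp only:) (intro ennreal_mult[symmetric], auto)
    also have "2 * (2 * (sqrt b - sqrt a)) * (c * (b powr ((1 - \<theta>) / 2) / ((1 - \<theta>) / 2))) =
       28 * b powr ((1 - \<theta>) / 2) / (1 - \<theta>) * \<epsilon> powr (\<theta> / 2) * (sqrt b - sqrt a)"
      using \<theta> by (simp add: c_def field_simps)
    finally show ?thesis unfolding nn_integral_inverse_sqrt[OF ab] .
  qed
  finally show ?thesis .
qed

end

section \<open>Mean-square bounds uniform in time\<close>

text \<open>A bounded function that is continuous at \<open>0\<close> differs from its value there by at most
  \<open>\<rho> + C * \<bar>x\<bar>\<close>, with \<open>\<rho>\<close> as small as desired, and the first absolute moment of the kernel is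
  \<open>O(sqrt \<epsilon>)\<close>.\<close>

lemma (in crossing_functional) crossing_kernel_approximate_identity:
  fixes l :: "real \<Rightarrow> real" and e :: "nat \<Rightarrow> real"
  assumes [measurable]: "l \<in> borel_measurable borel" and cont: "isCont l 0"
    and bound: "AE x in lborel. \<bar>l x - l 0\<bar> \<le> B" and e: "\<And>n. 0 < e n" "e \<longlonglongrightarrow> 0"
  shows "integrable lborel (\<lambda>x. crossing_kernel (e n) x * l x)"
    and "(\<lambda>n. \<integral>x. crossing_kernel (e n) x * l x \<partial>lborel) \<longlonglongrightarrow> l 0 / 4"
proof -
  let ?k = crossing_kernel
  have B0: "0 \<le> B"
  proof -
    have "AE x in lborel :: real measure. 0 \<le> B" using bound by eventually_elim linarith
    then show ?thesis by (simp add: AE_iff_measurable[OF _ refl] split: if_splits)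
  qed
  have k0: "0 \<le> ?k (e n) x" for n x by (rule crossing_kernel_nonneg[OF e(1)])
  have int: "integrable lborel (\<lambda>x. ?k (e n) x * (l x - l 0))" for n
  proof (rule Bochner_Integration.integrable_bound[OF integrable_mult_left[OF integrable_crossing_kernel[OF e(1)[of n]], of B]])
    show "AE x in lborel. norm (?k (e n) x * (l x - l 0)) \<le> norm (?k (e n) x * B)"
      using bound by eventually_elim (use k0 B0 in \<open>auto simp: abs_mult intro!: mult_left_mono\<close>)
  qed measurable
  have split: "?k (e n) x * l x = ?k (e n) x * (l x - l 0) + ?k (e n) x * l 0" for n x
    by (simp add: right_diff_distrib)
  show "integrable lborel (\<lambda>x. ?k (e n) x * l x)" for n
    unfolding split by (intro Bochner_Integration.integrable_add int integrable_mult_left integrable_crossing_kernel e)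
  have eq: "(\<integral>x. ?k (e n) x * l x \<partial>lborel) = (\<integral>x. ?k (e n) x * (l x - l 0) \<partial>lborel) + l 0 / 4" for n
    unfolding split
    by (subst Bochner_Integration.integral_add)
      (auto simp: integral_crossing_kernel e intro!: int integrable_mult_left integrable_crossing_kernel)
  have "(\<lambda>n. \<integral>x. ?k (e n) x * (l x - l 0) \<partial>lborel) \<longlonglongrightarrow> 0"
  proof (rule LIMSEQ_I)
    fix \<rho> :: real assume \<rho>: "0 < \<rho>"
    from cont[unfolded isCont_def, THEN LIM_D, OF \<rho>] obtain \<eta> where \<eta>: "0 < \<eta>"
      "\<And>x. x \<noteq> 0 \<Longrightarrow> \<bar>x\<bar> < \<eta> \<Longrightarrow> \<bar>l x - l 0\<bar> < \<rho>" by auto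
    have le: "\<bar>\<integral>x. ?k (e n) x * (l x - l 0) \<partial>lborel\<bar> \<le> \<rho> / 4 + B / \<eta> * 4 * sqrt (e n)" for n
    proof -
      have "ennreal \<bar>\<integral>x. ?k (e n) x * (l x - l 0) \<partial>lborel\<bar> \<le> (\<integral>\<^sup>+ x. ennreal (norm (?k (e n) x * (l x - l 0))) \<partial>lborel)"
        using integral_norm_bound_ennreal[OF int[of n]] by simp
      also have "\<dots> \<le> (\<integral>\<^sup>+ x. ennreal \<rho> * ennreal (?k (e n) x) + ennreal (B / \<eta>) * ennreal (\<bar>x\<bar> * ?k (e n) x) \<partial>lborel)"
      proof (rule nn_integral_mono_AE, use bound in eventually_elim)
        case (elim x)
        have "\<bar>l x - l 0\<bar> \<le> \<rho> + B / \<eta> * \<bar>x\<bar>"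
        proof (cases "\<bar>x\<bar> < \<eta>")
          case True
          then have "\<bar>l x - l 0\<bar> \<le> \<rho>" using \<eta>(2)[of x] \<rho> by (cases "x = 0") auto
          moreover have "0 \<le> B / \<eta> * \<bar>x\<bar>" using B0 \<eta> by simp
          ultimately show ?thesis by linarith
        next
          case False
          then have "B * 1 \<le> B * (\<bar>x\<bar> / \<eta>)" using B0 \<eta> by (intro mult_left_mono) auto
          then show ?thesis using elim \<rho> by simp
        qed
        then have "norm (?k (e n) x * (l x - l 0)) \<le> ?k (e n) x * (\<rho> + B / \<eta> * \<bar>x\<bar>)"
          using k0 by (auto simp: abs_mult intro!: mult_left_mono)
        then have "ennreal (norm (?k (e n) x * (l x - l 0))) \<le> ennreal (\<rho> * ?k (e n) x + B / \<eta> * (\<bar>x\<bar> * ?k (e n) x))"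
          by (intro ennreal_leI) (simp add: algebra_simps)
        also have "\<dots> = ennreal (\<rho> * ?k (e n) x) + ennreal (B / \<eta> * (\<bar>x\<bar> * ?k (e n) x))"
          using k0[of n x] \<rho> \<eta> B0 by (intro ennreal_plus) auto
        also have "\<dots> = ennreal \<rho> * ennreal (?k (e n) x) + ennreal (B / \<eta>) * ennreal (\<bar>x\<bar> * ?k (e n) x)"
          using k0[of n x] \<rho> \<eta> B0 by (intro arg_cong2[where f = plus] ennreal_mult) auto
        finally show ?case .
      qed
      also have "\<dots> = ennreal \<rho> * (\<integral>\<^sup>+ x. ennreal (?k (e n) x) \<partial>lborel) + ennreal (B / \<eta>) * (\<integral>\<^sup>+ x. ennreal (\<bar>x\<bar> * ?k (e n) x) \<partial>lborel)"
        by (simp add: nn_integral_add nn_integral_cmult)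
      also have "\<dots> \<le> ennreal \<rho> * ennreal (1 / 4) + ennreal (B / \<eta>) * ennreal (4 * sqrt (e n))"
        unfolding crossing_kernel_mass[OF e(1)] by (intro add_left_mono mult_left_mono crossing_kernel_moment e) auto
      also have "\<dots> = ennreal (\<rho> * (1 / 4)) + ennreal (B / \<eta> * (4 * sqrt (e n)))"
        using \<rho> \<eta> B0 e(1)[of n] by (intro arg_cong2[where f = plus] ennreal_mult[symmetric]) auto
      also have "\<dots> = ennreal (\<rho> * (1 / 4) + B / \<eta> * (4 * sqrt (e n)))"
        using \<rho> \<eta> B0 e(1)[of n] by (intro ennreal_plus[symmetric]) auto
      finally show ?thesis using \<rho> \<eta> B0 e(1)[of n] by (subst (asm) ennreal_le_iff) (auto simp: less_imp_le)
    qed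
    have "(\<lambda>n. B / \<eta> * 4 * sqrt (e n)) \<longlonglongrightarrow> B / \<eta> * 4 * sqrt 0" by (intro tendsto_intros e)
    then have "(\<lambda>n. B / \<eta> * 4 * sqrt (e n)) \<longlonglongrightarrow> 0" by simp
    from LIMSEQ_D[OF this, of "\<rho> / 4"] \<rho> obtain N where N: "\<And>n. N \<le> n \<Longrightarrow> \<bar>B / \<eta> * 4 * sqrt (e n)\<bar> < \<rho> / 4" by auto
    have "norm ((\<integral>x. ?k (e n) x * (l x - l 0) \<partial>lborel) - 0) < \<rho>" if "N \<le> n" for n
      using le[of n] N[OF that] \<rho> by (simp only: real_norm_def diff_0_right)
    then show "\<exists>N. \<forall>n\<ge>N. norm ((\<integral>x. ?k (e n) x * (l x - l 0) \<partial>lborel) - 0) < \<rho>" by blast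
  qed
  from tendsto_add[OF this tendsto_const[of "l 0 / 4"]]
  show "(\<lambda>n. \<integral>x. ?k (e n) x * l x \<partial>lborel) \<longlonglongrightarrow> l 0 / 4" unfolding eq by simp
qed

context brownian_crossing
begin

definition occupation :: "real \<Rightarrow> real \<Rightarrow> 'a \<Rightarrow> real" where
  "occupation \<epsilon> t \<omega> = (LINT u:{0..t}|lborel. crossing_kernel \<epsilon> (path u \<omega>))"

definition crossing :: "real \<Rightarrow> real \<Rightarrow> 'a \<Rightarrow> real" where
  "crossing \<epsilon> t \<omega> = 1 / \<epsilon> * (LINT u:{0..t}|lborel. f (path u \<omega>) (path (u + \<epsilon>) \<omega>))"

definition stopped_crossing :: "real \<Rightarrow> real \<Rightarrow> 'a \<Rightarrow> real" where
  "stopped_crossing \<epsilon> t \<omega> = 1 / \<epsilon> * (LINT u:{0..t}|lborel. f (path u \<omega>) (path (min (u + \<epsilon>) t) \<omega>))"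

definition modulus_const :: "real \<Rightarrow> real" where
  "modulus_const H = 36 * sqrt (2 * H) / (1 - sqrt (1 / sqrt 2))\<^sup>2"

lemma modulus_const_nonneg: "0 \<le> H \<Longrightarrow> 0 \<le> modulus_const H"
  by (simp add: modulus_const_def)

lemma path_time_measurable[measurable]:
  assumes "\<omega> \<in> space M" "g \<in> borel_measurable N"
  shows "(\<lambda>x. path (g x) \<omega>) \<in> borel_measurable N"
  using assms by (intro path_measurable measurable_const)

lemma integrable_f_path:
  assumes \<omega>: "\<omega> \<in> space M" and r: "continuous_on UNIV r"
  shows "set_integrable lborel {a..b} (\<lambda>u. f (path u \<omega>) (path (r u) \<omega>))"
proof (rule set_integrable_bound)
  show "set_integrable lborel {a..b} (\<lambda>u. \<bar>path (r u) \<omega> - path u \<omega>\<bar>)"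
    by (intro borel_integrable_atLeastAtMost' continuous_intros \<omega> continuous_on_subset[OF r]) auto
  have [measurable]: "r \<in> borel_measurable borel" using r by (rule borel_measurable_continuous_onI)
  have [measurable]: "(\<lambda>u. path u \<omega>) \<in> borel_measurable borel" "(\<lambda>u. path (r u) \<omega>) \<in> borel_measurable borel"
    using \<omega> by measurable
  show "set_borel_measurable lborel {a..b} (\<lambda>u. f (path u \<omega>) (path (r u) \<omega>))"
    unfolding set_borel_measurable_def by measurable
  show "AE u in lborel. u \<in> {a..b} \<longrightarrow> norm (f (path u \<omega>) (path (r u) \<omega>)) \<le> norm \<bar>path (r u) \<omega> - path u \<omega>\<bar>"
    using f_le f_nonneg by auto
qed

lemma integrable_bounded_path:
  assumes \<omega>: "\<omega> \<in> space M" and [measurable]: "g \<in> borel_measurable borel" and g: "\<And>x :: real. \<bar>g x\<bar> \<le> c"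
  shows "set_integrable lborel {a..b} (\<lambda>u. g (path u \<omega>) :: real)"
proof (rule set_integrable_bound)
  show "set_integrable lborel {a..b} (\<lambda>u. c)"
    by (intro borel_integrable_atLeastAtMost' continuous_intros)
  have [measurable]: "(\<lambda>u. path u \<omega>) \<in> borel_measurable borel" using \<omega> by measurable
  show "set_borel_measurable lborel {a..b} (\<lambda>u. g (path u \<omega>))"
    unfolding set_borel_measurable_def by measurable
  have "\<bar>g x\<bar> \<le> \<bar>c\<bar>" for x using g[of x] by linarith
  then show "AE u in lborel. u \<in> {a..b} \<longrightarrow> norm (g (path u \<omega>)) \<le> norm c" by auto
qed

lemma integrable_kernel_path:
  assumes "\<omega> \<in> space M" "0 < \<epsilon>"
  shows "set_integrable lborel {a..b} (\<lambda>u. crossing_kernel \<epsilon> (path u \<omega>))"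
  by (rule integrable_bounded_path[OF assms(1), of _ "1 / sqrt \<epsilon>"])
    (use crossing_kernel_nonneg[OF assms(2)] crossing_kernel_le[OF assms(2)] in auto)

lemma integrable_deviation:
  assumes "\<omega> \<in> space M" "0 < \<epsilon>"
  shows "set_integrable lborel {a..b} (\<lambda>u. deviation \<epsilon> u \<omega>)"
  unfolding deviation_def using assms
  by (intro set_integral_diff(1) set_integrable_divide integrable_f_path integrable_kernel_path continuous_intros)

lemma deviation_integral_eq:
  assumes "\<omega> \<in> space M" "0 < \<epsilon>"
  shows "(LINT u:{0..t}|lborel. deviation \<epsilon> u \<omega>) = crossing \<epsilon> t \<omega> - occupation \<epsilon> t \<omega>"
proof -
  have "(LINT u:{0..t}|lborel. deviation \<epsilon> u \<omega>) =
     (LINT u:{0..t}|lborel. f (path u \<omega>) (path (u + \<epsilon>) \<omega>) / \<epsilon>) - (LINT u:{0..t}|lborel. crossing_kernel \<epsilon> (path u \<omega>))"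
    unfolding deviation_def
    by (intro set_integral_diff(2) set_integrable_divide integrable_f_path integrable_kernel_path continuous_intros assms)
  then show ?thesis by (simp add: crossing_def occupation_def)
qed

lemma sup_sq_le_path_increment:
  assumes "0 \<le> T" "0 < \<epsilon>" "\<epsilon> \<le> 1"
  shows "sup_sq_le M {(s, t). 0 \<le> s \<and> s \<le> t \<and> t \<le> T + 1 \<and> t - s \<le> \<epsilon>} (\<lambda>(s, t) \<omega>. path t \<omega> - path s \<omega>)
    (modulus_const (T + 1) * sqrt \<epsilon>)"
  unfolding modulus_const_def using assms by (intro modulus_of_continuity) auto

text \<open>Only the last time interval of length \<open>\<epsilon>\<close> is affected by stopping at \<open>t\<close>. There both
  integrands are bounded by increments of the path over times at most \<open>\<epsilon>\<close>, and their average over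
  the interval by the largest of these increments.\<close>

lemma sup_stopped_crossing:
  assumes T: "0 \<le> T" and e: "0 < \<epsilon>" "\<epsilon> \<le> 1"
  shows "sup_sq_le M {0..T} (\<lambda>t \<omega>. stopped_crossing \<epsilon> t \<omega> - crossing \<epsilon> t \<omega>) (modulus_const (T + 1) * sqrt \<epsilon>)"
proof (rule sup_sq_le_dominated[OF sup_sq_le_path_increment[OF T e]], intro AE_I2 ballI)
  fix \<omega> t assume \<omega>: "\<omega> \<in> space M" and t: "t \<in> {0..T}"
  define h where "h u = f (path u \<omega>) (path (min (u + \<epsilon>) t) \<omega>) - f (path u \<omega>) (path (u + \<epsilon>) \<omega>)" for u
  define a where "a = max 0 (t - \<epsilon>)"
  have a: "0 \<le> a" "a \<le> t" "t - a \<le> \<epsilon>" "t - \<epsilon> \<le> a" using t e by (auto simp: a_def)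
  have int: "set_integrable lborel {0..t} h"
    unfolding h_def by (intro set_integral_diff(1) integrable_f_path \<omega> continuous_intros)
  have eq1: "stopped_crossing \<epsilon> t \<omega> - crossing \<epsilon> t \<omega> = 1 / \<epsilon> * (LINT u:{0..t}|lborel. h u)"
    unfolding stopped_crossing_def crossing_def h_def right_diff_distrib[symmetric]
    by (intro arg_cong2[where f = times] refl set_integral_diff(2)[symmetric] integrable_f_path \<omega> continuous_intros)
  have "(LINT u:{0..a}|lborel. h u) = 0"
  proof (cases "a = 0")
    case False
    then have "h u = 0" if "u \<in> {0..a}" for u using that by (auto simp: h_def a_def min_def max_def split: if_splits)
    then have "(LINT u:{0..a}|lborel. h u) = (LINT u:{0..a}|lborel. 0)"
      by (intro set_lebesgue_integral_cong) auto
    then show ?thesis by (simp add: set_lebesgue_integral_def)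
  qed (use set_integral_singleton_0[of h] in simp)
  then have eq2: "(LINT u:{0..t}|lborel. h u) = (LINT u:{a..t}|lborel. h u)"
    using set_integral_diff_Icc[OF int a(1,2)] by simp
  define g where "g u = max \<bar>path t \<omega> - path u \<omega>\<bar> \<bar>path (u + \<epsilon>) \<omega> - path u \<omega>\<bar>" for u
  have "continuous_on {a..t} g" unfolding g_def by (intro continuous_intros \<omega>)
  from continuous_attains_sup[OF compact_Icc _ this] a(2) obtain u where
    u: "a \<le> u" "u \<le> t" "\<And>v. a \<le> v \<Longrightarrow> v \<le> t \<Longrightarrow> g v \<le> g u" by auto
  have "\<bar>LINT u:{a..t}|lborel. h u\<bar> \<le> (t - a) * g u"
  proof (rule abs_set_integral_le[OF a(2)])
    fix v assume v: "a \<le> v" "v \<le> t"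
    then have m: "min (v + \<epsilon>) t = t" using a(4) by auto
    have "\<bar>h v\<bar> \<le> g v" unfolding h_def g_def m
      using f_le[of "path v \<omega>" "path t \<omega>"] f_le[of "path v \<omega>" "path (v + \<epsilon>) \<omega>"]
        f_nonneg[of "path v \<omega>" "path t \<omega>"] f_nonneg[of "path v \<omega>" "path (v + \<epsilon>) \<omega>"] by linarith
    then show "\<bar>h v\<bar> \<le> g u" using u(3)[OF v] by simp
  qed
  also have "\<dots> \<le> \<epsilon> * g u" using a by (intro mult_right_mono) (auto simp: g_def)
  finally have "\<bar>stopped_crossing \<epsilon> t \<omega> - crossing \<epsilon> t \<omega>\<bar> \<le> 1 / \<epsilon> * (\<epsilon> * g u)"
    unfolding eq1 eq2 abs_mult using e by (intro mult_mono) auto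
  then have le: "\<bar>stopped_crossing \<epsilon> t \<omega> - crossing \<epsilon> t \<omega>\<bar> \<le> g u" using e by simp
  let ?S = "{(s, t). 0 \<le> s \<and> s \<le> t \<and> t \<le> T + 1 \<and> t - s \<le> \<epsilon>}"
  let ?P = "\<lambda>(s, t) \<omega>. path t \<omega> - path s \<omega>"
  show "\<exists>p\<in>?S. \<bar>stopped_crossing \<epsilon> t \<omega> - crossing \<epsilon> t \<omega>\<bar> \<le> \<bar>?P p \<omega>\<bar>"
  proof (cases "\<bar>path t \<omega> - path u \<omega>\<bar> \<le> \<bar>path (u + \<epsilon>) \<omega> - path u \<omega>\<bar>")
    case True
    then show ?thesis using le u a e t by (intro bexI[of _ "(u, u + \<epsilon>)"]) (auto simp: g_def)
  next
    case False
    then show ?thesis using le u a e t by (intro bexI[of _ "(u, t)"]) (auto simp: g_def)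
  qed
qed

text \<open>Inside a gap of length \<open>\<epsilon>\<close> the integral of the deviation is at most an increment of the path over
  time \<open>\<epsilon>\<close> plus \<open>sqrt \<epsilon>\<close>, since the kernel is bounded by \<open>1 / sqrt \<epsilon>\<close>.\<close>

lemma sup_deviation:
  assumes T: "0 < T" and \<delta>: "0 < \<delta>" "\<delta> < 1 / 2"
  shows "\<exists>C\<ge>0. \<forall>\<epsilon>\<in>{0<..1}. sup_sq_le M {0..T} (\<lambda>t \<omega>. crossing \<epsilon> t \<omega> - occupation \<epsilon> t \<omega>) (C * \<epsilon> powr \<delta>)"
proof -
  have "\<exists>C\<ge>0. \<forall>\<epsilon>\<in>{0<..1}. sup_sq_le M {0..T} (\<lambda>t \<omega>. LINT u:{0..t}|lborel. deviation \<epsilon> u \<omega>) (C * \<epsilon> powr \<delta>)"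
  proof (rule sup_sq_le_chaining_rate[OF T, where K = 36 and G = "2 * modulus_const (T + 1) + 2"])
    show "\<delta> < 1 / 2" by fact
    show "0 \<le> 2 * modulus_const (T + 1) + 2" using modulus_const_nonneg[of "T + 1"] T by simp
    show "(\<lambda>\<omega>. LINT u:{0..t}|lborel. deviation \<epsilon> u \<omega>) \<in> borel_measurable M" for \<epsilon> t
      unfolding set_lebesgue_integral_def by measurable
    show "(LINT u:{0..0}|lborel. deviation \<epsilon> u \<omega>) = 0" for \<epsilon> \<omega> by (rule set_integral_singleton_0)
  next
    fix \<epsilon> a b :: real assume e: "0 < \<epsilon>" "\<epsilon> \<le> 1" and ab: "0 \<le> a" "a \<le> b" "b \<le> T"
    have "(\<integral>\<^sup>+ \<omega>. ennreal (((LINT u:{0..b}|lborel. deviation \<epsilon> u \<omega>) - (LINT u:{0..a}|lborel. deviation \<epsilon> u \<omega>))\<^sup>2) \<partial>M) =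
        (\<integral>\<^sup>+ \<omega>. ennreal ((LINT u:{a..b}|lborel. deviation \<epsilon> u \<omega>)\<^sup>2) \<partial>M)"
      by (intro nn_integral_cong) (simp add: set_integral_diff_Icc[OF integrable_deviation[OF _ e(1)] ab(1,2)])
    also have "\<dots> \<le> ennreal (36 * sqrt \<epsilon> * (sqrt b - sqrt a))" by (rule deviation_increment[OF e(1) ab(1,2)])
    finally show "(\<integral>\<^sup>+ \<omega>. ennreal (((LINT u:{0..b}|lborel. deviation \<epsilon> u \<omega>) - (LINT u:{0..a}|lborel. deviation \<epsilon> u \<omega>))\<^sup>2) \<partial>M)
       \<le> ennreal (36 * \<epsilon> powr (1 / 2) * (sqrt b - sqrt a))" using e by (simp add: powr_half_sqrt)
  next
    fix \<epsilon> :: real assume e: "0 < \<epsilon>" "\<epsilon> \<le> 1"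
    let ?S = "{(s, t). 0 \<le> s \<and> s \<le> t \<and> t \<le> T + 1 \<and> t - s \<le> \<epsilon>}"
    let ?S' = "{(s, t). 0 \<le> s \<and> s \<le> t \<and> t \<le> T \<and> t - s \<le> \<epsilon>}"
    let ?P = "\<lambda>(s, t) \<omega>. path t \<omega> - path s \<omega>"
    define D where "D p \<omega> = (LINT u:{fst p..snd p}|lborel. deviation \<epsilon> u \<omega>)" for p \<omega>
    \<comment> \<open>The increment over time \<open>\<epsilon>\<close> that bounds the gap \<open>p\<close>, up to \<open>sqrt \<epsilon>\<close>; it is chosen separately for each path.\<close>
    define h where "h p \<omega> = (SOME v. \<exists>u. fst p \<le> u \<and> u \<le> snd p \<and> v = path (u + \<epsilon>) \<omega> - path u \<omega> \<and> \<bar>D p \<omega>\<bar> \<le> \<bar>v\<bar> + sqrt \<epsilon>)" for p \<omega>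
    have h: "\<exists>u. fst p \<le> u \<and> u \<le> snd p \<and> h p \<omega> = path (u + \<epsilon>) \<omega> - path u \<omega> \<and> \<bar>D p \<omega>\<bar> \<le> \<bar>h p \<omega>\<bar> + sqrt \<epsilon>"
      if \<omega>: "\<omega> \<in> space M" and p: "p \<in> ?S'" for \<omega> p
    proof -
      obtain s t where st: "p = (s, t)" "0 \<le> s" "s \<le> t" "t - s \<le> \<epsilon>" using p by auto
      define g where "g u = \<bar>path (u + \<epsilon>) \<omega> - path u \<omega>\<bar>" for u
      have "continuous_on {s..t} g" unfolding g_def by (intro continuous_intros \<omega>)
      from continuous_attains_sup[OF compact_Icc _ this] st obtain u where
        u: "s \<le> u" "u \<le> t" "\<And>v. s \<le> v \<Longrightarrow> v \<le> t \<Longrightarrow> g v \<le> g u" by auto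
      have "\<bar>LINT u:{s..t}|lborel. deviation \<epsilon> u \<omega>\<bar> \<le> (t - s) * (g u / \<epsilon> + 1 / sqrt \<epsilon>)"
      proof (rule abs_set_integral_le[OF st(3)])
        fix v assume v: "s \<le> v" "v \<le> t"
        have "f (path v \<omega>) (path (v + \<epsilon>) \<omega>) / \<epsilon> \<le> g u / \<epsilon>"
          using f_le[of "path v \<omega>" "path (v + \<epsilon>) \<omega>"] u(3)[OF v] e unfolding g_def by (intro divide_right_mono) auto
        moreover have "0 \<le> f (path v \<omega>) (path (v + \<epsilon>) \<omega>) / \<epsilon>" using f_nonneg e by simp
        ultimately show "\<bar>deviation \<epsilon> v \<omega>\<bar> \<le> g u / \<epsilon> + 1 / sqrt \<epsilon>"
          using crossing_kernel_nonneg[OF e(1), of "path v \<omega>"] crossing_kernel_le[OF e(1), of "path v \<omega>"]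
          unfolding deviation_def abs_le_iff by linarith
      qed
      also have "\<dots> \<le> \<epsilon> * (g u / \<epsilon> + 1 / sqrt \<epsilon>)"
        using st e by (intro mult_right_mono) (auto simp: g_def)
      also have "\<dots> = g u + sqrt \<epsilon>" using e by (simp add: field_simps)
      finally have "\<exists>v u. fst p \<le> u \<and> u \<le> snd p \<and> v = path (u + \<epsilon>) \<omega> - path u \<omega> \<and> \<bar>D p \<omega>\<bar> \<le> \<bar>v\<bar> + sqrt \<epsilon>"
        using u(1,2) by (auto simp: D_def st g_def)
      from someI_ex[OF this] show ?thesis unfolding h_def[symmetric] .
    qed
    have "sup_sq_le M ?S' h (modulus_const (T + 1) * sqrt \<epsilon>)"
    proof (rule sup_sq_le_dominated[OF sup_sq_le_path_increment[OF _ e]], use T in simp, intro AE_I2 ballI)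
      fix \<omega> p assume "\<omega> \<in> space M" and p: "p \<in> ?S'"
      from h[OF this] obtain u where u: "fst p \<le> u" "u \<le> snd p" "h p \<omega> = path (u + \<epsilon>) \<omega> - path u \<omega>" by blast
      then show "\<exists>q\<in>?S. \<bar>h p \<omega>\<bar> \<le> \<bar>?P q \<omega>\<bar>" using p e by (intro bexI[of _ "(u, u + \<epsilon>)"]) auto
    qed
    from sup_sq_le_add[OF this sup_sq_le_const[of _ "sqrt \<epsilon>"]]
    have "sup_sq_le M ?S' D (2 * (modulus_const (T + 1) * sqrt \<epsilon>) + 2 * (sqrt \<epsilon>)\<^sup>2)"
      using h e modulus_const_nonneg[of "T + 1"] T by (simp add: AE_I2) blast
    then have "sup_sq_le M ?S' D ((2 * modulus_const (T + 1) + 2) * \<epsilon> powr \<delta>)"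
    proof (rule sup_sq_le_mono)
      have 1: "sqrt \<epsilon> \<le> \<epsilon> powr \<delta>"
        using e \<delta> powr_mono'[of \<delta> "1/2" \<epsilon>] by (simp add: powr_half_sqrt)
      have 2: "(sqrt \<epsilon>)\<^sup>2 \<le> \<epsilon> powr \<delta>"
        using e \<delta> powr_mono'[of \<delta> 1 \<epsilon>] by simp
      have "modulus_const (T + 1) * sqrt \<epsilon> \<le> modulus_const (T + 1) * \<epsilon> powr \<delta>"
        using modulus_const_nonneg[of "T + 1"] T 1 by (intro mult_left_mono) auto
      then show "2 * (modulus_const (T + 1) * sqrt \<epsilon>) + 2 * (sqrt \<epsilon>)\<^sup>2 \<le> (2 * modulus_const (T + 1) + 2) * \<epsilon> powr \<delta>"
        using 2 by (simp add: distrib_right)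
    qed
    then show "sup_sq_le M ?S' (\<lambda>(s, t) \<omega>. (LINT u:{0..t}|lborel. deviation \<epsilon> u \<omega>) - (LINT u:{0..s}|lborel. deviation \<epsilon> u \<omega>))
        ((2 * modulus_const (T + 1) + 2) * \<epsilon> powr \<delta>)"
    proof (rule sup_sq_le_dominated, intro AE_I2 ballI)
      fix \<omega> p assume \<omega>: "\<omega> \<in> space M" and p: "p \<in> ?S'"
      then obtain s t where st: "p = (s, t)" "0 \<le> s" "s \<le> t" by auto
      show "\<exists>q\<in>?S'. \<bar>(case p of (s, t) \<Rightarrow> \<lambda>\<omega>. (LINT u:{0..t}|lborel. deviation \<epsilon> u \<omega>) - (LINT u:{0..s}|lborel. deviation \<epsilon> u \<omega>)) \<omega>\<bar> \<le> \<bar>D q \<omega>\<bar>"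
        by (rule bexI[OF _ p]) (simp add: st(1) D_def set_integral_diff_Icc[OF integrable_deviation[OF \<omega> e(1)] st(2,3)])
    qed
  qed simp_all
  then obtain C where C: "0 \<le> C" "\<And>\<epsilon>. \<epsilon> \<in> {0<..1} \<Longrightarrow> sup_sq_le M {0..T} (\<lambda>t \<omega>. LINT u:{0..t}|lborel. deviation \<epsilon> u \<omega>) (C * \<epsilon> powr \<delta>)"
    by blast
  have "sup_sq_le M {0..T} (\<lambda>t \<omega>. crossing \<epsilon> t \<omega> - occupation \<epsilon> t \<omega>) (C * \<epsilon> powr \<delta>)" if e: "\<epsilon> \<in> {0<..1}" for \<epsilon>
    by (rule sup_sq_le_dominated[OF C(2)[OF e]], intro AE_I2 ballI)
      (use e in \<open>auto simp: deviation_integral_eq\<close>)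
  then show ?thesis using C(1) by blast
qed

lemma occupation_diff:
  assumes "\<omega> \<in> space M" "0 < \<epsilon>"
  shows "(LINT u:{0..t}|lborel. kernel_diff \<epsilon> (path u \<omega>)) = occupation \<epsilon> t \<omega> - occupation (\<epsilon> / 4) t \<omega>"
  unfolding kernel_diff_def occupation_def using assms by (intro set_integral_diff(2) integrable_kernel_path) auto

text \<open>Inside a gap of length \<open>\<epsilon>\<close> the integral is at most \<open>2 * sqrt \<epsilon>\<close>, because \<open>kernel_diff \<epsilon>\<close> is bounded by
  \<open>2 / sqrt \<epsilon>\<close>.\<close>

lemma sup_occupation_diff:
  assumes T: "0 < T" and \<delta>: "0 < \<delta>" "\<delta> < 1 / 2"
  shows "\<exists>C\<ge>0. \<forall>\<epsilon>\<in>{0<..1}. sup_sq_le M {0..T} (\<lambda>t \<omega>. LINT u:{0..t}|lborel. kernel_diff \<epsilon> (path u \<omega>)) (C * \<epsilon> powr \<delta>)"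
proof -
  \<comment> \<open>Any value strictly between \<open>2 * \<delta>\<close> and \<open>1\<close> would do.\<close>
  define \<theta> where "\<theta> = \<delta> + 1 / 2"
  have \<theta>: "0 < \<theta>" "\<theta> < 1" "\<delta> < \<theta> / 2" using \<delta> by (auto simp: \<theta>_def)
  define K where "K = 28 * T powr ((1 - \<theta>) / 2) / (1 - \<theta>)"
  show ?thesis
  proof (rule sup_sq_le_chaining_rate[OF T, where K = K and G = 4 and \<eta> = "\<theta> / 2"])
    show "0 \<le> K" using \<theta> by (simp add: K_def)
    show "(\<lambda>\<omega>. LINT u:{0..t}|lborel. kernel_diff \<epsilon> (path u \<omega>)) \<in> borel_measurable M" for \<epsilon> t
      unfolding set_lebesgue_integral_def by measurable
    show "(LINT u:{0..0}|lborel. kernel_diff \<epsilon> (path u \<omega>)) = 0" for \<epsilon> \<omega> by (rule set_integral_singleton_0)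
  next
    fix \<epsilon> a b :: real assume e: "0 < \<epsilon>" "\<epsilon> \<le> 1" and ab: "0 \<le> a" "a \<le> b" "b \<le> T"
    have "(\<integral>\<^sup>+ \<omega>. ennreal (((LINT u:{0..b}|lborel. kernel_diff \<epsilon> (path u \<omega>)) - (LINT u:{0..a}|lborel. kernel_diff \<epsilon> (path u \<omega>)))\<^sup>2) \<partial>M) =
        (\<integral>\<^sup>+ \<omega>. ennreal ((LINT u:{a..b}|lborel. kernel_diff \<epsilon> (path u \<omega>))\<^sup>2) \<partial>M)"
      by (intro nn_integral_cong)
        (simp add: set_integral_diff_Icc[OF integrable_bounded_path[OF _ kernel_diff_measurable abs_kernel_diff_le[OF e(1)]] ab(1,2)])
    also have "\<dots> \<le> ennreal (28 * b powr ((1 - \<theta>) / 2) / (1 - \<theta>) * \<epsilon> powr (\<theta> / 2) * (sqrt b - sqrt a))"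
      by (rule kernel_diff_increment[OF e(1) ab(1,2) \<theta>(1,2)])
    also have "\<dots> \<le> ennreal (K * \<epsilon> powr (\<theta> / 2) * (sqrt b - sqrt a))"
      unfolding K_def using ab \<theta> by (intro ennreal_leI mult_right_mono divide_right_mono mult_left_mono powr_mono2) auto
    finally show "(\<integral>\<^sup>+ \<omega>. ennreal (((LINT u:{0..b}|lborel. kernel_diff \<epsilon> (path u \<omega>)) - (LINT u:{0..a}|lborel. kernel_diff \<epsilon> (path u \<omega>)))\<^sup>2) \<partial>M)
        \<le> ennreal (K * \<epsilon> powr (\<theta> / 2) * (sqrt b - sqrt a))" .
  next
    fix \<epsilon> :: real assume e: "0 < \<epsilon>" "\<epsilon> \<le> 1"
    let ?S' = "{(s, t). 0 \<le> s \<and> s \<le> t \<and> t \<le> T \<and> t - s \<le> \<epsilon>}"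
    have "sup_sq_le M ?S' (\<lambda>_ _. 2 * sqrt \<epsilon>) (4 * \<epsilon> powr \<delta>)"
    proof (rule sup_sq_le_mono[OF sup_sq_le_const])
      show "(2 * sqrt \<epsilon>)\<^sup>2 \<le> 4 * \<epsilon> powr \<delta>"
        using e \<delta> powr_mono'[of \<delta> 1 \<epsilon>] by (simp add: power_mult_distrib)
    qed
    then show "sup_sq_le M ?S' (\<lambda>(s, t) \<omega>. (LINT u:{0..t}|lborel. kernel_diff \<epsilon> (path u \<omega>)) - (LINT u:{0..s}|lborel. kernel_diff \<epsilon> (path u \<omega>))) (4 * \<epsilon> powr \<delta>)"
    proof (rule sup_sq_le_dominated, intro AE_I2 ballI)
      fix \<omega> p assume \<omega>: "\<omega> \<in> space M" and p: "p \<in> ?S'"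
      then obtain s t where st: "p = (s, t)" "0 \<le> s" "s \<le> t" "t - s \<le> \<epsilon>" by auto
      have "\<bar>LINT u:{s..t}|lborel. kernel_diff \<epsilon> (path u \<omega>)\<bar> \<le> (t - s) * (2 / sqrt \<epsilon>)"
        using abs_kernel_diff_le[OF e(1)] st by (intro abs_set_integral_le) auto
      also have "\<dots> \<le> \<epsilon> * (2 / sqrt \<epsilon>)" using st e by (intro mult_right_mono) auto
      also have "\<dots> = 2 * sqrt \<epsilon>" using e by (simp add: field_simps)
      finally show "\<exists>q\<in>?S'. \<bar>(case p of (s, t) \<Rightarrow> \<lambda>\<omega>. (LINT u:{0..t}|lborel. kernel_diff \<epsilon> (path u \<omega>)) - (LINT u:{0..s}|lborel. kernel_diff \<epsilon> (path u \<omega>))) \<omega>\<bar> \<le> \<bar>2 * sqrt \<epsilon>\<bar>"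
        using p e by (intro bexI[OF _ p])
          (simp add: st(1) set_integral_diff_Icc[OF integrable_bounded_path[OF \<omega> kernel_diff_measurable abs_kernel_diff_le[OF e(1)]] st(2,3)])
    qed
  qed (use \<theta> in simp_all)
qed

text \<open>Up to time \<open>t\<close> the path stays in a bounded set, so by the occupation time formula the local times
  vanish at almost every level outside it and are bounded. The kernel then acts on the continuous
  function \<open>x \<mapsto> L x t\<close> as an approximate identity of mass \<open>1 / 4\<close>.\<close>

lemma occupation_tendsto_local_time:
  assumes lt: "local_time_family M X L" and e: "0 < \<epsilon>"
  shows "AE \<omega> in M. \<forall>t\<ge>0. (\<lambda>n. occupation (\<epsilon> / 4 ^ n) t \<omega>) \<longlonglongrightarrow> 1 / 4 * L 0 t \<omega>"
proof -
  have cont: "continuous_on (UNIV \<times> {0..}) (\<lambda>(x, t). L x t \<omega>)" if "\<omega> \<in> space M" for \<omega>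
    using lt that unfolding local_time_family_def by blast
  have nonneg: "0 \<le> L x t \<omega>" if "\<omega> \<in> space M" "0 \<le> t" for x t \<omega>
    using lt that unfolding local_time_family_def by blast
  have "AE \<omega> in M. \<forall>t\<ge>0. \<forall>g :: real \<Rightarrow> ennreal. g \<in> borel_measurable borel \<longrightarrow>
        (\<integral>\<^sup>+ s\<in>{0..t}. g (X s \<omega>) \<partial>lborel) = (\<integral>\<^sup>+ x. g x * ennreal (L x t \<omega>) \<partial>lborel)"
    using lt unfolding local_time_family_def by blast
  then show ?thesis using AE_space
  proof eventually_elim
    case (elim \<omega>)
    note \<omega> = elim(2)
    show ?case
    proof (intro allI impI)
      fix t :: real assume t: "0 \<le> t"
      define l where "l x = L x t \<omega>" for x
      have occ: "(\<integral>\<^sup>+ s\<in>{0..t}. g (path s \<omega>) \<partial>lborel) = (\<integral>\<^sup>+ x. g x * ennreal (l x) \<partial>lborel)"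
        if "g \<in> borel_measurable borel" for g :: "real \<Rightarrow> ennreal"
      proof -
        have "(\<integral>\<^sup>+ s\<in>{0..t}. g (path s \<omega>) \<partial>lborel) = (\<integral>\<^sup>+ s\<in>{0..t}. g (X s \<omega>) \<partial>lborel)"
          by (intro nn_integral_cong) (auto simp: indicator_def path_eq)
        then show ?thesis using elim(1) t that by (simp add: l_def)
      qed
      have l0: "0 \<le> l x" for x using nonneg[OF \<omega> t] by (simp add: l_def)
      have "continuous_on UNIV (\<lambda>x. (\<lambda>(x, t). L x t \<omega>) (x, t))"
        by (rule continuous_on_compose2[OF cont[OF \<omega>]]) (use t in \<open>auto intro!: continuous_intros\<close>)
      then have lcont: "continuous_on UNIV l" by (simp add: l_def[abs_def])
      have lm[measurable]: "l \<in> borel_measurable borel" by (rule borel_measurable_continuous_onI[OF lcont])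
      have "compact ((\<lambda>u. path u \<omega>) ` {0..t})"
        by (intro compact_continuous_image continuous_intros \<omega>) auto
      then obtain K where K: "\<And>u. 0 \<le> u \<Longrightarrow> u \<le> t \<Longrightarrow> \<bar>path u \<omega>\<bar> \<le> K"
        by (metis (no_types, lifting) atLeastAtMost_iff bounded_iff compact_imp_bounded image_eqI real_norm_def)
      have K0: "0 \<le> K" using K[of 0] t by (simp add: order_trans[OF abs_ge_zero])
      have "compact (l ` {- K..K})"
        by (intro compact_continuous_image continuous_on_subset[OF lcont]) auto
      then obtain B where B: "\<And>x. - K \<le> x \<Longrightarrow> x \<le> K \<Longrightarrow> \<bar>l x\<bar> \<le> B"
        by (metis (no_types, lifting) atLeastAtMost_iff bounded_iff compact_imp_bounded image_eqI real_norm_def)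
      let ?O = "{x :: real. K < \<bar>x\<bar>}"
      have Om[measurable]: "?O \<in> sets borel" by measurable
      have "(\<integral>\<^sup>+ x. indicator ?O x * ennreal (l x) \<partial>lborel) = (\<integral>\<^sup>+ s\<in>{0..t}. indicator ?O (path s \<omega>) \<partial>lborel)"
        by (rule occ[symmetric]) measurable
      also have "\<dots> = (\<integral>\<^sup>+ s. 0 \<partial>(lborel :: real measure))"
        using K by (intro nn_integral_cong) (fastforce simp: indicator_def not_less)
      finally have "(\<integral>\<^sup>+ x. indicator ?O x * ennreal (l x) \<partial>lborel) = 0" by simp
      then have "AE x in lborel. indicator ?O x * ennreal (l x) = 0"
        by (subst (asm) nn_integral_0_iff_AE) auto
      then have bound: "AE x in lborel. \<bar>l x - l 0\<bar> \<le> 2 * B"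
      proof eventually_elim
        case (elim x)
        have b0: "\<bar>l 0\<bar> \<le> B" using B[of 0] K0 by simp
        show ?case
        proof (cases "K < \<bar>x\<bar>")
          case True
          then have "l x = 0" using elim l0[of x] by (simp add: ennreal_eq_0_iff)
          then show ?thesis using b0 by simp
        next
          case False
          then have "\<bar>l x\<bar> \<le> B" using B[of x] by auto
          then show ?thesis using b0 by linarith
        qed
      qed
      define e where "e n = \<epsilon> / 4 ^ n" for n :: nat
      have e0: "0 < e n" for n using \<open>0 < \<epsilon>\<close> by (simp add: e_def)
      have "(\<lambda>n. \<epsilon> * (1 / 4) ^ n) \<longlonglongrightarrow> \<epsilon> * 0" by (intro tendsto_intros LIMSEQ_power_zero) simp
      then have elim0: "e \<longlonglongrightarrow> 0" by (simp add: e_def[abs_def] power_divide)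
      have "isCont l 0" using lcont by (simp add: continuous_on_eq_continuous_at)
      note approx = crossing_kernel_approximate_identity[OF lm this bound e0 elim0]
      have "occupation (e n) t \<omega> = (\<integral>x. crossing_kernel (e n) x * l x \<partial>lborel)" for n
      proof -
        have k0: "0 \<le> crossing_kernel (e n) x" for x by (rule crossing_kernel_nonneg[OF e0])
        have "ennreal (occupation (e n) t \<omega>) = (\<integral>\<^sup>+ u. ennreal (indicator {0..t} u *\<^sub>R crossing_kernel (e n) (path u \<omega>)) \<partial>lborel)"
          unfolding occupation_def set_lebesgue_integral_def
          by (intro nn_integral_eq_integral[symmetric] integrable_kernel_path[OF \<omega> e0, unfolded set_integrable_def]) (auto simp: k0)
        also have "\<dots> = (\<integral>\<^sup>+ s\<in>{0..t}. ennreal (crossing_kernel (e n) (path s \<omega>)) \<partial>lborel)"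
          by (intro nn_integral_cong) (auto simp: indicator_def)
        also have "\<dots> = (\<integral>\<^sup>+ x. ennreal (crossing_kernel (e n) x) * ennreal (l x) \<partial>lborel)"
          by (rule occ) measurable
        also have "\<dots> = (\<integral>\<^sup>+ x. ennreal (crossing_kernel (e n) x * l x) \<partial>lborel)"
          by (intro nn_integral_cong ennreal_mult[symmetric] k0 l0)
        also have "\<dots> = ennreal (\<integral>x. crossing_kernel (e n) x * l x \<partial>lborel)"
          by (intro nn_integral_eq_integral approx(1)) (auto simp: k0 l0)
        finally show ?thesis
          by (subst (asm) ennreal_inj) (auto simp: occupation_def set_lebesgue_integral_def k0 l0 intro!: integral_nonneg)
      qed
      then show "(\<lambda>n. occupation (\<epsilon> / 4 ^ n) t \<omega>) \<longlonglongrightarrow> 1 / 4 * L 0 t \<omega>"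
        using approx(2) by (simp add: e_def l_def)
    qed
  qed
qed

text \<open>Telescoping along the scales \<open>\<epsilon> / 4 ^ k\<close>, whose bounds form a geometric series.\<close>

lemma sup_occupation:
  assumes lt: "local_time_family M X L" and T: "0 < T" and \<delta>: "0 < \<delta>" "\<delta> < 1 / 2"
  shows "\<exists>C\<ge>0. \<forall>\<epsilon>\<in>{0<..1}. sup_sq_le M {0..T} (\<lambda>t \<omega>. occupation \<epsilon> t \<omega> - 1 / 4 * L 0 t \<omega>) (C * \<epsilon> powr \<delta>)"
proof -
  from sup_occupation_diff[OF T \<delta>] obtain C where C: "0 \<le> C"
    and sup: "\<And>\<epsilon>. \<epsilon> \<in> {0<..1} \<Longrightarrow> sup_sq_le M {0..T} (\<lambda>t \<omega>. LINT u:{0..t}|lborel. kernel_diff \<epsilon> (path u \<omega>)) (C * \<epsilon> powr \<delta>)"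
    by blast
  define p :: real where "p = 4 powr (- \<delta>)"
  have p: "0 < p" "p < 1" using \<delta> powr_less_mono[of "- \<delta>" 0 4] by (auto simp: p_def)
  have "sup_sq_le M {0..T} (\<lambda>t \<omega>. occupation \<epsilon> t \<omega> - 1 / 4 * L 0 t \<omega>) (C / (1 - sqrt p)\<^sup>2 * \<epsilon> powr \<delta>)" if \<epsilon>: "\<epsilon> \<in> {0<..1}" for \<epsilon>
  proof -
    have e: "0 < \<epsilon> / 4 ^ k" "\<epsilon> / 4 ^ k \<le> 1" for k :: nat
    proof -
      have "\<epsilon> / 4 ^ k \<le> 1 / 1" using \<epsilon> by (intro frac_le) auto
      then show "0 < \<epsilon> / 4 ^ k" "\<epsilon> / 4 ^ k \<le> 1" using \<epsilon> by auto
    qed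
    have "sup_sq_le M {0..T} (\<lambda>t \<omega>. occupation \<epsilon> t \<omega> - 1 / 4 * L 0 t \<omega>) (C * \<epsilon> powr \<delta> / (1 - sqrt p)\<^sup>2)"
    proof (rule sup_sq_le_series[where Y = "\<lambda>k t \<omega>. LINT u:{0..t}|lborel. kernel_diff (\<epsilon> / 4 ^ k) (path u \<omega>)", OF _ p])
      fix k
      have "(\<epsilon> / 4 ^ k) powr \<delta> = \<epsilon> powr \<delta> * p ^ k"
      proof -
        have "((4 :: real) ^ k) powr \<delta> = (4 powr real k) powr \<delta>" by (simp add: powr_realpow)
        also have "\<dots> = (4 powr \<delta>) powr real k" by (simp add: powr_powr mult.commute)
        also have "\<dots> = (4 powr \<delta>) ^ k" by (simp add: powr_realpow)
        finally have "((4 :: real) ^ k) powr \<delta> = (4 powr \<delta>) ^ k" .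
        moreover have "(\<epsilon> / 4 ^ k) powr \<delta> = \<epsilon> powr \<delta> / (4 ^ k) powr \<delta>" by (rule powr_divide)
        moreover have "p ^ k = 1 / (4 powr \<delta>) ^ k" by (simp add: p_def powr_minus inverse_eq_divide power_one_over)
        ultimately show ?thesis by simp
      qed
      then show "sup_sq_le M {0..T} (\<lambda>t \<omega>. LINT u:{0..t}|lborel. kernel_diff (\<epsilon> / 4 ^ k) (path u \<omega>)) (C * \<epsilon> powr \<delta> * p ^ k)"
        using sup[of "\<epsilon> / 4 ^ k"] e[of k] by (simp add: mult.assoc)
    next
      show "0 \<le> C * \<epsilon> powr \<delta>" using C by simp
      have "0 < \<epsilon>" using \<epsilon> by simp
      from occupation_tendsto_local_time[OF lt this]
      show "AE \<omega> in M. \<forall>t\<in>{0..T}. \<exists>z. (z \<longlonglongrightarrow> occupation \<epsilon> t \<omega> - 1 / 4 * L 0 t \<omega>) \<and>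
          (\<forall>n. \<bar>z n\<bar> \<le> (\<Sum>k<n. \<bar>LINT u:{0..t}|lborel. kernel_diff (\<epsilon> / 4 ^ k) (path u \<omega>)\<bar>))"
        using AE_space
      proof eventually_elim
        case (elim \<omega>)
        show ?case
        proof
          fix t assume t: "t \<in> {0..T}"
          define z where "z n = occupation \<epsilon> t \<omega> - occupation (\<epsilon> / 4 ^ n) t \<omega>" for n :: nat
          have "z \<longlonglongrightarrow> occupation \<epsilon> t \<omega> - 1 / 4 * L 0 t \<omega>"
            unfolding z_def using elim t by (intro tendsto_diff tendsto_const) auto
          moreover have "\<bar>z n\<bar> \<le> (\<Sum>k<n. \<bar>LINT u:{0..t}|lborel. kernel_diff (\<epsilon> / 4 ^ k) (path u \<omega>)\<bar>)" for n
          proof (induction n)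
            case (Suc n)
            have "(LINT u:{0..t}|lborel. kernel_diff (\<epsilon> / 4 ^ n) (path u \<omega>)) = occupation (\<epsilon> / 4 ^ n) t \<omega> - occupation (\<epsilon> / 4 ^ Suc n) t \<omega>"
              using occupation_diff[OF elim(2) e(1)[of n], of t] by (simp add: mult.commute)
            then have "z (Suc n) = z n + (LINT u:{0..t}|lborel. kernel_diff (\<epsilon> / 4 ^ n) (path u \<omega>))"
              by (simp add: z_def)
            then have "\<bar>z (Suc n)\<bar> \<le> \<bar>z n\<bar> + \<bar>LINT u:{0..t}|lborel. kernel_diff (\<epsilon> / 4 ^ n) (path u \<omega>)\<bar>" by linarith
            then show ?case using Suc by simp
          qed (simp add: z_def)
          ultimately show "\<exists>z. (z \<longlonglongrightarrow> occupation \<epsilon> t \<omega> - 1 / 4 * L 0 t \<omega>) \<and>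
            (\<forall>n. \<bar>z n\<bar> \<le> (\<Sum>k<n. \<bar>LINT u:{0..t}|lborel. kernel_diff (\<epsilon> / 4 ^ k) (path u \<omega>)\<bar>))" by blast
        qed
      qed
    qed
    then show ?thesis by simp
  qed
  then show ?thesis using C by (intro exI[of _ "C / (1 - sqrt p)\<^sup>2"]) auto
qed

lemma sup_stopped_crossing_local_time:
  assumes lt: "local_time_family M X L" and T: "0 < T" and \<delta>: "0 < \<delta>" "\<delta> < 1 / 2"
  shows "\<exists>C\<ge>0. \<forall>\<epsilon>\<in>{0<..1}. sup_sq_le M {0..T} (\<lambda>t \<omega>. stopped_crossing \<epsilon> t \<omega> - 1 / 4 * L 0 t \<omega>) (C * \<epsilon> powr \<delta>)"
proof -
  from sup_deviation[OF T \<delta>] obtain C1 where C1: "0 \<le> C1"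
    and sup1: "\<And>\<epsilon>. \<epsilon> \<in> {0<..1} \<Longrightarrow> sup_sq_le M {0..T} (\<lambda>t \<omega>. crossing \<epsilon> t \<omega> - occupation \<epsilon> t \<omega>) (C1 * \<epsilon> powr \<delta>)"
    by blast
  from sup_occupation[OF lt T \<delta>] obtain C2 where C2: "0 \<le> C2"
    and sup2: "\<And>\<epsilon>. \<epsilon> \<in> {0<..1} \<Longrightarrow> sup_sq_le M {0..T} (\<lambda>t \<omega>. occupation \<epsilon> t \<omega> - 1 / 4 * L 0 t \<omega>) (C2 * \<epsilon> powr \<delta>)"
    by blast
  define C3 where "C3 = modulus_const (T + 1)"
  have C3: "0 \<le> C3" unfolding C3_def using T by (intro modulus_const_nonneg) simp
  have "sup_sq_le M {0..T} (\<lambda>t \<omega>. stopped_crossing \<epsilon> t \<omega> - 1 / 4 * L 0 t \<omega>) ((2 * C3 + 2 * (2 * C1 + 2 * C2)) * \<epsilon> powr \<delta>)" if \<epsilon>: "\<epsilon> \<in> {0<..1}" for \<epsilon>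
  proof -
    have e: "0 < \<epsilon>" "\<epsilon> \<le> 1" using \<epsilon> by auto
    have "sqrt \<epsilon> \<le> \<epsilon> powr \<delta>"
      using e \<delta> powr_mono'[of \<delta> "1/2" \<epsilon>] by (simp add: powr_half_sqrt)
    then have sup3: "sup_sq_le M {0..T} (\<lambda>t \<omega>. stopped_crossing \<epsilon> t \<omega> - crossing \<epsilon> t \<omega>) (C3 * \<epsilon> powr \<delta>)"
      using C3 T by (intro sup_sq_le_mono[OF sup_stopped_crossing[OF _ e]]) (auto simp: C3_def[symmetric] intro!: mult_left_mono)
    have "sup_sq_le M {0..T} (\<lambda>t \<omega>. crossing \<epsilon> t \<omega> - 1 / 4 * L 0 t \<omega>) (2 * (C1 * \<epsilon> powr \<delta>) + 2 * (C2 * \<epsilon> powr \<delta>))"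
      by (rule sup_sq_le_add[OF sup1[OF \<epsilon>] sup2[OF \<epsilon>]]) (use C1 C2 in \<open>auto intro!: AE_I2\<close>)
    from sup_sq_le_add[OF sup3 this]
    have "sup_sq_le M {0..T} (\<lambda>t \<omega>. stopped_crossing \<epsilon> t \<omega> - 1 / 4 * L 0 t \<omega>)
        (2 * (C3 * \<epsilon> powr \<delta>) + 2 * (2 * (C1 * \<epsilon> powr \<delta>) + 2 * (C2 * \<epsilon> powr \<delta>)))"
      by (rule meta_mp) (use C1 C2 C3 in \<open>auto intro!: AE_I2\<close>)
    then show ?thesis by (simp add: algebra_simps)
  qed
  then show ?thesis using C1 C2 C3 by (intro exI[of _ "2 * C3 + 2 * (2 * C1 + 2 * C2)"]) auto
qed

end

section \<open>Measurability of the suprema\<close>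

lemma SUP_continuous_eq_SUP_rationals:
  fixes \<phi> :: "real \<Rightarrow> real"
  assumes T: "0 \<le> T" and \<phi>: "continuous_on {0..T} \<phi>"
  shows "(SUP t\<in>{0..T}. ennreal (\<phi> t)) = (SUP q\<in>\<rat>. ennreal (\<phi> (max 0 (min T q))))"
proof (rule antisym)
  define c where "c q = max 0 (min T q)" for q :: real
  have c: "c q \<in> {0..T}" for q using T by (auto simp: c_def)
  show "(SUP q\<in>\<rat>. ennreal (\<phi> (max 0 (min T q)))) \<le> (SUP t\<in>{0..T}. ennreal (\<phi> t))"
    by (rule SUP_least) (rule SUP_upper[OF c, unfolded c_def])
  show "(SUP t\<in>{0..T}. ennreal (\<phi> t)) \<le> (SUP q\<in>\<rat>. ennreal (\<phi> (max 0 (min T q))))"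
  proof (rule SUP_least, rule ccontr)
    fix t assume t: "t \<in> {0..T}"
    let ?s = "SUP q\<in>\<rat>. ennreal (\<phi> (c q))"
    assume "\<not> ennreal (\<phi> t) \<le> (SUP q\<in>\<rat>. ennreal (\<phi> (max 0 (min T q))))"
    then have less: "?s < ennreal (\<phi> (c t))" using t by (simp add: c_def not_le)
    have "continuous_on UNIV (\<lambda>q. \<phi> (c q))"
      by (rule continuous_on_compose2[OF \<phi>]) (use T in \<open>auto simp: c_def intro!: continuous_intros\<close>)
    then have "continuous_on UNIV (\<lambda>q. ennreal (\<phi> (c q)))" by (intro continuous_on_ennreal)
    then have "open ((\<lambda>q. ennreal (\<phi> (c q))) -` {?s<..})"
      by (rule open_vimage[OF open_greaterThan])
    moreover have "t \<in> (\<lambda>q. ennreal (\<phi> (c q))) -` {?s<..}" using less by simp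
    ultimately obtain r where r: "0 < r" "ball t r \<subseteq> (\<lambda>q. ennreal (\<phi> (c q))) -` {?s<..}"
      unfolding open_contains_ball by blast
    from Rats_dense_in_real[of t "t + r"] r(1) obtain q where q': "q \<in> \<rat>" "t < q" "q < t + r" by auto
    then have "q \<in> ball t r" by (simp add: dist_real_def)
    then have q: "q \<in> \<rat>" "q \<in> (\<lambda>q. ennreal (\<phi> (c q))) -` {?s<..}" using r(2) q'(1) by blast+
    have "ennreal (\<phi> (c q)) \<le> ?s" by (rule SUP_upper[OF q(1)])
    then show False using q(2) by (simp add: not_le[symmetric])
  qed
qed

text \<open>A variant of Dini's theorem. If all suprema exceeded \<open>\<sigma> + \<rho>\<close>, the nested compact sets
  where \<open>\<phi> n \<ge> \<sigma> + \<rho>\<close> would have a common point, and there the limit would exceed \<open>\<sigma>\<close>.\<close>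

lemma SUP_decreasing_continuous:
  fixes \<phi> :: "nat \<Rightarrow> real \<Rightarrow> real"
  assumes cont: "\<And>n. continuous_on {0..T} (\<phi> n)"
    and dec: "\<And>t. t \<in> {0..T} \<Longrightarrow> decseq (\<lambda>n. \<phi> n t)"
    and lim: "\<And>t. t \<in> {0..T} \<Longrightarrow> (\<lambda>n. \<phi> n t) \<longlonglongrightarrow> \<psi> t"
  shows "(SUP t\<in>{0..T}. ennreal (\<psi> t)) = (INF n. SUP t\<in>{0..T}. ennreal (\<phi> n t))" (is "?s = ?i")
proof (rule antisym)
  have le: "\<psi> t \<le> \<phi> n t" if "t \<in> {0..T}" for n t
    using decseq_ge[OF dec[OF that] lim[OF that]] .
  show "?s \<le> ?i"
    by (intro INF_greatest SUP_mono) (auto intro!: bexI ennreal_leI le)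
  show "?i \<le> ?s"
  proof (cases ?s)
    case (real \<sigma>)
    have bound: "?i \<le> ennreal (\<sigma> + \<rho>)" if \<rho>: "0 < \<rho>" for \<rho>
    proof -
      define F where "F n = {0..T} \<inter> \<phi> n -` {\<sigma> + \<rho>..}" for n
      have comp: "compact (F n)" for n
      proof -
        have "closed (F n)" unfolding F_def by (rule continuous_closed_preimage[OF cont]) auto
        then have "compact ({0..T} \<inter> F n)" by (rule compact_Int_closed[OF compact_Icc])
        then show ?thesis by (simp add: F_def Int_assoc[symmetric])
      qed
      have "\<exists>n. F n = {}"
      proof (rule ccontr)
        assume "\<not> (\<exists>n. F n = {})"
        moreover have "F n \<subseteq> F m" if "m \<le> n" for m n
          using decseqD[OF dec that] by (force simp: F_def intro: order_trans)
        ultimately have "\<Inter>(range F) \<noteq> {}" by (intro compact_nest comp) auto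
        then obtain t where "\<And>n. t \<in> F n" by auto
        then have t: "t \<in> {0..T}" "\<And>n. \<sigma> + \<rho> \<le> \<phi> n t" by (auto simp: F_def)
        have "\<sigma> + \<rho> \<le> \<psi> t" by (rule LIMSEQ_le_const[OF lim[OF t(1)]]) (use t(2) in auto)
        moreover have "ennreal (\<psi> t) \<le> ennreal \<sigma>"
          unfolding real(2)[symmetric] by (rule SUP_upper[OF t(1)])
        then have "\<psi> t \<le> \<sigma>" using real(1) by (simp add: ennreal_le_iff)
        ultimately show False using \<rho> by simp
      qed
      then obtain n where "F n = {}" by blast
      then have "\<phi> n t \<le> \<sigma> + \<rho>" if "t \<in> {0..T}" for t using that by (fastforce simp: F_def)
      then have "(SUP t\<in>{0..T}. ennreal (\<phi> n t)) \<le> ennreal (\<sigma> + \<rho>)"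
        by (intro SUP_least ennreal_leI)
      then show ?thesis by (rule INF_lower2[OF UNIV_I])
    qed
    have "?i \<le> ennreal \<sigma>"
    proof (rule ennreal_le_epsilon)
      fix \<rho> :: real assume "0 < \<rho>"
      then show "?i \<le> ennreal \<sigma> + ennreal \<rho>" using bound[of \<rho>] real(1) by (simp only: ennreal_plus less_imp_le)
    qed
    then show ?thesis unfolding real(2) .
  next
    case top
    show ?thesis unfolding top by (rule top_greatest)
  qed
qed

lemma SUP_increasing_continuous:
  fixes \<phi> :: "nat \<Rightarrow> real \<Rightarrow> real"
  assumes "\<And>t. t \<in> {0..T} \<Longrightarrow> incseq (\<lambda>n. \<phi> n t)"
    and lim: "\<And>t. t \<in> {0..T} \<Longrightarrow> (\<lambda>n. \<phi> n t) \<longlonglongrightarrow> \<psi> t"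
  shows "(SUP t\<in>{0..T}. ennreal (\<psi> t)) = (SUP n. SUP t\<in>{0..T}. ennreal (\<phi> n t))"
proof -
  have "ennreal (\<psi> t) = (SUP n. ennreal (\<phi> n t))" if "t \<in> {0..T}" for t
  proof (rule LIMSEQ_unique)
    show "(\<lambda>n. ennreal (\<phi> n t)) \<longlonglongrightarrow> ennreal (\<psi> t)" by (intro tendsto_ennrealI lim that)
    show "(\<lambda>n. ennreal (\<phi> n t)) \<longlonglongrightarrow> (SUP n. ennreal (\<phi> n t))"
      using assms(1)[OF that] by (intro LIMSEQ_SUP) (auto simp: incseq_def intro: ennreal_leI)
  qed
  then have "(SUP t\<in>{0..T}. ennreal (\<psi> t)) = (SUP t\<in>{0..T}. SUP n. ennreal (\<phi> n t))"
    by (intro SUP_cong) auto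
  also have "\<dots> = (SUP n. SUP t\<in>{0..T}. ennreal (\<phi> n t))" by (rule SUP_commute)
  finally show ?thesis .
qed

lemma borel_measurable_SUP_continuous:
  fixes \<phi> :: "real \<Rightarrow> 'a \<Rightarrow> real"
  assumes T: "0 \<le> T" and cont: "\<And>\<omega>. \<omega> \<in> space M \<Longrightarrow> continuous_on {0..T} (\<lambda>t. \<phi> t \<omega>)"
    and meas: "\<And>t. t \<in> {0..T} \<Longrightarrow> \<phi> t \<in> borel_measurable M"
  shows "(\<lambda>\<omega>. SUP t\<in>{0..T}. ennreal (\<phi> t \<omega>)) \<in> borel_measurable M"
proof -
  have "(\<lambda>\<omega>. SUP q\<in>\<rat>. ennreal (\<phi> (max 0 (min T q)) \<omega>)) \<in> borel_measurable M"
  proof (rule borel_measurable_SUP)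
    show "countable (\<rat> :: real set)" by (rule countable_rat)
    show "(\<lambda>\<omega>. ennreal (\<phi> (max 0 (min T q)) \<omega>)) \<in> borel_measurable M" for q
      by (rule measurable_compose[OF meas measurable_ennreal]) (use T in auto)
  qed
  then show ?thesis
    by (rule measurable_cong[THEN iffD1, rotated]) (simp add: SUP_continuous_eq_SUP_rationals[OF T cont])
qed

text \<open>The absolute value is the larger of \<open>I - Z\<close>, an increasing limit of continuous processes, and
  \<open>Z - I\<close>, a decreasing one. In both cases the supremum over the compact interval commutes with
  the limit, and the supremum of a continuous function may be taken over the
  rationals.\<close>

lemma sup_dist_measurable:
  fixes I :: "real \<Rightarrow> 'a \<Rightarrow> real" and J :: "nat \<Rightarrow> real \<Rightarrow> 'a \<Rightarrow> real"
  assumes T: "0 \<le> T"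
    and J: "\<And>n \<omega>. \<omega> \<in> space M \<Longrightarrow> continuous_on {0..T} (\<lambda>t. J n t \<omega>)" "\<And>n t. t \<in> {0..T} \<Longrightarrow> J n t \<in> borel_measurable M"
    and inc: "\<And>\<omega> t. \<omega> \<in> space M \<Longrightarrow> t \<in> {0..T} \<Longrightarrow> incseq (\<lambda>n. J n t \<omega>)"
    and lim: "\<And>\<omega> t. \<omega> \<in> space M \<Longrightarrow> t \<in> {0..T} \<Longrightarrow> (\<lambda>n. J n t \<omega>) \<longlonglongrightarrow> I t \<omega>"
    and Z: "\<And>\<omega>. \<omega> \<in> space M \<Longrightarrow> continuous_on {0..T} (\<lambda>t. Z t \<omega>)" "\<And>t. t \<in> {0..T} \<Longrightarrow> Z t \<in> borel_measurable M"
  shows "sup_dist T I Z \<in> borel_measurable M"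
proof -
  define V where "V \<omega> = sup (SUP n. SUP t\<in>{0..T}. ennreal (J n t \<omega> - Z t \<omega>)) (INF n. SUP t\<in>{0..T}. ennreal (Z t \<omega> - J n t \<omega>))" for \<omega>
  have "V \<in> borel_measurable M"
    unfolding V_def sup_max
    by (intro borel_measurable_max borel_measurable_SUP borel_measurable_INF borel_measurable_SUP_continuous[OF T]
        continuous_on_diff J Z borel_measurable_diff) auto
  moreover have "sup_dist T I Z \<omega> = V \<omega>" if \<omega>: "\<omega> \<in> space M" for \<omega>
  proof -
    have split: "ennreal \<bar>x\<bar> = sup (ennreal x) (ennreal (- x))" for x :: real
      by (cases "0 \<le> x") (auto simp: ennreal_neg sup_max max_def)
    have "sup_dist T I Z \<omega> = (SUP t\<in>{0..T}. sup (ennreal (I t \<omega> - Z t \<omega>)) (ennreal (Z t \<omega> - I t \<omega>)))"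
      unfolding sup_dist_def split by simp
    also have "\<dots> = sup (SUP t\<in>{0..T}. ennreal (I t \<omega> - Z t \<omega>)) (SUP t\<in>{0..T}. ennreal (Z t \<omega> - I t \<omega>))"
      by (rule SUP_sup_distrib[symmetric]) (use T in auto)
    also have "(SUP t\<in>{0..T}. ennreal (I t \<omega> - Z t \<omega>)) = (SUP n. SUP t\<in>{0..T}. ennreal (J n t \<omega> - Z t \<omega>))"
      using inc[OF \<omega>] lim[OF \<omega>]
      by (intro SUP_increasing_continuous tendsto_diff tendsto_const) (auto simp: incseq_def)
    also have "(SUP t\<in>{0..T}. ennreal (Z t \<omega> - I t \<omega>)) = (INF n. SUP t\<in>{0..T}. ennreal (Z t \<omega> - J n t \<omega>))"
      using inc[OF \<omega>] lim[OF \<omega>]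
      by (intro SUP_decreasing_continuous tendsto_diff tendsto_const continuous_on_diff J Z \<omega>) (auto simp: incseq_def decseq_def)
    finally show ?thesis unfolding V_def .
  qed
  ultimately show ?thesis by (subst measurable_cong[where g = V]) auto
qed

context brownian_crossing
begin

text \<open>The upper limit of integration and the stopping time both move with \<open>t\<close>; dominated convergence
  handles them together, except at \<open>u = t\<close>, where the indicator may jump.\<close>

lemma continuous_on_stopped_integral:
  assumes \<omega>: "\<omega> \<in> space M" and g: "continuous_on UNIV (g :: real \<times> real \<Rightarrow> real)"
    and le: "\<And>p. \<bar>g p\<bar> \<le> \<bar>snd p - fst p\<bar>" and T: "0 \<le> T" and e: "0 < \<epsilon>"
  shows "continuous_on {0..T} (\<lambda>t. LINT u:{0..t}|lborel. g (path u \<omega>, path (min (u + \<epsilon>) t) \<omega>))"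
  unfolding continuous_on_sequentially
proof (intro allI ballI impI, elim conjE)
  fix x :: "nat \<Rightarrow> real" and t assume t: "t \<in> {0..T}" and x: "\<forall>n. x n \<in> {0..T}" "x \<longlonglongrightarrow> t"
  have [measurable]: "g \<in> borel_measurable borel" by (rule borel_measurable_continuous_onI[OF g])
  have [measurable]: "(\<lambda>u. path u \<omega>) \<in> borel_measurable borel" "(\<lambda>u. path (min (u + \<epsilon>) s) \<omega>) \<in> borel_measurable borel" for s
    using \<omega> by measurable
  have gm[measurable]: "(\<lambda>u. g (path u \<omega>, path (min (u + \<epsilon>) s) \<omega>)) \<in> borel_measurable borel" for s
    by (rule measurable_compose[OF borel_measurable_Pair]) measurable
  have "compact ((\<lambda>u. path u \<omega>) ` {0..T})"
    by (intro compact_continuous_image continuous_intros \<omega>) auto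
  then have "bounded ((\<lambda>u. path u \<omega>) ` {0..T})" by (rule compact_imp_bounded)
  then obtain K where "\<forall>y\<in>(\<lambda>u. path u \<omega>) ` {0..T}. norm y \<le> K" unfolding bounded_iff by blast
  then have K: "\<bar>path u \<omega>\<bar> \<le> K" if "0 \<le> u" "u \<le> T" for u using that by auto
  have "(\<lambda>n. \<integral>u. indicator {0..x n} u *\<^sub>R g (path u \<omega>, path (min (u + \<epsilon>) (x n)) \<omega>) \<partial>lborel)
      \<longlonglongrightarrow> (\<integral>u. indicator {0..t} u *\<^sub>R g (path u \<omega>, path (min (u + \<epsilon>) t) \<omega>) \<partial>lborel)"
  proof (rule integral_dominated_convergence)
    show "integrable lborel (\<lambda>u. indicator {0..T} u * (2 * K))"
      by (intro integrable_mult_left integrable_real_indicator) (auto simp: T)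
    show "AE u in lborel. norm (indicator {0..x n} u *\<^sub>R g (path u \<omega>, path (min (u + \<epsilon>) (x n)) \<omega>)) \<le> indicator {0..T} u * (2 * K)" for n
    proof (intro AE_I2)
      fix u
      show "norm (indicator {0..x n} u *\<^sub>R g (path u \<omega>, path (min (u + \<epsilon>) (x n)) \<omega>)) \<le> indicator {0..T} u * (2 * K)"
      proof (cases "u \<in> {0..x n}")
        case True
        have xn: "0 \<le> x n" "x n \<le> T" using x(1) by auto
        have "\<bar>g (path u \<omega>, path (min (u + \<epsilon>) (x n)) \<omega>)\<bar> \<le> \<bar>path (min (u + \<epsilon>) (x n)) \<omega> - path u \<omega>\<bar>"
          using le[of "(path u \<omega>, path (min (u + \<epsilon>) (x n)) \<omega>)"] by simp
        also have "\<dots> \<le> 2 * K"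
        proof -
          have "0 \<le> min (u + \<epsilon>) (x n)" "min (u + \<epsilon>) (x n) \<le> T" "0 \<le> u" "u \<le> T" using True xn e by auto
          then show ?thesis using K[of u] K[of "min (u + \<epsilon>) (x n)"] by linarith
        qed
        finally show ?thesis using True xn by (auto simp: indicator_def)
      next
        case False
        have "0 \<le> K" using K[of 0] T by (simp add: order_trans[OF abs_ge_zero])
        then show ?thesis using False by simp
      qed
    qed
    show "AE u in lborel. (\<lambda>n. indicator {0..x n} u *\<^sub>R g (path u \<omega>, path (min (u + \<epsilon>) (x n)) \<omega>))
        \<longlonglongrightarrow> indicator {0..t} u *\<^sub>R g (path u \<omega>, path (min (u + \<epsilon>) t) \<omega>)"
      using AE_lborel_singleton[of t]
    proof eventually_elim
      case (elim u)
      have "(\<lambda>n. indicator {0..x n} u :: real) \<longlonglongrightarrow> indicator {0..t} u"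
      proof (cases "u < t")
        case True
        then have "\<forall>\<^sub>F n in sequentially. u < x n" by (rule order_tendstoD(1)[OF x(2)])
        then have "\<forall>\<^sub>F n in sequentially. (indicator {0..x n} u :: real) = indicator {0..t} u"
          by eventually_elim (use True in \<open>auto simp: indicator_def\<close>)
        then show ?thesis by (rule tendsto_eventually)
      next
        case False
        then have "t < u" using elim by simp
        then have "\<forall>\<^sub>F n in sequentially. x n < u" by (rule order_tendstoD(2)[OF x(2)])
        then have "\<forall>\<^sub>F n in sequentially. (indicator {0..x n} u :: real) = indicator {0..t} u"
          by eventually_elim (use \<open>t < u\<close> in \<open>auto simp: indicator_def\<close>)
        then show ?thesis by (rule tendsto_eventually)
      qed
      moreover have "(\<lambda>n. path (min (u + \<epsilon>) (x n)) \<omega>) \<longlonglongrightarrow> path (min (u + \<epsilon>) t) \<omega>"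
        by (rule continuous_on_tendsto_compose[OF path_continuous[OF \<omega>]]) (auto intro!: tendsto_min x(2))
      then have "(\<lambda>n. g (path u \<omega>, path (min (u + \<epsilon>) (x n)) \<omega>)) \<longlonglongrightarrow> g (path u \<omega>, path (min (u + \<epsilon>) t) \<omega>)"
        by (intro continuous_on_tendsto_compose[OF g] tendsto_Pair tendsto_const) auto
      ultimately show ?case by (rule tendsto_scaleR)
    qed
  qed measurable
  then show "((\<lambda>t. LINT u:{0..t}|lborel. g (path u \<omega>, path (min (u + \<epsilon>) t) \<omega>)) \<circ> x) \<longlonglongrightarrow> (LINT u:{0..t}|lborel. g (path u \<omega>, path (min (u + \<epsilon>) t) \<omega>))"
    by (simp add: comp_def set_lebesgue_integral_def)
qed

lemma sup_dist_stopped_crossing_measurable: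
  assumes lt: "local_time_family M X L" and T: "0 < T" and e: "0 < \<epsilon>"
  shows "sup_dist T (stopped_crossing \<epsilon>) (\<lambda>t \<omega>. 1 / 4 * L 0 t \<omega>) \<in> borel_measurable M"
proof -
  from f_lsc obtain g :: "nat \<Rightarrow> real \<times> real \<Rightarrow> real" where g: "\<And>n. continuous_on UNIV (g n)" "\<And>n p. 0 \<le> g n p"
    "\<And>p. incseq (\<lambda>n. g n p)" "\<And>p. (\<lambda>n. g n p) \<longlonglongrightarrow> f (fst p) (snd p)" by blast
  have gf: "g n p \<le> f (fst p) (snd p)" for n p using incseq_le[OF g(3,4)] .
  have gle: "\<bar>g n p\<bar> \<le> \<bar>snd p - fst p\<bar>" for n p
    using gf[of n p] g(2)[of n p] f_le[of "fst p" "snd p"] by linarith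
  have gm[measurable]: "g n \<in> borel_measurable borel" for n by (rule borel_measurable_continuous_onI[OF g(1)])
  define J where "J n t \<omega> = 1 / \<epsilon> * (LINT u:{0..t}|lborel. g n (path u \<omega>, path (min (u + \<epsilon>) t) \<omega>))" for n t \<omega>
  show ?thesis
  proof (rule sup_dist_measurable[where J = J])
    fix n \<omega> assume \<omega>: "\<omega> \<in> space M"
    show "continuous_on {0..T} (\<lambda>t. J n t \<omega>)"
      unfolding J_def by (intro continuous_on_mult continuous_on_const continuous_on_stopped_integral \<omega> g(1) gle e) (use T in simp)
  next
    fix n t
    have "(\<lambda>x. g n (path (snd x) (fst x), path (min (snd x + \<epsilon>) t) (fst x))) \<in> borel_measurable (M \<Otimes>\<^sub>M lborel)"
      by (rule measurable_compose[OF borel_measurable_Pair gm]) measurable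
    then have [measurable]: "(\<lambda>(\<omega>, u). g n (path u \<omega>, path (min (u + \<epsilon>) t) \<omega>)) \<in> borel_measurable (M \<Otimes>\<^sub>M lborel)"
      by (simp add: case_prod_beta)
    show "J n t \<in> borel_measurable M" unfolding J_def set_lebesgue_integral_def by measurable
  next
    fix \<omega> t assume \<omega>: "\<omega> \<in> space M" and t: "t \<in> {0..T}"
    have [measurable]: "(\<lambda>u. path u \<omega>) \<in> borel_measurable borel" "(\<lambda>u. path (min (u + \<epsilon>) t) \<omega>) \<in> borel_measurable borel"
      using \<omega> by measurable
    have [measurable]: "(\<lambda>u. g n (path u \<omega>, path (min (u + \<epsilon>) t) \<omega>)) \<in> borel_measurable borel" for n
      by (rule measurable_compose[OF borel_measurable_Pair gm]) measurable
    have fint: "integrable lborel (\<lambda>u. indicator {0..t} u *\<^sub>R f (path u \<omega>) (path (min (u + \<epsilon>) t) \<omega>))"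
      using integrable_f_path[OF \<omega>, of "\<lambda>u. min (u + \<epsilon>) t"] by (simp add: set_integrable_def continuous_intros)
    have gint: "integrable lborel (\<lambda>u. indicator {0..t} u *\<^sub>R g n (path u \<omega>, path (min (u + \<epsilon>) t) \<omega>))" for n
      by (rule Bochner_Integration.integrable_bound[OF fint])
        (use gf g(2) f_nonneg in \<open>auto simp: indicator_def\<close>)
    show "incseq (\<lambda>n. J n t \<omega>)"
      unfolding J_def set_lebesgue_integral_def
    proof (intro incseq_SucI mult_left_mono integral_mono gint)
      fix n u
      show "indicator {0..t} u *\<^sub>R g n (path u \<omega>, path (min (u + \<epsilon>) t) \<omega>) \<le> indicator {0..t} u *\<^sub>R g (Suc n) (path u \<omega>, path (min (u + \<epsilon>) t) \<omega>)"
        using incseq_SucD[OF g(3)] by (auto simp: indicator_def)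
    qed (use e in simp)
    show "(\<lambda>n. J n t \<omega>) \<longlonglongrightarrow> stopped_crossing \<epsilon> t \<omega>"
      unfolding J_def stopped_crossing_def set_lebesgue_integral_def
    proof (intro tendsto_mult tendsto_const integral_dominated_convergence[OF _ _ fint])
      show "AE u in lborel. (\<lambda>n. indicator {0..t} u *\<^sub>R g n (path u \<omega>, path (min (u + \<epsilon>) t) \<omega>)) \<longlonglongrightarrow> indicator {0..t} u *\<^sub>R f (path u \<omega>) (path (min (u + \<epsilon>) t) \<omega>)"
      proof (intro AE_I2 tendsto_scaleR tendsto_const)
        fix u
        show "(\<lambda>n. g n (path u \<omega>, path (min (u + \<epsilon>) t) \<omega>)) \<longlonglongrightarrow> f (path u \<omega>) (path (min (u + \<epsilon>) t) \<omega>)"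
          using g(4)[of "(path u \<omega>, path (min (u + \<epsilon>) t) \<omega>)"] by simp
      qed
      show "AE u in lborel. norm (indicator {0..t} u *\<^sub>R g n (path u \<omega>, path (min (u + \<epsilon>) t) \<omega>)) \<le> indicator {0..t} u *\<^sub>R f (path u \<omega>) (path (min (u + \<epsilon>) t) \<omega>)" for n
        using gf[of n "(_, _)"] g(2) by (auto simp: indicator_def)
    qed measurable
  next
    fix \<omega> assume \<omega>: "\<omega> \<in> space M"
    have "continuous_on (UNIV \<times> {0..}) (\<lambda>(x, t). L x t \<omega>)"
      using lt \<omega> unfolding local_time_family_def by blast
    then have "continuous_on {0..T} (\<lambda>t. (\<lambda>(x, t). L x t \<omega>) (0, t))"
      by (rule continuous_on_compose2) (auto intro!: continuous_intros)
    then show "continuous_on {0..T} (\<lambda>t. 1 / 4 * L 0 t \<omega>)" by (auto intro!: continuous_intros)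
  next
    fix t assume "t \<in> {0..T}"
    then have [measurable]: "L 0 t \<in> borel_measurable M" using lt unfolding local_time_family_def by simp
    show "(\<lambda>\<omega>. 1 / 4 * L 0 t \<omega>) \<in> borel_measurable M" by measurable
  qed (use T in simp)
qed

end

section \<open>From suprema to the two modes of convergence\<close>

lemma nn_integral_sup_dist_square_le:
  assumes "sup_sq_le M {0..T} (\<lambda>t \<omega>. Y t \<omega> - Z t \<omega>) c"
  shows "(\<integral>\<^sup>+ \<omega>. (sup_dist T Y Z \<omega>)\<^sup>2 \<partial>M) \<le> ennreal c"
proof -
  from assms obtain U where U: "U \<in> borel_measurable M" "AE \<omega> in M. \<forall>t\<in>{0..T}. ennreal ((Y t \<omega> - Z t \<omega>)\<^sup>2) \<le> U \<omega>"
    "(\<integral>\<^sup>+ \<omega>. U \<omega> \<partial>M) \<le> ennreal c" by (rule sup_sq_leE)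
  have "(\<integral>\<^sup>+ \<omega>. (sup_dist T Y Z \<omega>)\<^sup>2 \<partial>M) \<le> (\<integral>\<^sup>+ \<omega>. U \<omega> \<partial>M)"
  proof (rule nn_integral_mono_AE, use U(2) in eventually_elim)
    case (elim \<omega>)
    show "(sup_dist T Y Z \<omega>)\<^sup>2 \<le> U \<omega>"
    proof (cases "U \<omega>")
      case (real r)
      have "sup_dist T Y Z \<omega> \<le> ennreal (sqrt r)"
        unfolding sup_dist_def
      proof (rule SUP_least)
        fix t assume "t \<in> {0..T}"
        then have "ennreal ((Y t \<omega> - Z t \<omega>)\<^sup>2) \<le> ennreal r" using elim real by simp
        then have "\<bar>Y t \<omega> - Z t \<omega>\<bar>\<^sup>2 \<le> r" using real(1) by (simp add: ennreal_le_iff)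
        then show "ennreal \<bar>Y t \<omega> - Z t \<omega>\<bar> \<le> ennreal (sqrt r)" by (intro ennreal_leI real_le_rsqrt)
      qed
      then have "(sup_dist T Y Z \<omega>)\<^sup>2 \<le> (ennreal (sqrt r))\<^sup>2" by (intro power_mono) auto
      also have "\<dots> = ennreal r" using real(1) by (simp add: ennreal_power)
      finally show ?thesis using real by simp
    qed simp
  qed
  then show ?thesis using U(3) by simp
qed

lemma L2_norm_le_of_sup_sq_le:
  assumes "sup_sq_le M {0..T} (\<lambda>t \<omega>. Y t \<omega> - Z t \<omega>) (c\<^sup>2)" "0 \<le> c" "sup_dist T Y Z \<in> borel_measurable M"
  shows "L2_norm_le M (sup_dist T Y Z) c"
proof -
  define p where "p = (\<integral>\<^sup>+ \<omega>. (sup_dist T Y Z \<omega>)\<^sup>2 \<partial>M)"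
  have p: "p \<le> ennreal (c\<^sup>2)" unfolding p_def by (rule nn_integral_sup_dist_square_le[OF assms(1)])
  then have fin: "p \<noteq> \<top>" by (auto simp: top_unique)
  have "enn2real p \<le> c\<^sup>2" using p by (rule enn2real_leI[rotated]) simp
  then have "sqrt (enn2real p) \<le> c" using assms(2) by (intro real_le_lsqrt) auto
  then have "L2_norm M (sup_dist T Y Z) \<le> ennreal c"
    unfolding L2_norm_def p_def[symmetric] Let_def using fin by (simp add: ennreal_leI)
  then show ?thesis unfolding L2_norm_le_def using assms(3) by blast
qed

lemma (in prob_space) prob_sup_dist_le:
  assumes Y: "sup_sq_le M {0..T} (\<lambda>t \<omega>. Y t \<omega> - Z t \<omega>) c" "0 \<le> c" and [measurable]: "sup_dist T Y Z \<in> borel_measurable M"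
    and \<eta>: "0 < \<eta>"
  shows "measure M {\<omega> \<in> space M. ennreal \<eta> < sup_dist T Y Z \<omega>} \<le> c / \<eta>\<^sup>2"
proof -
  let ?S = "sup_dist T Y Z"
  have "emeasure M {\<omega> \<in> space M. ennreal \<eta> < ?S \<omega>} \<le> emeasure M {\<omega> \<in> space M. 1 \<le> ennreal (1 / \<eta>\<^sup>2) * (?S \<omega>)\<^sup>2}"
  proof (rule emeasure_mono)
    show "{\<omega> \<in> space M. ennreal \<eta> < ?S \<omega>} \<subseteq> {\<omega> \<in> space M. 1 \<le> ennreal (1 / \<eta>\<^sup>2) * (?S \<omega>)\<^sup>2}"
    proof safe
      fix \<omega> assume "ennreal \<eta> < ?S \<omega>"
      then have "(ennreal \<eta>)\<^sup>2 \<le> (?S \<omega>)\<^sup>2" by (intro power_mono) auto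
      then have "ennreal (1 / \<eta>\<^sup>2) * (ennreal \<eta>)\<^sup>2 \<le> ennreal (1 / \<eta>\<^sup>2) * (?S \<omega>)\<^sup>2" by (intro mult_left_mono) auto
      moreover have "ennreal (1 / \<eta>\<^sup>2) * (ennreal \<eta>)\<^sup>2 = ennreal (1 / \<eta>\<^sup>2 * \<eta>\<^sup>2)"
        using \<eta> by (subst ennreal_mult) (auto simp: ennreal_power)
      ultimately show "1 \<le> ennreal (1 / \<eta>\<^sup>2) * (?S \<omega>)\<^sup>2" using \<eta> by simp
    qed
  qed measurable
  also have "\<dots> \<le> ennreal (1 / \<eta>\<^sup>2) * (\<integral>\<^sup>+ \<omega>. (?S \<omega>)\<^sup>2 * indicator (space M) \<omega> \<partial>M)"
    by (rule nn_integral_Markov_inequality) auto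
  also have "(\<integral>\<^sup>+ \<omega>. (?S \<omega>)\<^sup>2 * indicator (space M) \<omega> \<partial>M) = (\<integral>\<^sup>+ \<omega>. (?S \<omega>)\<^sup>2 \<partial>M)"
    by (intro nn_integral_cong) simp
  also have "ennreal (1 / \<eta>\<^sup>2) * (\<integral>\<^sup>+ \<omega>. (?S \<omega>)\<^sup>2 \<partial>M) \<le> ennreal (1 / \<eta>\<^sup>2) * ennreal c"
    by (intro mult_left_mono nn_integral_sup_dist_square_le[OF Y(1)]) auto
  also have "\<dots> = ennreal (1 / \<eta>\<^sup>2 * c)" using Y(2) by (intro ennreal_mult[symmetric]) auto
  finally have "ennreal (measure M {\<omega> \<in> space M. ennreal \<eta> < ?S \<omega>}) \<le> ennreal (1 / \<eta>\<^sup>2 * c)"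
    by (simp add: emeasure_eq_measure)
  then show ?thesis using Y(2) by (subst (asm) ennreal_le_iff) auto
qed

context brownian_crossing
begin

lemma stopped_crossing_L2_rate:
  assumes lt: "local_time_family M X L" and T: "0 < T" and \<delta>: "0 < \<delta>" "\<delta> < 1 / 2"
  shows "\<exists>C. \<forall>\<epsilon>\<in>{0<..1}. L2_norm_le M (sup_dist T (stopped_crossing \<epsilon>) (\<lambda>t \<omega>. 1 / 4 * L 0 t \<omega>)) (C * \<epsilon> powr (\<delta> / 2))"
proof -
  from sup_stopped_crossing_local_time[OF assms] obtain C where C: "0 \<le> C"
    and sup: "\<And>\<epsilon>. \<epsilon> \<in> {0<..1} \<Longrightarrow> sup_sq_le M {0..T} (\<lambda>t \<omega>. stopped_crossing \<epsilon> t \<omega> - 1 / 4 * L 0 t \<omega>) (C * \<epsilon> powr \<delta>)"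
    by blast
  have "L2_norm_le M (sup_dist T (stopped_crossing \<epsilon>) (\<lambda>t \<omega>. 1 / 4 * L 0 t \<omega>)) (sqrt C * \<epsilon> powr (\<delta> / 2))" if \<epsilon>: "\<epsilon> \<in> {0<..1}" for \<epsilon>
  proof (rule L2_norm_le_of_sup_sq_le)
    have "(sqrt C * \<epsilon> powr (\<delta> / 2))\<^sup>2 = C * \<epsilon> powr \<delta>"
      using C \<epsilon> by (simp add: power_mult_distrib power2_eq_square[of "\<epsilon> powr _"] powr_add[symmetric])
    then show "sup_sq_le M {0..T} (\<lambda>t \<omega>. stopped_crossing \<epsilon> t \<omega> - 1 / 4 * L 0 t \<omega>) ((sqrt C * \<epsilon> powr (\<delta> / 2))\<^sup>2)"
      using sup[OF \<epsilon>] by simp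
    show "sup_dist T (stopped_crossing \<epsilon>) (\<lambda>t \<omega>. 1 / 4 * L 0 t \<omega>) \<in> borel_measurable M"
      using \<epsilon> by (intro sup_dist_stopped_crossing_measurable[OF lt T]) simp
  qed (use C in simp)
  then show ?thesis by blast
qed

lemma stopped_crossing_ucp:
  assumes lt: "local_time_family M X L"
  shows "ucp_tendsto M stopped_crossing (\<lambda>t \<omega>. 1 / 4 * L 0 t \<omega>) (at_right 0)"
  unfolding ucp_tendsto_def
proof (intro allI impI conjI)
  fix T :: real assume T: "0 < T"
  have ev: "\<forall>\<^sub>F \<epsilon> in at_right 0. \<epsilon> \<in> {0<..1 :: real}"
  proof -
    have "\<forall>\<^sub>F \<epsilon> in at_right 0. \<epsilon> \<in> {0<..<1 :: real}" by (rule eventually_at_right_real) simp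
    then show ?thesis by eventually_elim auto
  qed
  then show "\<forall>\<^sub>F \<epsilon> in at_right 0. sup_dist T (stopped_crossing \<epsilon>) (\<lambda>t \<omega>. 1 / 4 * L 0 t \<omega>) \<in> borel_measurable M"
  proof eventually_elim
    case (elim \<epsilon>)
    then have "0 < \<epsilon>" by simp
    then show ?case by (rule sup_dist_stopped_crossing_measurable[OF lt T])
  qed
  fix \<eta> :: real assume \<eta>: "0 < \<eta>"
  from sup_stopped_crossing_local_time[OF lt T, of "1 / 4"] obtain C where C: "0 \<le> C"
    and sup: "\<And>\<epsilon>. \<epsilon> \<in> {0<..1} \<Longrightarrow> sup_sq_le M {0..T} (\<lambda>t \<omega>. stopped_crossing \<epsilon> t \<omega> - 1 / 4 * L 0 t \<omega>) (C * \<epsilon> powr (1 / 4))"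
    by auto
  show "((\<lambda>\<epsilon>. measure M {\<omega> \<in> space M. ennreal \<eta> < sup_dist T (stopped_crossing \<epsilon>) (\<lambda>t \<omega>. 1 / 4 * L 0 t \<omega>) \<omega>}) \<longlongrightarrow> 0) (at_right 0)"
  proof (rule tendsto_sandwich[of "\<lambda>_. 0" _ _ "\<lambda>\<epsilon>. C * \<epsilon> powr (1 / 4) / \<eta>\<^sup>2"])
    show "\<forall>\<^sub>F \<epsilon> in at_right 0. measure M {\<omega> \<in> space M. ennreal \<eta> < sup_dist T (stopped_crossing \<epsilon>) (\<lambda>t \<omega>. 1 / 4 * L 0 t \<omega>) \<omega>} \<le> C * \<epsilon> powr (1 / 4) / \<eta>\<^sup>2"
      using ev
    proof eventually_elim
      case (elim \<epsilon>)
      show ?case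
        using elim C by (intro prob_sup_dist_le sup \<eta> sup_dist_stopped_crossing_measurable[OF lt T]) auto
    qed
    have "((\<lambda>\<epsilon>. \<epsilon> powr (1 / 4)) \<longlongrightarrow> 0 powr (1 / 4)) (at_right (0 :: real))"
      by (rule tendsto_powr'[OF tendsto_ident_at tendsto_const]) (auto simp: eventually_at_right_less intro: eventually_mono[OF eventually_at_right_less])
    then have "((\<lambda>\<epsilon>. C * \<epsilon> powr (1 / 4) / \<eta>\<^sup>2) \<longlongrightarrow> C * 0 / \<eta>\<^sup>2) (at_right (0 :: real))"
      using \<eta> by (intro tendsto_intros) auto
    then show "((\<lambda>\<epsilon>. C * \<epsilon> powr (1 / 4) / \<eta>\<^sup>2) \<longlongrightarrow> 0) (at_right (0 :: real))" by simp
  qed simp_all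
qed

end

section \<open>The four crossing functionals\<close>

lemma nn_integral_triangle:
  assumes "0 \<le> z" shows "(\<integral>\<^sup>+ x. ennreal x * indicator {0..z} x \<partial>lborel) = ennreal (z\<^sup>2 / 2)"
proof -
  have "((\<lambda>x. x) has_integral (z\<^sup>2 / 2 - 0\<^sup>2 / 2)) {0..z}"
  proof (rule fundamental_theorem_of_calculus[OF assms])
    fix x :: real
    show "((\<lambda>x. x\<^sup>2 / 2) has_vector_derivative x) (at x within {0..z})"
      unfolding has_real_derivative_iff_has_vector_derivative[symmetric]
      by (auto intro!: derivative_eq_intros)
  qed
  then have h: "((\<lambda>x. x) has_integral (z\<^sup>2 / 2)) {0..z}" by simp
  have "((\<lambda>x. if 0 \<le> x then x else 0) has_integral (z\<^sup>2 / 2)) {0..z}"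
    by (rule has_integral_eq[OF _ h]) simp
  from nn_integral_has_integral_lebesgue[OF _ this]
  have "(\<integral>\<^sup>+ x. ennreal (indicator {0..z} x * (if 0 \<le> x then x else 0)) \<partial>lborel) = ennreal (z\<^sup>2 / 2)" by simp
  also have "(\<integral>\<^sup>+ x. ennreal (indicator {0..z} x * (if 0 \<le> x then x else 0)) \<partial>lborel) = (\<integral>\<^sup>+ x. ennreal x * indicator {0..z} x \<partial>lborel)"
    by (intro nn_integral_cong) (auto simp: indicator_def)
  finally show ?thesis .
qed

text \<open>The indicator of an open half-line as an increasing limit of continuous functions.\<close>

lemma tendsto_min_mult_indicator:
  "(\<lambda>n. min 1 (real n * max y 0)) \<longlonglongrightarrow> indicator {0<..} (y :: real)"
proof (cases "0 < y")
  case True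
  obtain N where N: "1 < real N * y" using reals_Archimedean3[OF True] by blast
  have "\<forall>\<^sub>F n in sequentially. min 1 (real n * max y 0) = indicator {0<..} y"
    unfolding eventually_sequentially
  proof (intro exI[of _ N] allI impI)
    fix n assume "N \<le> n"
    then have "real N * y \<le> real n * y" using True by (intro mult_right_mono) auto
    then have "1 \<le> real n * y" using N by linarith
    then show "min 1 (real n * max y 0) = indicator {0<..} y" using True by simp
  qed
  then show ?thesis by (rule tendsto_eventually)
qed (auto simp: max_def)

lemma crossing_functional_reflect:
  assumes "crossing_functional f" shows "crossing_functional (\<lambda>x y. f (- x) (- y))"
proof -
  interpret crossing_functional f by fact
  show ?thesis
  proof
    show "(\<lambda>(x, y). f (- x) (- y)) \<in> borel_measurable (borel \<Otimes>\<^sub>M borel)"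
      unfolding case_prod_beta by measurable
    show "0 \<le> f (- x) (- y)" for x y by (rule f_nonneg)
    show "f (- x) (- y) \<le> \<bar>y - x\<bar>" for x y using f_le[of "- x" "- y"] by linarith
    show "f (- x) (- y) \<noteq> 0 \<Longrightarrow> \<bar>x\<bar> \<le> \<bar>y - x\<bar>" for x y using f_support[of "- x" "- y"] by linarith
    have refl: "(\<integral>\<^sup>+ x. ennreal (f (- x) (- (x + z))) \<partial>lborel) = (\<integral>\<^sup>+ x. ennreal (f x (x - z)) \<partial>lborel)" for z
    proof -
      have "(\<integral>\<^sup>+ x. ennreal (f x (x - z)) \<partial>lborel) = ennreal \<bar>-1\<bar> * (\<integral>\<^sup>+ x. ennreal (f (0 + -1 * x) ((0 + -1 * x) - z)) \<partial>lborel)"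
        by (rule nn_integral_real_affine) auto
      then show ?thesis by simp
    qed
    show "(\<integral>\<^sup>+ x. ennreal (f (- x) (- (x + z))) \<partial>lborel) + (\<integral>\<^sup>+ x. ennreal (f (- x) (- (x - z))) \<partial>lborel) = ennreal (z\<^sup>2 / 2)" for z
      using refl[of z] refl[of "- z"] f_mass[of z] by (simp add: add.commute)
    from f_lsc obtain g :: "nat \<Rightarrow> real \<times> real \<Rightarrow> real" where g: "\<And>n. continuous_on UNIV (g n)" "\<And>n p. 0 \<le> g n p"
      "\<And>p. incseq (\<lambda>n. g n p)" "\<And>p. (\<lambda>n. g n p) \<longlonglongrightarrow> f (fst p) (snd p)" by blast
    have "continuous_on UNIV (\<lambda>p. g n (- p))" for n
      by (rule continuous_on_compose2[OF g(1)]) (auto intro!: continuous_intros)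
    moreover have "(\<lambda>n. g n (- p)) \<longlonglongrightarrow> f (- fst p) (- snd p)" for p using g(4)[of "- p"] by simp
    ultimately show "\<exists>g :: nat \<Rightarrow> real \<times> real \<Rightarrow> real. (\<forall>n. continuous_on UNIV (g n)) \<and> (\<forall>n p. 0 \<le> g n p) \<and>
      (\<forall>p. incseq (\<lambda>n. g n p)) \<and> (\<forall>p. (\<lambda>n. g n p) \<longlonglongrightarrow> f (- fst p) (- snd p))"
      using g(2,3) by (intro exI[of _ "\<lambda>n p. g n (- p)"]) auto
  qed
qed

lemma crossing_functionalI:
  fixes f :: "real \<Rightarrow> real \<Rightarrow> real"
  assumes "(\<lambda>(x, y). f x y) \<in> borel_measurable (borel \<Otimes>\<^sub>M borel)"
    and "\<And>x y. 0 \<le> f x y" "\<And>x y. f x y \<le> \<bar>y - x\<bar>" "\<And>x y. f x y \<noteq> 0 \<Longrightarrow> \<bar>x\<bar> \<le> \<bar>y - x\<bar>"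
    and mass: "\<And>z. 0 \<le> z \<Longrightarrow> (\<integral>\<^sup>+ x. ennreal (f x (x + z)) \<partial>lborel) + (\<integral>\<^sup>+ x. ennreal (f x (x - z)) \<partial>lborel) = ennreal (z\<^sup>2 / 2)"
    and "\<And>n. continuous_on UNIV (g n)" "\<And>n p. 0 \<le> g n p" "\<And>p. incseq (\<lambda>n :: nat. g n p)"
      "\<And>p. (\<lambda>n. g n p) \<longlonglongrightarrow> f (fst p) (snd p)"
  shows "crossing_functional f"
proof
  show "(\<integral>\<^sup>+ x. ennreal (f x (x + z)) \<partial>lborel) + (\<integral>\<^sup>+ x. ennreal (f x (x - z)) \<partial>lborel) = ennreal (z\<^sup>2 / 2)" for z
    using mass[of z] mass[of "- z"] by (cases "0 \<le> z") (auto simp: add.commute)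
qed (use assms in blast)+

text \<open>For an upward increment \<open>z\<close> the path crosses \<open>0\<close> if it starts in the interval from \<open>- z\<close> to \<open>0\<close>, and the
  functional then records the distance of the starting point from \<open>0\<close>; a downward increment
  contributes nothing.\<close>

lemma crossing_functional_I41: "crossing_functional (\<lambda>x y. neg_part x * indicator {0<..} y)"
proof (rule crossing_functionalI[where g = "\<lambda>n p. neg_part (fst p) * min 1 (real n * max (snd p) 0)"])
  have nm: "neg_part \<in> borel_measurable borel" unfolding neg_part_def[abs_def] by measurable
  show "(\<lambda>(x :: real, y :: real). neg_part x * indicator {0<..} y) \<in> borel_measurable (borel \<Otimes>\<^sub>M borel)"
    unfolding case_prod_beta
    by (intro borel_measurable_times measurable_compose[OF measurable_fst nm] measurable_compose[OF measurable_snd borel_measurable_indicator]) auto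
  show "0 \<le> neg_part x * indicator {0<..} (y :: real)" for x y by (simp add: neg_part_def)
  show "neg_part x * indicator {0<..} y \<le> \<bar>y - x\<bar>" for x y by (auto simp: neg_part_def indicator_def)
  show "neg_part x * indicator {0<..} y \<noteq> 0 \<Longrightarrow> \<bar>x\<bar> \<le> \<bar>y - x\<bar>" for x y by (auto simp: neg_part_def indicator_def split: if_splits)
  fix z :: real assume z: "0 \<le> z"
  have "(\<integral>\<^sup>+ x. ennreal (neg_part x * indicator {0<..} (x + z)) \<partial>lborel) = (\<integral>\<^sup>+ x. ennreal (- x) * indicator {0..z} (- x) \<partial>lborel)"
  proof (rule nn_integral_cong_AE, use AE_lborel_singleton[of "- z"] in eventually_elim)
    case (elim x)
    then show ?case by (auto simp: neg_part_def indicator_def max_def)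
  qed
  also have "\<dots> = (\<integral>\<^sup>+ x. ennreal x * indicator {0..z} x \<partial>lborel)"
    by (subst nn_integral_real_affine[of "\<lambda>x. ennreal x * indicator {0..z} x" "-1" 0]) auto
  also have "\<dots> = ennreal (z\<^sup>2 / 2)" by (rule nn_integral_triangle[OF z])
  finally have 1: "(\<integral>\<^sup>+ x. ennreal (neg_part x * indicator {0<..} (x + z)) \<partial>lborel) = ennreal (z\<^sup>2 / 2)" .
  have "(\<lambda>x. ennreal (neg_part x * indicator {0<..} (x - z))) = (\<lambda>x. 0)"
    using z by (auto simp: fun_eq_iff neg_part_def indicator_def)
  with 1 show "(\<integral>\<^sup>+ x. ennreal (neg_part x * indicator {0<..} (x + z)) \<partial>lborel) + (\<integral>\<^sup>+ x. ennreal (neg_part x * indicator {0<..} (x - z)) \<partial>lborel) = ennreal (z\<^sup>2 / 2)"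
    by simp
next
  fix n
  show "continuous_on UNIV (\<lambda>p. neg_part (fst p) * min 1 (real n * max (snd p) 0))"
    unfolding neg_part_def by (intro continuous_intros)
  show "0 \<le> neg_part (fst p) * min 1 (real n * max (snd p) 0)" for p :: "real \<times> real" by (simp add: neg_part_def)
next
  fix p :: "real \<times> real"
  show "incseq (\<lambda>n. neg_part (fst p) * min 1 (real n * max (snd p) 0))"
    by (intro incseq_SucI mult_left_mono min.mono mult_right_mono order_refl) (auto simp: neg_part_def)
  show "(\<lambda>n. neg_part (fst p) * min 1 (real n * max (snd p) 0)) \<longlonglongrightarrow> neg_part (fst p) * indicator {0<..} (snd p)"
    by (intro tendsto_mult tendsto_const tendsto_min_mult_indicator)
qed

text \<open>Here the downward increments contribute, and the functional records how far the path has passed beyond \<open>0\<close>.\<close>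

lemma crossing_functional_I31: "crossing_functional (\<lambda>x y. neg_part y * indicator {0<..} x)"
proof (rule crossing_functionalI[where g = "\<lambda>n p. neg_part (snd p) * min 1 (real n * max (fst p) 0)"])
  have nm: "neg_part \<in> borel_measurable borel" unfolding neg_part_def[abs_def] by measurable
  show "(\<lambda>(x :: real, y :: real). neg_part y * indicator {0<..} x) \<in> borel_measurable (borel \<Otimes>\<^sub>M borel)"
    unfolding case_prod_beta
    by (intro borel_measurable_times measurable_compose[OF measurable_snd nm] measurable_compose[OF measurable_fst borel_measurable_indicator]) auto
  show "0 \<le> neg_part y * indicator {0<..} (x :: real)" for x y by (simp add: neg_part_def)
  show "neg_part y * indicator {0<..} x \<le> \<bar>y - x\<bar>" for x y by (auto simp: neg_part_def indicator_def)
  show "neg_part y * indicator {0<..} x \<noteq> 0 \<Longrightarrow> \<bar>x\<bar> \<le> \<bar>y - x\<bar>" for x y by (auto simp: neg_part_def indicator_def split: if_splits)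
  fix z :: real assume z: "0 \<le> z"
  have "(\<integral>\<^sup>+ x. ennreal (neg_part (x - z) * indicator {0<..} x) \<partial>lborel) = (\<integral>\<^sup>+ x. ennreal (z - x) * indicator {0..z} (z - x) \<partial>lborel)"
  proof (rule nn_integral_cong_AE, use AE_lborel_singleton[of 0] in eventually_elim)
    case (elim x)
    then show ?case by (auto simp: neg_part_def indicator_def max_def)
  qed
  also have "\<dots> = (\<integral>\<^sup>+ x. ennreal x * indicator {0..z} x \<partial>lborel)"
    by (subst nn_integral_real_affine[of "\<lambda>x. ennreal x * indicator {0..z} x" "-1" z]) auto
  also have "\<dots> = ennreal (z\<^sup>2 / 2)" by (rule nn_integral_triangle[OF z])
  finally have 1: "(\<integral>\<^sup>+ x. ennreal (neg_part (x - z) * indicator {0<..} x) \<partial>lborel) = ennreal (z\<^sup>2 / 2)" .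
  have "(\<lambda>x. ennreal (neg_part (x + z) * indicator {0<..} x)) = (\<lambda>x. 0)"
    using z by (auto simp: fun_eq_iff neg_part_def indicator_def)
  with 1 show "(\<integral>\<^sup>+ x. ennreal (neg_part (x + z) * indicator {0<..} x) \<partial>lborel) + (\<integral>\<^sup>+ x. ennreal (neg_part (x - z) * indicator {0<..} x) \<partial>lborel) = ennreal (z\<^sup>2 / 2)"
    by simp
next
  fix n
  show "continuous_on UNIV (\<lambda>p. neg_part (snd p) * min 1 (real n * max (fst p) 0))"
    unfolding neg_part_def by (intro continuous_intros)
  show "0 \<le> neg_part (snd p) * min 1 (real n * max (fst p) 0)" for p :: "real \<times> real" by (simp add: neg_part_def)
next
  fix p :: "real \<times> real"
  show "incseq (\<lambda>n. neg_part (snd p) * min 1 (real n * max (fst p) 0))"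
    by (intro incseq_SucI mult_left_mono min.mono mult_right_mono order_refl) (auto simp: neg_part_def)
  show "(\<lambda>n. neg_part (snd p) * min 1 (real n * max (fst p) 0)) \<longlonglongrightarrow> neg_part (snd p) * indicator {0<..} (fst p)"
    by (intro tendsto_mult tendsto_const tendsto_min_mult_indicator)
qed

lemma neg_part_uminus: "neg_part (- x) = pos_part x"
  by (simp add: neg_part_def pos_part_def)

lemma indicator_uminus: "indicator {0<..} (- x) = (indicator {..<0} x :: real)" for x :: real
  by (simp add: indicator_def)

lemma crossing_functional_I42: "crossing_functional (\<lambda>x y. pos_part x * indicator {..<0} y)"
  using crossing_functional_reflect[OF crossing_functional_I41] unfolding neg_part_uminus indicator_uminus .

lemma crossing_functional_I32: "crossing_functional (\<lambda>x y. pos_part y * indicator {..<0} x)"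
  using crossing_functional_reflect[OF crossing_functional_I31] unfolding neg_part_uminus indicator_uminus .

lemma convergence_to_local_time:
  assumes BM: "standard_brownian_motion M X" and lt: "local_time_family M X L" and f: "crossing_functional f"
    and I: "\<And>\<epsilon> t \<omega>. I \<epsilon> t \<omega> = 1 / \<epsilon> * (LINT u:{0..t}|lborel. f (X u \<omega>) (X (min (u + \<epsilon>) t) \<omega>))"
  shows "ucp_tendsto M I (\<lambda>t \<omega>. 1 / 4 * L 0 t \<omega>) (at_right 0)"
    and "0 < T \<Longrightarrow> 0 < \<delta> \<Longrightarrow> \<delta> < 1 / 2 \<Longrightarrow> \<exists>C. \<forall>\<epsilon>\<in>{0<..1}. L2_norm_le M (sup_dist T (I \<epsilon>) (\<lambda>t \<omega>. 1 / 4 * L 0 t \<omega>)) (C * \<epsilon> powr (\<delta> / 2))"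
proof -
  interpret standard_brownian_motion M X by fact
  interpret crossing_functional f by fact
  interpret brownian_crossing M X f by unfold_locales
  have eq: "sup_dist T (I \<epsilon>) Z = sup_dist T (stopped_crossing \<epsilon>) Z" if "0 < \<epsilon>" for T \<epsilon> Z
  proof -
    have "I \<epsilon> t \<omega> = stopped_crossing \<epsilon> t \<omega>" if "0 \<le> t" for t \<omega>
      unfolding I stopped_crossing_def
      by (intro arg_cong2[where f = times] refl set_lebesgue_integral_cong) (use that \<open>0 < \<epsilon>\<close> in \<open>auto simp: path_eq\<close>)
    then show ?thesis unfolding sup_dist_def fun_eq_iff by (intro allI SUP_cong) auto
  qed
  have ev: "\<forall>\<^sub>F \<epsilon> :: real in at_right 0. 0 < \<epsilon>" by (rule eventually_at_right_less)
  show "ucp_tendsto M I (\<lambda>t \<omega>. 1 / 4 * L 0 t \<omega>) (at_right 0)"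
    unfolding ucp_tendsto_def
  proof (intro allI impI conjI)
    fix T :: real assume T: "0 < T"
    show "\<forall>\<^sub>F \<epsilon> in at_right 0. sup_dist T (I \<epsilon>) (\<lambda>t \<omega>. 1 / 4 * L 0 t \<omega>) \<in> borel_measurable M"
      using ev
    proof eventually_elim
      case (elim \<epsilon>)
      show ?case unfolding eq[OF elim] by (rule sup_dist_stopped_crossing_measurable[OF lt T elim])
    qed
    fix \<eta> :: real assume \<eta>: "0 < \<eta>"
    have "((\<lambda>\<epsilon>. measure M {\<omega> \<in> space M. ennreal \<eta> < sup_dist T (stopped_crossing \<epsilon>) (\<lambda>t \<omega>. 1 / 4 * L 0 t \<omega>) \<omega>}) \<longlongrightarrow> 0) (at_right 0)"
      using stopped_crossing_ucp[OF lt] T \<eta> unfolding ucp_tendsto_def by blast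
    then show "((\<lambda>\<epsilon>. measure M {\<omega> \<in> space M. ennreal \<eta> < sup_dist T (I \<epsilon>) (\<lambda>t \<omega>. 1 / 4 * L 0 t \<omega>) \<omega>}) \<longlongrightarrow> 0) (at_right 0)"
      by (rule Lim_transform_eventually) (use ev in eventually_elim, simp add: eq)
  qed
  assume "0 < T" "0 < \<delta>" "\<delta> < 1 / 2"
  from stopped_crossing_L2_rate[OF lt this]
  show "\<exists>C. \<forall>\<epsilon>\<in>{0<..1}. L2_norm_le M (sup_dist T (I \<epsilon>) (\<lambda>t \<omega>. 1 / 4 * L 0 t \<omega>)) (C * \<epsilon> powr (\<delta> / 2))"
    by (simp add: eq)
qed

lemma L2_norm_le_mono:
  "L2_norm_le M S c \<Longrightarrow> c \<le> c' \<Longrightarrow> L2_norm_le M S c'"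
  unfolding L2_norm_le_def by (meson ennreal_leI order_trans)

theorem theorem1p4:
  fixes M :: "'a measure" and X :: "real \<Rightarrow> 'a \<Rightarrow> real" and L :: "real \<Rightarrow> real \<Rightarrow> 'a \<Rightarrow> real"
  assumes "standard_brownian_motion M X"
    and "local_time_family M X L"
  shows "ucp_tendsto M (I31 X) (\<lambda>t \<omega>. 1 / 4 * L 0 t \<omega>) (at_right 0) \<and>
    ucp_tendsto M (I32 X) (\<lambda>t \<omega>. 1 / 4 * L 0 t \<omega>) (at_right 0) \<and>
    ucp_tendsto M (I41 X) (\<lambda>t \<omega>. 1 / 4 * L 0 t \<omega>) (at_right 0) \<and>
    ucp_tendsto M (I42 X) (\<lambda>t \<omega>. 1 / 4 * L 0 t \<omega>) (at_right 0) \<and>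
    (\<forall>T>0. \<forall>\<delta>\<in>{0<..<1/2}. \<exists>C. \<forall>\<epsilon>\<in>{0<..1}. \<forall>I\<in>{I41, I42}.
      L2_norm_le M (sup_dist T (I X \<epsilon>) (\<lambda>t \<omega>. 1 / 4 * L 0 t \<omega>)) (C * \<epsilon> powr (\<delta> / 2)))"
proof (intro conjI allI impI ballI)
  note conv = convergence_to_local_time[OF assms]
  show "ucp_tendsto M (I31 X) (\<lambda>t \<omega>. 1 / 4 * L 0 t \<omega>) (at_right 0)"
    by (rule conv(1)[OF crossing_functional_I31]) (rule I31_def)
  show "ucp_tendsto M (I32 X) (\<lambda>t \<omega>. 1 / 4 * L 0 t \<omega>) (at_right 0)"
    by (rule conv(1)[OF crossing_functional_I32]) (rule I32_def)
  show "ucp_tendsto M (I41 X) (\<lambda>t \<omega>. 1 / 4 * L 0 t \<omega>) (at_right 0)"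
    by (rule conv(1)[OF crossing_functional_I41]) (rule I41_def)
  show "ucp_tendsto M (I42 X) (\<lambda>t \<omega>. 1 / 4 * L 0 t \<omega>) (at_right 0)"
    by (rule conv(1)[OF crossing_functional_I42]) (rule I42_def)
  fix T \<delta> :: real assume T: "0 < T" and "\<delta> \<in> {0<..<1/2}"
  then have \<delta>: "0 < \<delta>" "\<delta> < 1 / 2" by auto
  obtain C where C: "\<And>\<epsilon>. \<epsilon> \<in> {0<..1} \<Longrightarrow> L2_norm_le M (sup_dist T (I41 X \<epsilon>) (\<lambda>t \<omega>. 1 / 4 * L 0 t \<omega>)) (C * \<epsilon> powr (\<delta> / 2))"
    using conv(2)[OF crossing_functional_I41, where I = "I41 X", OF I41_def T \<delta>] by blast
  obtain D where D: "\<And>\<epsilon>. \<epsilon> \<in> {0<..1} \<Longrightarrow> L2_norm_le M (sup_dist T (I42 X \<epsilon>) (\<lambda>t \<omega>. 1 / 4 * L 0 t \<omega>)) (D * \<epsilon> powr (\<delta> / 2))"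
    using conv(2)[OF crossing_functional_I42, where I = "I42 X", OF I42_def T \<delta>] by blast
  show "\<exists>C. \<forall>\<epsilon>\<in>{0<..1}. \<forall>I\<in>{I41, I42}. L2_norm_le M (sup_dist T (I X \<epsilon>) (\<lambda>t \<omega>. 1 / 4 * L 0 t \<omega>)) (C * \<epsilon> powr (\<delta> / 2))"
  proof (intro exI[of _ "max C D"] ballI)
    fix \<epsilon> :: real and I :: "(real \<Rightarrow> 'a \<Rightarrow> real) \<Rightarrow> real \<Rightarrow> real \<Rightarrow> 'a \<Rightarrow> real"
    assume \<epsilon>: "\<epsilon> \<in> {0<..1}" and "I \<in> {I41, I42}"
    then consider "I = I41" | "I = I42" by blast
    then show "L2_norm_le M (sup_dist T (I X \<epsilon>) (\<lambda>t \<omega>. 1 / 4 * L 0 t \<omega>)) (max C D * \<epsilon> powr (\<delta> / 2))"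
    proof cases
      case 1
      show ?thesis unfolding 1 by (rule L2_norm_le_mono[OF C[OF \<epsilon>]]) (intro mult_right_mono, auto)
    next
      case 2
      show ?thesis unfolding 2 by (rule L2_norm_le_mono[OF D[OF \<epsilon>]]) (intro mult_right_mono, auto)
    qed
  qed
qed

end
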